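(* Assume the model accuracy, preconditioner and regularity conditions given in the context. Assume that $\phi$ is bounded from below ($\phi^*>-\infty$) and that every sublevel set $\{x\in\mathbb{R}^d : \phi(x)\le t\}$, $t\in\mathbb{R}$, is bounded. Assume further that there exist a continuous nondecreasing function $\mathsf{G}:\mathbb{R}_+\to\mathbb{R}_+$ and a measurable function $\overline{L}_\varphi:\mathcal{S}\to\mathbb{R}_+$ with $\sqrt{\mathbb{E}_{s\sim P}[\overline{L}_\varphi(s)^2]}\le \overline{L}_\phi$ for some constant $\overline{L}_\phi\in\mathbb{R}_+$ such that for $P$-almost all $s\in\mathcal{S}$, $$|\varphi_x(y;s)-\varphi_x(z;s)|\le \overline{L}_\varphi(s)\,\mathsf{G}(\max\{\|x\|_2,\|y\|_2\})\,\|y-z\|_2$$ for all $x,y\in V$ and all $z$ in a neighborhood of $y$. Let $\{x_k\}$ be generated by the model-based ispPPA algorithm with stepsizes $\{\alpha_k\}$ and parameters $\{\epsilon_k\}$. Put $\eta=L_\infty^2\overline{\eta}$, $\tau=L_\infty^2\overline{\tau}$, $B_\rho=\sup_{k\in\mathbb{Z}_+}\rho_k^2$. Suppose that there exist $\gamma\in\mathbb{R}_+$ and $\overline{\rho}>B_\rho(\eta+2\tau)$ such that $$\alpha_k=\frac{\overline{\alpha}_k}{\max\{1,\mathsf{G}(\|x_k\|_2)\}},\qquad \epsilon_k=\gamma\alpha_k^2\quad\text{for all }k\in\mathbb{Z}_+,$$ where $\sup_{k\in\mathbb{Z}_+}\overline{\alpha}_k<(2\overline{\rho})^{-1}$ and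 $\sum_{k=1}^\infty\overline{\alpha}_k^2<\infty$. Then $\sup_{k\in\mathbb{Z}_+}\|x_k\|_2<\infty$ with probability $1$. Furthermore, if $\sum_{k=1}^\infty\overline{\alpha}_k=\infty$, then $$\liminf_{k\to\infty}\left\|\nabla e^{M_{k-1}}_{(\overline{\rho})^{-1}\phi}(x_k)\right\|_2=0\quad\text{with probability }1.$$
   Context: Notation: $\mathbb{Z}_+=\{1,2,\dots\}$, $\mathbb{R}_+=[0,\infty)$, $\mathbb{R}_{++}=(0,\infty)$. For a self-adjoint positive-definite linear map $M$ on $\mathbb{R}^d$: $\|x\|_M^2=\langle x,Mx\rangle$, $\mathrm{dist}_M(x,X)=\inf_{y\in X}\|x-y\|_M$; for $p:\mathbb{R}^d\to(-\infty,+\infty]$ proper closed and $\alpha>0$, $e^M_{\alpha p}(x)=\min_y\{p(y)+\frac1{2\alpha}\|y-x\|_M^2\}$ and $\mathrm{prox}^M_{\alpha p}(x)$ is the corresponding argmin (superscript omitted when $M=I_d$). $p$ is $\overline{\tau}$-weakly convex if $p+\frac{\overline{\tau}}2\|\cdot\|_2^2$ is convex; $\partial p$ is the regular (Fréchet) subdifferential. Problem: minimize $\phi(x)=F(x)+r(x)$ over $\mathbb{R}^d$, $F(x)=\mathbb{E}_{s\sim P}[f(x;s)]$, $P$ a distribution on a sample space $\mathcal{S}$, $r:\mathbb{R}^d\to(-\infty,+\infty]$. $\phi^*=\inf\phi$. Model functions: $V$ is an open convex set containing $\mathrm{dom}(r)$, and $(x,y,s)\mapsto f_x(y;s)$ is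 a measurable function on $V\times V\times\mathcal{S}$; $\varphi_x(y;s)=f_x(y;s)+r(y)$, with value $+\infty$ for $y\notin\mathrm{dom}(r)$. For a minibatch $S_k^{1:m}=\{S_k^i\}_{i=1}^m$: $\overline{f}_{x_k}(x;S_k^{1:m})=\frac1m\sum_{i=1}^m f_{x_k}(x;S_k^i)$, $\overline{\varphi}_{x_k}(x;S_k^{1:m})=\overline{f}_{x_k}(x;S_k^{1:m})+r(x)$. Model-based ispPPA algorithm: given $x_1$, stepsizes $\alpha_k>0$, accuracies $\epsilon_k\ge0$, minibatch size $m$ and self-adjoint positive-definite linear maps (preconditioners) $M_k$, which may depend on the sampled minibatches, at iteration $k=1,2,\dots$ draw $S_k^1,\dots,S_k^m$ i.i.d. from $P$ and let $x_{k+1}$ be an approximate minimizer of $\Phi_k(x)=\overline{\varphi}_{x_k}(x;S_k^{1:m})+\frac1{2\alpha_k}\|x-x_k\|_{M_k}^2$ satisfying one of: (a) $\|x_{k+1}-\tilde{x}_{k+1}\|_{M_k}\le\epsilon_k$, where $\tilde{x}_{k+1}=\mathrm{prox}^{M_k}_{\alpha_k\overline{\varphi}_{x_k}(\cdot;S_k^{1:m})}(x_k)$; (b) $\Phi_k(x_{k+1})-\min\Phi_k\le\frac{1-\tau\alpha_k}{2\alpha_k}\epsilon_k^2$; (c) $\mathrm{dist}_{M_k^{-1}}(0,\partial\Phi_k(x_{k+1}))\le\frac{1-\tau\alpha_k}{\alpha_k}\epsilon_k$; here $\tau=L_\infty^2\overline{\tau}$. $\mathcal{F}_k=\sigma(S_1^{1:m},\dots,S_k^{1:m})$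 and $\mathbb{E}_k[\cdot]=\mathbb{E}[\cdot\mid\mathcal{F}_{k-1}]$. Model accuracy condition: there is a scalar $\overline{\eta}$ such that for $P$-almost all $s$, $f_x(x;s)=f(x;s)$ and $|f_x(y;s)-f(y;s)|\le\frac{\overline{\eta}}2\|y-x\|_2^2$ for all $x,y\in V$. Preconditioner condition: there are $\mu_\infty\in(0,1]$, $L_\infty\in[1,\infty)$ such that for every $k\in\mathbb{Z}_+$, $\mu_k\|x\|_{M_k}\le\|x\|_2\le L_k\|x\|_{M_k}$ for all $x\in\mathbb{R}^d$, with $\mu_k\in[\mu_\infty,\infty)$, $L_k\in(0,L_\infty]$; and $\rho_k^{-2}\le\mathbb{E}_k\big[\|x\|_{M_k}^2/\|x\|_{M_{k-1}}^2\big]\le\rho_k^2$ for all $x\ne0$, with $\rho_k\in[1,\infty)$ and $\nu_k=\prod_{i=0}^{k-1}\rho_i\nearrow\nu_\infty=\prod_{i=0}^\infty\rho_i<\infty$; by definition $M_0=I_d$, $\mu_0=L_0=\rho_0=1$. Regularity condition: $F:\mathbb{R}^d\to\mathbb{R}$ is locally Lipschitz, $r$ is proper closed, and for $P$-almost all $s$, $f(\cdot;s):\mathbb{R}^d\to(-\infty,+\infty]$ is proper closed with $\mathrm{dom}(f(\cdot;s))\supset\mathrm{dom}(r)$, and $\varphi_x(\cdot;s)$ is $\overline{\tau}$-weakly convex for all $x\in V$, where $\overline{\tau}\in\mathbb{R}_+$ is a constant. *)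

theory Defs
  imports "HOL-Probability.Probability"
begin

section \<open>Extended-real-valued functions\<close>

definition edom :: "('a \<Rightarrow> ereal) \<Rightarrow> 'a set" where
  "edom p = {x. p x < \<infinity>}"

definition proper_fun :: "('a \<Rightarrow> ereal) \<Rightarrow> bool" where
  "proper_fun p \<longleftrightarrow> (\<forall>x. p x \<noteq> -\<infinity>) \<and> edom p \<noteq> {}"

text \<open>The library's \<^const>\<open>epigraph\<close> is for real-valued functions only; as usual in convex
  analysis, closedness and convexity of extended-real-valued functions are those of the epigraph.\<close>

definition eepigraph :: "('a \<Rightarrow> ereal) \<Rightarrow> ('a \<times> real) set" where
  "eepigraph p = {(x, t). p x \<le> ereal t}"

definition closed_fun :: "('a::topological_space \<Rightarrow> ereal) \<Rightarrow> bool" where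
  "closed_fun p \<longleftrightarrow> closed (eepigraph p)"

definition convex_fun :: "('a::real_vector \<Rightarrow> ereal) \<Rightarrow> bool" where
  "convex_fun p \<longleftrightarrow> convex (eepigraph p)"

definition weakly_convex :: "real \<Rightarrow> ('a::real_normed_vector \<Rightarrow> ereal) \<Rightarrow> bool" where
  "weakly_convex \<tau> p \<longleftrightarrow> convex_fun (\<lambda>x. p x + ereal (\<tau> / 2 * (norm x)\<^sup>2))"

text \<open>Regular (Frechet) subdifferential:
  \<open>p y \<ge> p x + \<langle>v, y - x\<rangle> + o(\<parallel>y - x\<parallel>)\<close>; it is empty where \<open>p\<close> is not finite.\<close>

definition subdifferential :: "('a::real_inner \<Rightarrow> ereal) \<Rightarrow> 'a \<Rightarrow> 'a set" where
  "subdifferential p x =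
     {v. \<bar>p x\<bar> \<noteq> \<infinity> \<and>
         (\<forall>e>0. \<forall>\<^sub>F y in nhds x. p y \<ge> p x + ereal (v \<bullet> (y - x) - e * norm (y - x)))}"

definition locally_lipschitz :: "('a::metric_space \<Rightarrow> real) \<Rightarrow> bool" where
  "locally_lipschitz h \<longleftrightarrow> (\<forall>x. \<exists>u>0. \<exists>C. C-lipschitz_on (ball x u) h)"

text \<open>Meaningful only at points of differentiability.\<close>

definition gradient :: "('a::real_inner \<Rightarrow> real) \<Rightarrow> 'a \<Rightarrow> 'a" where
  "gradient h x = (THE g. GDERIV h x :> g)"

section \<open>Preconditioned norms, Moreau envelopes and proximal maps\<close>

definition spd :: "('a::real_inner \<Rightarrow> 'a) \<Rightarrow> bool" where
  "spd M \<longleftrightarrow> linear M \<and> (\<forall>x y. x \<bullet> M y = M x \<bullet> y) \<and> (\<forall>x. x \<noteq> 0 \<longrightarrow> x \<bullet> M x > 0)"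

definition mnorm :: "('a::real_inner \<Rightarrow> 'a) \<Rightarrow> 'a \<Rightarrow> real" where
  "mnorm M x = sqrt (x \<bullet> M x)"

text \<open>Extended-real-valued, so that the distance to the empty set is \<open>\<infinity>\<close>.\<close>

definition mdist :: "('a::real_inner \<Rightarrow> 'a) \<Rightarrow> 'a \<Rightarrow> 'a set \<Rightarrow> ereal" where
  "mdist M x X = (INF y\<in>X. ereal (mnorm M (x - y)))"

definition prox_objective ::
    "('a::real_inner \<Rightarrow> 'a) \<Rightarrow> real \<Rightarrow> ('a \<Rightarrow> ereal) \<Rightarrow> 'a \<Rightarrow> 'a \<Rightarrow> ereal" where
  "prox_objective M \<alpha> p x y = p y + ereal (1 / (2 * \<alpha>) * (mnorm M (y - x))\<^sup>2)"

text \<open>\<open>envelope M \<alpha> p\<close> is the Moreau envelope of \<open>\<alpha> p\<close> in the metric \<open>M\<close>.\<close>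

definition envelope ::
    "('a::real_inner \<Rightarrow> 'a) \<Rightarrow> real \<Rightarrow> ('a \<Rightarrow> ereal) \<Rightarrow> 'a \<Rightarrow> ereal" where
  "envelope M \<alpha> p x = (INF y. prox_objective M \<alpha> p x y)"

text \<open>The set of minimizers; in the intended use it is a singleton, by strong convexity.\<close>

definition prox ::
    "('a::real_inner \<Rightarrow> 'a) \<Rightarrow> real \<Rightarrow> ('a \<Rightarrow> ereal) \<Rightarrow> 'a \<Rightarrow> 'a set" where
  "prox M \<alpha> p x = {z. is_arg_min (prox_objective M \<alpha> p x) (\<lambda>_. True) z}"

section \<open>The problem and its models\<close>

definition expected_loss :: "'s measure \<Rightarrow> ('a \<Rightarrow> 's \<Rightarrow> ereal) \<Rightarrow> 'a \<Rightarrow> real" where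
  "expected_loss P f x = (\<integral>s. real_of_ereal (f x s) \<partial>P)"

definition objective ::
    "'s measure \<Rightarrow> ('a \<Rightarrow> 's \<Rightarrow> ereal) \<Rightarrow> ('a \<Rightarrow> ereal) \<Rightarrow> 'a \<Rightarrow> ereal" where
  "objective P f r x = ereal (expected_loss P f x) + r x"

text \<open>A model family \<open>fm x y s\<close> is the value at \<open>y\<close> of the model of \<open>f(\<cdot>; s)\<close> built at \<open>x\<close>.
  Its values off \<open>V \<times> V\<close> are irrelevant: \<open>r = \<infinity>\<close> off \<open>V\<close>, hence so is \<open>model_obj\<close>.\<close>

definition model_family ::
    "'s measure \<Rightarrow> ('a::euclidean_space \<Rightarrow> ereal) \<Rightarrow> 'a set \<Rightarrow> ('a \<Rightarrow> 'a \<Rightarrow> 's \<Rightarrow> real) \<Rightarrow> bool" where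
  "model_family P r V fm \<longleftrightarrow>
     open V \<and> convex V \<and> edom r \<subseteq> V \<and>
     (\<lambda>(x, y, s). fm x y s) \<in>
       borel_measurable (restrict_space borel V \<Otimes>\<^sub>M restrict_space borel V \<Otimes>\<^sub>M P)"

definition model_obj ::
    "('a \<Rightarrow> 'a \<Rightarrow> 's \<Rightarrow> real) \<Rightarrow> ('a \<Rightarrow> ereal) \<Rightarrow> 'a \<Rightarrow> 'a \<Rightarrow> 's \<Rightarrow> ereal" where
  "model_obj fm r x y s = ereal (fm x y s) + r y"

definition minibatch_model ::
    "nat \<Rightarrow> ('a \<Rightarrow> 'a \<Rightarrow> 's \<Rightarrow> real) \<Rightarrow> 'a \<Rightarrow> 'a \<Rightarrow> (nat \<Rightarrow> 's) \<Rightarrow> real" where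
  "minibatch_model m fm x y ss = 1 / real m * (\<Sum>i=1..m. fm x y (ss i))"

definition minibatch_obj ::
    "nat \<Rightarrow> ('a \<Rightarrow> 'a \<Rightarrow> 's \<Rightarrow> real) \<Rightarrow> ('a \<Rightarrow> ereal) \<Rightarrow> 'a \<Rightarrow> 'a \<Rightarrow> (nat \<Rightarrow> 's) \<Rightarrow> ereal" where
  "minibatch_obj m fm r x y ss = ereal (minibatch_model m fm x y ss) + r y"

definition model_accuracy ::
    "'s measure \<Rightarrow> ('a::euclidean_space \<Rightarrow> 's \<Rightarrow> ereal) \<Rightarrow> 'a set \<Rightarrow> ('a \<Rightarrow> 'a \<Rightarrow> 's \<Rightarrow> real)
      \<Rightarrow> real \<Rightarrow> bool" where
  "model_accuracy P f V fm \<eta> \<longleftrightarrow>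
     (AE s in P. \<forall>x\<in>V. \<forall>y\<in>V.
        ereal (fm x x s) = f x s \<and>
        \<bar>ereal (fm x y s) - f y s\<bar> \<le> ereal (\<eta> / 2 * (norm (y - x))\<^sup>2))"

text \<open>The first two conjuncts under the quantifier over \<open>x\<close> and the integrability say that
  \<open>F(x) = E[f(x; s)]\<close> is well defined and finite at every \<open>x\<close>; without them
  \<^const>\<open>expected_loss\<close> could be a dummy value.\<close>

definition regularity ::
    "'s measure \<Rightarrow> ('a::euclidean_space \<Rightarrow> 's \<Rightarrow> ereal) \<Rightarrow> ('a \<Rightarrow> ereal) \<Rightarrow> 'a set
      \<Rightarrow> ('a \<Rightarrow> 'a \<Rightarrow> 's \<Rightarrow> real) \<Rightarrow> real \<Rightarrow> bool" where
  "regularity P f r V fm \<tau> \<longleftrightarrow>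
     (\<forall>x. f x \<in> borel_measurable P \<and> (AE s in P. \<bar>f x s\<bar> \<noteq> \<infinity>) \<and>
          integrable P (\<lambda>s. real_of_ereal (f x s))) \<and>
     locally_lipschitz (expected_loss P f) \<and>
     proper_fun r \<and> closed_fun r \<and>
     (AE s in P.
        proper_fun (\<lambda>x. f x s) \<and> closed_fun (\<lambda>x. f x s) \<and> edom r \<subseteq> edom (\<lambda>x. f x s) \<and>
        (\<forall>x\<in>V. weakly_convex \<tau> (\<lambda>y. model_obj fm r x y s))) \<and>
     \<tau> \<ge> 0"

text \<open>\<open>z\<close> ranges over a neighborhood of \<open>y\<close> that may depend on \<open>x\<close>, \<open>y\<close> and \<open>s\<close>.\<close>

definition local_lipschitz_growth ::
    "'s measure \<Rightarrow> ('a::euclidean_space \<Rightarrow> ereal) \<Rightarrow> 'a set \<Rightarrow> ('a \<Rightarrow> 'a \<Rightarrow> 's \<Rightarrow> real)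
      \<Rightarrow> ('s \<Rightarrow> real) \<Rightarrow> (real \<Rightarrow> real) \<Rightarrow> bool" where
  "local_lipschitz_growth P r V fm L\<phi> G \<longleftrightarrow>
     (AE s in P. \<forall>x\<in>V. \<forall>y\<in>V. \<forall>\<^sub>F z in nhds y.
        \<bar>model_obj fm r x y s - model_obj fm r x z s\<bar>
          \<le> ereal (L\<phi> s * G (max (norm x) (norm y)) * norm (y - z)))"

section \<open>The algorithm\<close>

text \<open>\<open>S k i \<omega>\<close> is the \<open>i\<close>-th sample (\<open>1 \<le> i \<le> m\<close>) drawn at iteration \<open>k \<ge> 1\<close>;
  \<open>minibatch_filtration \<Omega> P m S k\<close> is the sigma-algebra generated by the first \<open>k\<close> minibatches.\<close>

definition iid_minibatches ::
    "'w measure \<Rightarrow> 's measure \<Rightarrow> nat \<Rightarrow> (nat \<Rightarrow> nat \<Rightarrow> 'w \<Rightarrow> 's) \<Rightarrow> bool" where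
  "iid_minibatches \<Omega> P m S \<longleftrightarrow>
     prob_space.indep_vars \<Omega> (\<lambda>_. P) (\<lambda>(k, i). S k i) ({1..} \<times> {1..m}) \<and>
     (\<forall>k\<ge>1. \<forall>i\<in>{1..m}. distr \<Omega> P (S k i) = P)"

definition minibatch_filtration ::
    "'w measure \<Rightarrow> 's measure \<Rightarrow> nat \<Rightarrow> (nat \<Rightarrow> nat \<Rightarrow> 'w \<Rightarrow> 's) \<Rightarrow> nat \<Rightarrow> 'w measure" where
  "minibatch_filtration \<Omega> P m S k =
     sigma (space \<Omega>)
       {S j i -` A \<inter> space \<Omega> | j i A. j \<in> {1..k} \<and> i \<in> {1..m} \<and> A \<in> sets P}"

text \<open>Self-adjoint positive-definite maps \<open>M k \<omega>\<close>, where \<open>M k\<close> may depend on the first \<open>k\<close>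
  minibatches, the current one included.\<close>

definition preconditioners ::
    "'w measure \<Rightarrow> (nat \<Rightarrow> 'w measure) \<Rightarrow> (nat \<Rightarrow> 'w \<Rightarrow> 'a::euclidean_space \<Rightarrow> 'a) \<Rightarrow> bool" where
  "preconditioners \<Omega> \<F> M \<longleftrightarrow>
     (\<forall>\<omega>\<in>space \<Omega>. M 0 \<omega> = id) \<and>
     (\<forall>k. \<forall>\<omega>\<in>space \<Omega>. spd (M k \<omega>)) \<and>
     (\<forall>k v. (\<lambda>\<omega>. M k \<omega> v) \<in> borel_measurable (\<F> k))"

definition preconditioner_condition ::
    "'w measure \<Rightarrow> (nat \<Rightarrow> 'w measure) \<Rightarrow> (nat \<Rightarrow> 'w \<Rightarrow> 'a::euclidean_space \<Rightarrow> 'a)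
      \<Rightarrow> (nat \<Rightarrow> real) \<Rightarrow> (nat \<Rightarrow> real) \<Rightarrow> (nat \<Rightarrow> real) \<Rightarrow> real \<Rightarrow> real \<Rightarrow> bool" where
  "preconditioner_condition \<Omega> \<F> M \<mu> L \<rho> \<mu>inf Linf \<longleftrightarrow>
     0 < \<mu>inf \<and> \<mu>inf \<le> 1 \<and> 1 \<le> Linf \<and>
     \<mu> 0 = 1 \<and> L 0 = 1 \<and> \<rho> 0 = 1 \<and>
     (\<forall>k\<ge>1. \<mu>inf \<le> \<mu> k \<and> 0 < L k \<and> L k \<le> Linf \<and> 1 \<le> \<rho> k \<and>
        (AE \<omega> in \<Omega>. \<forall>v. \<mu> k * mnorm (M k \<omega>) v \<le> norm v \<and> norm v \<le> L k * mnorm (M k \<omega>) v) \<and>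
        (\<forall>v. v \<noteq> 0 \<longrightarrow>
          (AE \<omega> in \<Omega>.
             let E = real_cond_exp \<Omega> (\<F> (k - 1))
                       (\<lambda>\<omega>. (mnorm (M k \<omega>) v)\<^sup>2 / (mnorm (M (k - 1) \<omega>) v)\<^sup>2) \<omega>
             in 1 / (\<rho> k)\<^sup>2 \<le> E \<and> E \<le> (\<rho> k)\<^sup>2))) \<and>
     convergent_prod \<rho>"

text \<open>The subproblem objective is \<open>prox_objective M \<alpha> p x\<close> with \<open>p\<close> the minibatch model
  objective at the current iterate \<open>x\<close>; \<open>x'\<close> is the next iterate.\<close>

definition inexact_prox_step ::
    "real \<Rightarrow> ('a::euclidean_space \<Rightarrow> 'a) \<Rightarrow> real \<Rightarrow> real \<Rightarrow> ('a \<Rightarrow> ereal) \<Rightarrow> 'a \<Rightarrow> 'a \<Rightarrow> bool" where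
  "inexact_prox_step \<tau> M \<alpha> \<epsilon> p x x' \<longleftrightarrow>
     (\<exists>z\<in>prox M \<alpha> p x. mnorm M (x' - z) \<le> \<epsilon>) \<or>
     prox_objective M \<alpha> p x x' - (INF y. prox_objective M \<alpha> p x y)
       \<le> ereal ((1 - \<tau> * \<alpha>) / (2 * \<alpha>) * \<epsilon>\<^sup>2) \<or>
     mdist (inv M) 0 (subdifferential (prox_objective M \<alpha> p x) x')
       \<le> ereal ((1 - \<tau> * \<alpha>) / \<alpha> * \<epsilon>)"

text \<open>Iterates are indexed from \<open>1\<close> and must lie in \<open>V\<close>, since the model built at \<open>x k \<omega>\<close> is
  defined only there.  The step holds almost surely, as the models are well behaved only for
  \<open>P\<close>-almost all samples.\<close>

definition ispPPA ::
    "'w measure \<Rightarrow> 's measure \<Rightarrow> nat \<Rightarrow> (nat \<Rightarrow> nat \<Rightarrow> 'w \<Rightarrow> 's)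
      \<Rightarrow> ('a::euclidean_space \<Rightarrow> ereal) \<Rightarrow> 'a set \<Rightarrow> ('a \<Rightarrow> 'a \<Rightarrow> 's \<Rightarrow> real) \<Rightarrow> real
      \<Rightarrow> (nat \<Rightarrow> 'w \<Rightarrow> 'a \<Rightarrow> 'a) \<Rightarrow> (nat \<Rightarrow> 'w \<Rightarrow> real) \<Rightarrow> (nat \<Rightarrow> 'w \<Rightarrow> real)
      \<Rightarrow> 'a \<Rightarrow> (nat \<Rightarrow> 'w \<Rightarrow> 'a) \<Rightarrow> bool" where
  "ispPPA \<Omega> P m S r V fm \<tau> M \<alpha> \<epsilon> x1 x \<longleftrightarrow>
     m \<ge> 1 \<and> iid_minibatches \<Omega> P m S \<and>
     preconditioners \<Omega> (minibatch_filtration \<Omega> P m S) M \<and>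
     (\<forall>k\<ge>1. \<forall>\<omega>\<in>space \<Omega>. 0 < \<alpha> k \<omega> \<and> 0 \<le> \<epsilon> k \<omega>) \<and>
     x1 \<in> V \<and> (\<forall>\<omega>\<in>space \<Omega>. x 1 \<omega> = x1) \<and>
     (\<forall>k\<ge>1.
        x (Suc k) \<in> borel_measurable (minibatch_filtration \<Omega> P m S k) \<and>
        (AE \<omega> in \<Omega>. x (Suc k) \<omega> \<in> V \<and>
           inexact_prox_step \<tau> (M k \<omega>) (\<alpha> k \<omega>) (\<epsilon> k \<omega>)
             (\<lambda>y. minibatch_obj m fm r (x k \<omega>) y (\<lambda>i. S k i \<omega>)) (x k \<omega>) (x (Suc k) \<omega>)))"

end

theory Submission
  imports Defs
begin

text \<open>
The proof follows the Moreau envelope of the objective along the iterates, measured in the current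
metric.  Write \<open>y\<^sub>k\<close> for the minimizer of
\<open>\<phi> + \<rho>bar / 2 \<cdot> \<parallel>\<cdot> - x\<^sub>k\<parallel>\<^sup>2\<close> in the metric \<open>M\<^sub>k\<^sub>-\<^sub>1\<close>, and \<open>D\<^sub>k\<close> for the squared distance
from \<open>x\<^sub>k\<close> to \<open>y\<^sub>k\<close> in that metric.  The envelope at \<open>x\<^sub>k\<close> is \<open>\<phi> y\<^sub>k + \<rho>bar / 2 \<cdot> D\<^sub>k\<close>, and its
gradient has norm of order \<open>sqrt D\<^sub>k\<close>.

Two effects make the envelope decrease in conditional mean.  First, the objective is weakly convex:
at each point it is touched from below, up to a quadratic error, by the mean of the weakly convex
models.  Hence \<open>\<rho>bar\<close> is large enough for the envelope problem to be strongly convex, and moving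
from \<open>x\<^sub>k\<close> to \<open>y\<^sub>k\<close> lowers \<open>\<phi>\<close> by a multiple of \<open>D\<^sub>k\<close>.  Second, a proximal step on the sampled model
brings the new iterate closer to \<open>y\<^sub>k\<close> in conditional mean, because the mean model inherits that decrease up
to a quadratic error.  Since \<open>y\<^sub>k\<close> is a
competitor in the next envelope problem, the two combine to
\<open>E[W\<^sub>k\<^sub>+\<^sub>1 | past] \<le> q\<^sub>k W\<^sub>k - \<delta>' \<alpha>\<^sub>k D\<^sub>k + b\<^sub>k\<close>, where \<open>W\<close> is the envelope minus a lower bound of \<open>\<phi>\<close>, the product
of the \<open>q\<^sub>k\<close> is finite and the \<open>b\<^sub>k\<close> are summable (\<open>recursion\<close>).  The random metric costs only a factor
\<open>\<rho>\<^sub>k\<^sup>2\<close> in this estimate, although it may depend on the current minibatch: the vector \<open>y\<^sub>k - x\<^sub>k\<close> is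
known before that minibatch is drawn (\<open>random_vector_norm_ratio\<close>).

The Robbins-Siegmund argument (\<open>almost_supermartingale_bounded_summable\<close>) gives that almost
surely \<open>W\<close> is bounded and \<open>\<alpha>\<^sub>k D\<^sub>k\<close> is summable.  Bounded sublevel sets turn the first statement into
boundedness of the iterates.  Then the growth function is bounded along the path, the actual
stepsizes are comparable to the nominal ones, and a divergent stepsize sum forces
\<open>liminf D\<^sub>k = 0\<close>.

Everything is done with real-valued functions on the whole space.  This loses nothing: a Lipschitz bound that is
uniform on bounded sets prevents the regularizer from blowing up at a boundary point of \<open>V\<close>, while
closedness forces it to, so \<open>V\<close> has no boundary (\<open>model_domain_is_everything\<close>).
\<close>

section \<open>The metric of a symmetric positive definite map\<close>

locale spd_map =
  fixes M :: "'a::euclidean_space \<Rightarrow> 'a"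
  assumes spd: "spd M"
begin

lemma lin: "linear M" and sym: "x \<bullet> M y = M x \<bullet> y" and pos: "x \<noteq> 0 \<Longrightarrow> x \<bullet> M x > 0"
  using spd by (auto simp: spd_def)

lemma nonneg: "0 \<le> x \<bullet> M x"
  using pos[of x] by (cases "x = 0") auto

lemma sym': "x \<bullet> M y = y \<bullet> M x"
  by (metis sym inner_commute)

lemma mnorm_nonneg: "0 \<le> mnorm M x"
  by (simp add: mnorm_def nonneg)

lemma mnorm_sq: "(mnorm M x)\<^sup>2 = x \<bullet> M x"
  by (simp add: mnorm_def nonneg)

lemma mnorm_sq_add: "(mnorm M (x + y))\<^sup>2 = (mnorm M x)\<^sup>2 + 2 * (x \<bullet> M y) + (mnorm M y)\<^sup>2"
  using sym'[of x y]
  by (simp add: mnorm_sq linear_add[OF lin] inner_add_left inner_add_right)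

lemma mnorm_sq_scale: "(mnorm M (c *\<^sub>R x))\<^sup>2 = c\<^sup>2 * (mnorm M x)\<^sup>2"
  unfolding mnorm_sq by (simp add: linear_scale[OF lin] power2_eq_square)

lemma mnorm_scale: "mnorm M (c *\<^sub>R x) = \<bar>c\<bar> * mnorm M x"
  by (rule power2_eq_imp_eq) (auto simp: mnorm_sq_scale power_mult_distrib mnorm_nonneg)

lemma mnorm_minus: "mnorm M (x - y) = mnorm M (y - x)"
  using mnorm_scale[of "-1" "x - y"] by simp

lemma mnorm_zero: "mnorm M 0 = 0"
  by (simp add: mnorm_def)

lemma cauchy_schwarz: "x \<bullet> M y \<le> mnorm M x * mnorm M y"
proof (cases "y = 0")
  case True
  then show ?thesis by (simp add: linear_0[OF lin] mnorm_zero)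
next
  case False
  define b where "b = mnorm M y"
  have b: "b > 0" using pos[OF False] by (simp add: b_def mnorm_def)
  have "0 \<le> (mnorm M (b *\<^sub>R x + (- mnorm M x) *\<^sub>R y))\<^sup>2" by simp
  also have "\<dots> = b\<^sup>2 * (mnorm M x)\<^sup>2 - 2 * (b * mnorm M x * (x \<bullet> M y)) + (mnorm M x)\<^sup>2 * b\<^sup>2"
    by (simp only: mnorm_sq_add mnorm_sq_scale)
       (simp add: linear_scale[OF lin] linear_neg[OF lin] b_def)
  finally have "b * mnorm M x * (x \<bullet> M y) \<le> b * mnorm M x * (mnorm M x * b)"
    by (simp add: power2_eq_square algebra_simps)
  then show ?thesis
    using b pos[of x] mnorm_zero nonneg[of x]
    by (cases "x = 0") (auto simp: b_def mnorm_def)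
qed

lemma mnorm_triangle: "mnorm M (x + y) \<le> mnorm M x + mnorm M y"
proof (rule power2_le_imp_le)
  show "(mnorm M (x + y))\<^sup>2 \<le> (mnorm M x + mnorm M y)\<^sup>2"
    using cauchy_schwarz[of x y] by (simp add: mnorm_sq_add power2_sum)
qed (simp add: mnorm_nonneg)

lemma continuous_mnorm: "continuous_on A (\<lambda>y. (mnorm M (y - x))\<^sup>2)"
  unfolding mnorm_sq by (intro continuous_intros linear_continuous_on_compose[OF _ lin])

lemma bij: "bij M"
proof -
  have "inj M"
    unfolding linear_injective_0[OF lin]
  proof (intro allI impI)
    fix v assume "M v = 0"
    then show "v = 0" using pos[of v] by (cases "v = 0") auto
  qed
  then show ?thesis
    using linear_injective_imp_surjective[OF lin] by (simp add: bij_def)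
qed

text \<open>The inverse map measures dual vectors; this is the form in which a small subgradient controls a
distance.\<close>

lemma dual_cauchy_schwarz: "v \<bullet> d \<le> mnorm (inv M) v * mnorm M d"
proof -
  define u where "u = inv M v"
  have v: "M u = v" using bij by (simp add: u_def bij_is_surj surj_f_inv_f)
  have "mnorm (inv M) v = mnorm M u"
    by (simp add: mnorm_def u_def[symmetric] v inner_commute)
  then show ?thesis using cauchy_schwarz[of d u] v by (simp add: inner_commute mult.commute)
qed

end

lemma spd_id: "spd (id :: 'a::euclidean_space \<Rightarrow> 'a)"
  by (auto simp: spd_def linear_id id_def[symmetric])

lemma mnorm_id: "mnorm id x = norm x"
  by (simp add: mnorm_def norm_eq_sqrt_inner)

section \<open>Curvature moduli relative to a metric\<close>

text \<open>Weak convexity (\<open>c < 0\<close>), convexity and strong convexity (\<open>c > 0\<close>) relative to the norm of \<open>M\<close> are one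
notion with a signed modulus \<open>c\<close>.  Moduli then simply add.\<close>

definition curved :: "('a::real_inner \<Rightarrow> 'a) \<Rightarrow> real \<Rightarrow> ('a \<Rightarrow> real) \<Rightarrow> bool" where
  "curved M c h \<longleftrightarrow> (\<forall>y z t. 0 \<le> t \<and> t \<le> 1 \<longrightarrow>
     h ((1 - t) *\<^sub>R y + t *\<^sub>R z) \<le> (1 - t) * h y + t * h z - c / 2 * (t * (1 - t)) * (mnorm M (z - y))\<^sup>2)"

lemma curvedD:
  assumes "curved M c h" "0 \<le> t" "t \<le> 1"
  shows "h ((1 - t) *\<^sub>R y + t *\<^sub>R z) \<le> (1 - t) * h y + t * h z - c / 2 * (t * (1 - t)) * (mnorm M (z - y))\<^sup>2"
  using assms unfolding curved_def by blast

lemma curved_add: "curved M b g \<Longrightarrow> curved M c h \<Longrightarrow> curved M (b + c) (\<lambda>y. g y + h y)" (is "_ \<Longrightarrow> _ \<Longrightarrow> ?thesis")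
proof -
  assume g: "curved M b g" and h: "curved M c h"
  show ?thesis
    unfolding curved_def
  proof (intro allI impI)
    fix y z and t :: real assume "0 \<le> t \<and> t \<le> 1"
    then show "g ((1 - t) *\<^sub>R y + t *\<^sub>R z) + h ((1 - t) *\<^sub>R y + t *\<^sub>R z)
        \<le> (1 - t) * (g y + h y) + t * (g z + h z) - (b + c) / 2 * (t * (1 - t)) * (mnorm M (z - y))\<^sup>2"
      using curvedD[OF g, of t y z] curvedD[OF h, of t y z]
      by (simp add: distrib_right distrib_left add_divide_distrib)
  qed
qed

lemma curved_cmult:
  assumes "curved M c h" "0 \<le> k"
  shows "curved M (k * c) (\<lambda>y. k * h y)"
  unfolding curved_def
proof (intro allI impI)
  fix y z and t :: real assume "0 \<le> t \<and> t \<le> 1"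
  with mult_left_mono[OF curvedD[OF assms(1)] assms(2), of t y z]
  show "k * h ((1 - t) *\<^sub>R y + t *\<^sub>R z)
      \<le> (1 - t) * (k * h y) + t * (k * h z) - k * c / 2 * (t * (1 - t)) * (mnorm M (z - y))\<^sup>2"
    by (simp add: algebra_simps)
qed

lemma curved_sum:
  assumes "\<And>i. i \<in> I \<Longrightarrow> curved M c (h i)"
  shows "curved M (real (card I) * c) (\<lambda>y. \<Sum>i\<in>I. h i y)"
proof (cases "finite I")
  case True
  then show ?thesis using assms
  proof (induction I)
    case empty
    then show ?case by (simp add: curved_def)
  next
    case (insert i I)
    have "curved M (c + real (card I) * c) (\<lambda>y. h i y + (\<Sum>i\<in>I. h i y))"
      using insert by (intro curved_add) auto
    then show ?case using insert by (simp add: algebra_simps)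
  qed
qed (simp add: curved_def)

context spd_map
begin

text \<open>Equality holds in the defining inequality, so the lemma applies with either sign of \<open>c\<close>; this is how a
quadratic can be both added and removed.\<close>

lemma curved_quadratic: "curved M c (\<lambda>y. c / 2 * (mnorm M (y - x))\<^sup>2)"
  unfolding curved_def
proof (intro allI impI)
  fix y z and t :: real assume "0 \<le> t \<and> t \<le> 1"
  define a b where "a = y - x" and "b = z - x"
  have e: "(1 - t) *\<^sub>R y + t *\<^sub>R z - x = (1 - t) *\<^sub>R a + t *\<^sub>R b"
    by (simp add: a_def b_def algebra_simps)
  have d: "z - y = b + (-1) *\<^sub>R a" by (simp add: a_def b_def)
  have "(mnorm M ((1 - t) *\<^sub>R a + t *\<^sub>R b))\<^sup>2
      = (1 - t) * (mnorm M a)\<^sup>2 + t * (mnorm M b)\<^sup>2 - t * (1 - t) * (mnorm M (b + (-1) *\<^sub>R a))\<^sup>2"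
    unfolding mnorm_sq_add mnorm_sq_scale using sym'[of a b]
    by (simp add: linear_scale[OF lin] linear_neg[OF lin] algebra_simps power2_eq_square)
  then have "c / 2 * (mnorm M ((1 - t) *\<^sub>R a + t *\<^sub>R b))\<^sup>2
      = c / 2 * ((1 - t) * (mnorm M a)\<^sup>2 + t * (mnorm M b)\<^sup>2 - t * (1 - t) * (mnorm M (b + (-1) *\<^sub>R a))\<^sup>2)"
    by (simp only:)
  then show "c / 2 * (mnorm M ((1 - t) *\<^sub>R y + t *\<^sub>R z - x))\<^sup>2
      \<le> (1 - t) * (c / 2 * (mnorm M (y - x))\<^sup>2) + t * (c / 2 * (mnorm M (z - x))\<^sup>2) -
         c / 2 * (t * (1 - t)) * (mnorm M (z - y))\<^sup>2"
    unfolding e d a_def[symmetric] b_def[symmetric]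
    by (simp only: distrib_left right_diff_distrib left_diff_distrib distrib_right mult.assoc
        mult.left_commute mult_1_left mult_1_right order_refl)
qed

lemma curved_continuous:
  assumes "curved M c h"
  shows "continuous_on A h"
proof -
  have c0: "curved M (c + (- c)) (\<lambda>y. h y + (- c) / 2 * (mnorm M (y - 0))\<^sup>2)"
    by (intro curved_add assms curved_quadratic)
  have "convex_on UNIV (\<lambda>y. h y + (- c) / 2 * (mnorm M (y - 0))\<^sup>2)"
  proof (rule convex_onI)
    fix t :: real and u v :: 'a assume "0 < t" "t < 1"
    then show "h ((1 - t) *\<^sub>R u + t *\<^sub>R v) + - c / 2 * (mnorm M ((1 - t) *\<^sub>R u + t *\<^sub>R v - 0))\<^sup>2
       \<le> (1 - t) * (h u + - c / 2 * (mnorm M (u - 0))\<^sup>2) + t * (h v + - c / 2 * (mnorm M (v - 0))\<^sup>2)"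
      using curvedD[OF c0, of t u v] by simp
  qed simp
  then have "continuous_on UNIV (\<lambda>y. h y + (- c) / 2 * (mnorm M (y - 0))\<^sup>2)"
    by (rule convex_on_continuous[OF open_UNIV])
  moreover have "continuous_on UNIV (\<lambda>y. c / 2 * (mnorm M (y - 0))\<^sup>2)"
    by (intro continuous_on_mult continuous_on_const continuous_mnorm)
  ultimately have "continuous_on UNIV (\<lambda>y. (h y + (- c) / 2 * (mnorm M (y - 0))\<^sup>2) + c / 2 * (mnorm M (y - 0))\<^sup>2)"
    by (rule continuous_on_add)
  then have "continuous_on UNIV h" by simp
  then show ?thesis using continuous_on_subset by blast
qed

text \<open>When the new norm dominates the old one, the error term of a negative modulus can only grow.\<close>

lemma curved_change_metric:
  assumes h: "curved id (- b) h" and b: "0 \<le> b" and L: "\<And>v. norm v \<le> L * mnorm M v"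
  shows "curved M (- (L\<^sup>2 * b)) h"
  unfolding curved_def
proof (intro allI impI)
  fix y z and t :: real assume t: "0 \<le> t \<and> t \<le> 1"
  have "(norm (z - y))\<^sup>2 \<le> L\<^sup>2 * (mnorm M (z - y))\<^sup>2"
    using power_mono[OF L[of "z - y"] norm_ge_zero, of 2] by (simp add: power_mult_distrib)
  then have "b / 2 * (t * (1 - t)) * (norm (z - y))\<^sup>2 \<le> b / 2 * (t * (1 - t)) * (L\<^sup>2 * (mnorm M (z - y))\<^sup>2)"
    using b t by (intro mult_left_mono) auto
  then show "h ((1 - t) *\<^sub>R y + t *\<^sub>R z)
      \<le> (1 - t) * h y + t * h z - - (L\<^sup>2 * b) / 2 * (t * (1 - t)) * (mnorm M (z - y))\<^sup>2"
    using curvedD[OF h, of t y z] t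
    by (simp only: mnorm_id mult_minus_left minus_divide_left[symmetric] diff_minus_eq_add) (simp add: mult_ac)
qed

text \<open>A lower bound on the slope in one direction extends to the whole ray.  Divide the defining
inequality by \<open>t\<close> and let \<open>t\<close> tend to 0.\<close>

lemma curved_slope:
  assumes h: "curved M c h"
    and d: "eventually (\<lambda>t. l * t \<le> h (z + t *\<^sub>R (y - z)) - h z) (at_right 0)"
  shows "h z + l + c / 2 * (mnorm M (y - z))\<^sup>2 \<le> h y"
proof -
  define N where "N = c / 2 * (mnorm M (y - z))\<^sup>2"
  have "eventually (\<lambda>t. l \<le> h y - h z - (1 - t) * N) (at_right 0)"
    using d eventually_at_right_real[of 0 1, simplified]
  proof eventually_elim
    case (elim t)
    have "z + t *\<^sub>R (y - z) = (1 - t) *\<^sub>R z + t *\<^sub>R y" by (simp add: algebra_simps)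
    with elim curvedD[OF h, of t z y]
    have "t * l \<le> t * (h y - h z - (1 - t) * N)"
      by (simp add: N_def algebra_simps)
    with elim show ?case by simp
  qed
  moreover have "((\<lambda>t. h y - h z - (1 - t) * N) \<longlongrightarrow> h y - h z - (1 - 0) * N) (at_right 0)"
    by (intro tendsto_intros)
  ultimately have "l \<le> h y - h z - (1 - 0) * N"
    by (intro tendsto_lowerbound) auto
  then show ?thesis by (simp add: N_def)
qed

lemma curved_min_growth:
  assumes h: "curved M c h" and z: "\<And>y. h z \<le> h y"
  shows "h z + c / 2 * (mnorm M (y - z))\<^sup>2 \<le> h y"
  using curved_slope[OF h, of 0 z y] z by simp

text \<open>Strong convexity alone gives coercivity: a bound on the unit sphere propagates along rays, where the
quadratic term eventually dominates.  The minimizer over a large ball is therefore global.\<close>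

lemma curved_has_min:
  assumes h: "curved M c h" and c: "0 < c" and L: "\<And>v. norm v \<le> L * mnorm M v"
  obtains z where "\<And>y. h z \<le> h y"
proof -
  have cont: "continuous_on A h" for A by (rule curved_continuous[OF h])
  define K where "K = h 0 - Inf (h ` sphere 0 1)"
  have "compact (h ` sphere (0::'a) 1)" by (intro compact_continuous_image cont) simp
  then have bd: "bdd_below (h ` sphere (0::'a) 1)" by (intro bounded_imp_bdd_below compact_imp_bounded)
  have K: "h 0 - K \<le> h u" if "norm u = 1" for u
    using bd that by (auto simp: K_def intro!: cINF_lower)
  have L0: "0 < L"
  proof -
    obtain b :: 'a where "b \<in> Basis" using nonempty_Basis by blast
    then have "1 \<le> L * mnorm M b" using L[of b] by simp
    then show ?thesis using mnorm_nonneg[of b] mult_nonpos_nonneg[of L "mnorm M b"] by linarith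
  qed
  define a where "a = c / (2 * L\<^sup>2)"
  have a: "a > 0" using c L0 by (simp add: a_def)
  \<comment> \<open>beyond radius \<open>R\<close> the quadratic gain \<open>a * (r - 1)\<close> exceeds the slope bound \<open>K\<close>\<close>
  define R where "R = 1 + \<bar>K\<bar> / a"
  have R: "R \<ge> 1" using a by (simp add: R_def)
  have far: "h 0 \<le> h y" if y: "norm y \<ge> R" for y
  proof -
    define r where "r = norm y"
    have r: "r \<ge> 1" "r \<ge> R" using y R by (auto simp: r_def)
    have N: "r\<^sup>2 \<le> L\<^sup>2 * (mnorm M y)\<^sup>2"
      using power_mono[OF L[of y] norm_ge_zero, of 2] by (simp add: power_mult_distrib r_def)
    have "y \<noteq> 0" using r(1) by (auto simp: r_def)
    then have "h 0 - K \<le> h ((1 / r) *\<^sub>R y)" by (intro K) (simp add: r_def)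
    also have "\<dots> \<le> (1 - 1/r) * h 0 + 1/r * h y - c / 2 * (1/r * (1 - 1/r)) * (mnorm M y)\<^sup>2"
      using curvedD[OF h, of "1/r" 0 y] r by simp
    also have "\<dots> \<le> (1 - 1/r) * h 0 + 1/r * h y - c / 2 * (1/r * (1 - 1/r)) * (r\<^sup>2 / L\<^sup>2)"
      using N L0 c r by (intro diff_left_mono mult_left_mono) (auto simp: field_simps)
    finally have "r * (h 0 - K) \<le> r * ((1 - 1/r) * h 0 + 1/r * h y - c / 2 * (1/r * (1 - 1/r)) * (r\<^sup>2 / L\<^sup>2))"
      using r by (intro mult_left_mono) auto
    also have "\<dots> = (r - 1) * h 0 + h y - a * (r - 1) * r"
      using r L0 by (simp add: a_def field_simps power2_eq_square)
    finally have 1: "h 0 + r * (a * (r - 1) - K) \<le> h y" by (simp add: algebra_simps)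
    have "\<bar>K\<bar> \<le> a * (r - 1)" using r a by (simp add: R_def field_simps)
    then have "0 \<le> r * (a * (r - 1) - K)" using r by (intro mult_nonneg_nonneg) auto
    with 1 show ?thesis by simp
  qed
  obtain z where z: "z \<in> cball 0 R" "\<And>y. y \<in> cball 0 R \<Longrightarrow> h z \<le> h y"
    using continuous_attains_inf[of "cball (0::'a) R" h] cont R by force
  have "h z \<le> h y" for y
  proof (cases "norm y \<le> R")
    case True then show ?thesis using z(2)[of y] by (simp add: dist_norm)
  next
    case False
    then have "h 0 \<le> h y" using far by simp
    moreover have "h z \<le> h 0" using z(2)[of 0] R by simp
    ultimately show ?thesis by simp
  qed
  then show ?thesis using that by blast
qed


section \<open>Inexact proximal steps\<close>

lemma curved_prox_objective:
  assumes p: "curved M (- \<tau>) p"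
  shows "curved M (1 / \<alpha> - \<tau>) (\<lambda>y. p y + 1 / (2 * \<alpha>) * (mnorm M (y - x))\<^sup>2)"
  using curved_add[OF p curved_quadratic[of "1 / \<alpha>" x]] by (simp add: field_simps)

lemma curved_subgradient:
  assumes h: "curved M c h" and v: "v \<in> subdifferential (\<lambda>y. ereal (h y)) x"
  shows "h x + v \<bullet> (y - x) + c / 2 * (mnorm M (y - x))\<^sup>2 \<le> h y"
proof -
  have *: "h x + v \<bullet> (y - x) - e + c / 2 * (mnorm M (y - x))\<^sup>2 \<le> h y" if e: "e > 0" for e
  proof -
    define e' where "e' = e / (1 + norm (y - x))"
    have e': "e' > 0" using e by (simp add: e'_def add_pos_nonneg)
    have e'n: "e' * norm (y - x) \<le> e"
      using e by (simp add: e'_def divide_simps add_pos_nonneg mult_left_mono)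
    have ev: "\<forall>\<^sub>F u in nhds x. h u \<ge> h x + (v \<bullet> (u - x) - e' * norm (u - x))"
      using v e' by (auto simp: subdifferential_def)
    have "((\<lambda>t. x + t *\<^sub>R (y - x)) \<longlongrightarrow> x + 0 *\<^sub>R (y - x)) (at_right 0)"
      by (intro tendsto_intros)
    then have "filterlim (\<lambda>t. x + t *\<^sub>R (y - x)) (nhds x) (at_right 0)" by simp
    from eventually_compose_filterlim[OF ev this]
    have "\<forall>\<^sub>F t in at_right 0. (v \<bullet> (y - x) - e) * t \<le> h (x + t *\<^sub>R (y - x)) - h x"
      using eventually_at_right_less[of 0]
    proof eventually_elim
      case (elim t)
      have a: "t * (e' * norm (y - x)) \<le> t * e" using e'n elim by (intro mult_left_mono) auto
      have b: "h x + (t * (v \<bullet> (y - x)) - e' * (t * norm (y - x))) \<le> h (x + t *\<^sub>R (y - x))"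
        using elim by simp
      have "(v \<bullet> (y - x) - e) * t = t * (v \<bullet> (y - x)) - t * e" by (subst left_diff_distrib) (simp add: mult.commute)
      with a b show ?case by (simp add: mult.left_commute)
    qed
    from curved_slope[OF h this] show ?thesis by simp
  qed
  show ?thesis
  proof (rule field_le_epsilon)
    fix e :: real assume "0 < e"
    from *[OF this] show "h x + v \<bullet> (y - x) + c / 2 * (mnorm M (y - x))\<^sup>2 \<le> h y + e" by simp
  qed
qed

lemma minimizer_unique:
  assumes h: "curved M c h" and c: "0 < c" and z: "\<And>y. h z \<le> h y" and z': "\<And>y. h z' \<le> h y"
  shows "z = z'"
proof (rule ccontr)
  assume "z \<noteq> z'"
  then have "0 < (mnorm M (z' - z))\<^sup>2" using pos[of "z' - z"] by (simp add: mnorm_sq)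
  then have "0 < c / 2 * (mnorm M (z' - z))\<^sup>2" using c by simp
  then show False using curved_min_growth[OF h z, of z'] z'[of z] by simp
qed

text \<open>The three accuracy criteria all bound the distance to the exact proximal point.  The objective is
strongly convex with modulus \<open>1 / \<alpha> - \<tau>\<close>, so its gap controls the squared distance, and a
subgradient at \<open>x'\<close> dominates the distance itself.  The distance to the subdifferential is an
infimum that need not be attained, which is why the third case works with an arbitrary slack \<open>d\<close>.\<close>

lemma inexact_prox_step_close:
  assumes p: "curved M (- \<tau>) p" and \<alpha>: "0 < \<alpha>" "\<tau> * \<alpha> < 1" and L: "\<And>v. norm v \<le> L * mnorm M v"
    and e: "0 \<le> \<epsilon>"
    and step: "inexact_prox_step \<tau> M \<alpha> \<epsilon> (\<lambda>y. ereal (p y)) x x'"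
  obtains z where "mnorm M (x' - z) \<le> \<epsilon>"
    "\<And>y. p z + 1 / (2 * \<alpha>) * (mnorm M (z - x))\<^sup>2 \<le> p y + 1 / (2 * \<alpha>) * (mnorm M (y - x))\<^sup>2"
proof -
  define h where "h y = p y + 1 / (2 * \<alpha>) * (mnorm M (y - x))\<^sup>2" for y
  define c where "c = 1 / \<alpha> - \<tau>"
  have h: "curved M c h" unfolding h_def c_def by (rule curved_prox_objective[OF p])
  have c: "0 < c" using \<alpha> by (simp add: c_def field_simps)
  have ph: "prox_objective M \<alpha> (\<lambda>y. ereal (p y)) x = (\<lambda>y. ereal (h y))"
    by (simp add: prox_objective_def h_def fun_eq_iff)
  obtain z where z: "\<And>y. h z \<le> h y" using curved_has_min[OF h c L] by blast
  have growth: "h z + c / 2 * (mnorm M (x' - z))\<^sup>2 \<le> h x'" by (rule curved_min_growth[OF h z])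
  have "mnorm M (x' - z) \<le> \<epsilon>"
    using step unfolding inexact_prox_step_def ph
  proof (elim disjE bexE)
    fix z' assume z': "z' \<in> prox M \<alpha> (\<lambda>y. ereal (p y)) x" "mnorm M (x' - z') \<le> \<epsilon>"
    from z'(1) have "h z' \<le> h y" for y
      by (auto simp: prox_def ph is_arg_min_linorder)
    then have "z' = z" using minimizer_unique[OF h c _ z] by blast
    with z' show ?thesis by simp
  next
    assume a: "ereal (h x') - (INF y. ereal (h y)) \<le> ereal ((1 - \<tau> * \<alpha>) / (2 * \<alpha>) * \<epsilon>\<^sup>2)"
    have "(INF y. ereal (h y)) = ereal (h z)"
      by (rule INF_eqI) (auto simp: z)
    with a have "h x' - h z \<le> (1 - \<tau> * \<alpha>) / (2 * \<alpha>) * \<epsilon>\<^sup>2" by simp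
    also have "\<dots> = c / 2 * \<epsilon>\<^sup>2" using \<alpha> by (simp add: c_def field_simps)
    finally have "c / 2 * (mnorm M (x' - z))\<^sup>2 \<le> c / 2 * \<epsilon>\<^sup>2" using growth by simp
    then have "(mnorm M (x' - z))\<^sup>2 \<le> \<epsilon>\<^sup>2" using c by simp
    then show ?thesis using e by (rule power2_le_imp_le)
  next
    assume a: "mdist (inv M) 0 (subdifferential (\<lambda>y. ereal (h y)) x') \<le> ereal ((1 - \<tau> * \<alpha>) / \<alpha> * \<epsilon>)"
    have "(1 - \<tau> * \<alpha>) / \<alpha> * \<epsilon> = c * \<epsilon>" using \<alpha> by (simp add: c_def field_simps)
    with a have a': "mdist (inv M) 0 (subdifferential (\<lambda>y. ereal (h y)) x') \<le> ereal (c * \<epsilon>)" by simp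
    have "c * mnorm M (x' - z) \<le> c * \<epsilon> + d" if d: "d > 0" for d
    proof -
      have "mdist (inv M) 0 (subdifferential (\<lambda>y. ereal (h y)) x') < ereal (c * \<epsilon> + d)"
        using d by (intro order.strict_trans1[OF a']) simp
      then obtain v where v: "v \<in> subdifferential (\<lambda>y. ereal (h y)) x'" and
        vb: "mnorm (inv M) (0 - v) < c * \<epsilon> + d"
        unfolding mdist_def INF_less_iff by auto
      define N where "N = mnorm M (x' - z)"
      have "M (- inv M v) = - v"
        using bij by (simp add: linear_neg[OF lin] bij_is_surj surj_f_inv_f)
      then have "inv M (- v) = - inv M v"
        using bij by (intro inv_f_eq bij_is_inj)
      then have vn: "mnorm (inv M) (0 - v) = mnorm (inv M) v"
        by (simp add: mnorm_def)
      have "h x' + v \<bullet> (z - x') + c / 2 * (mnorm M (z - x'))\<^sup>2 \<le> h z"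
        by (rule curved_subgradient[OF h v])
      with growth have "c * N\<^sup>2 \<le> v \<bullet> (x' - z)"
        by (simp add: N_def mnorm_minus[of z x'] inner_diff_right)
      also have "\<dots> \<le> mnorm (inv M) v * N"
        unfolding N_def by (rule dual_cauchy_schwarz)
      also have "\<dots> \<le> (c * \<epsilon> + d) * N"
        using vb vn by (intro mult_right_mono) (auto simp: N_def mnorm_nonneg)
      finally have "N * (c * N) \<le> N * (c * \<epsilon> + d)" by (simp add: power2_eq_square algebra_simps)
      moreover have "0 \<le> c * \<epsilon> + d" using c e d by simp
      ultimately show ?thesis
        unfolding N_def[symmetric] using mnorm_nonneg[of "x' - z"] N_def
        by (cases "N = 0") auto
    qed
    then have "c * mnorm M (x' - z) \<le> c * \<epsilon>" by (rule field_le_epsilon)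
    then show ?thesis using c by simp
  qed
  then show ?thesis using that[of z] z by (simp add: h_def)
qed

text \<open>Compare the proximal point with an arbitrary competitor \<open>y\<close>.  The loss from not knowing how far the model
drops between \<open>x\<close> and \<open>z\<close> is linear in \<open>\<parallel>z - x\<parallel>\<close> by \<open>lower\<close>; the proximal term is quadratic in it, and
maximizing the difference leaves an error of order \<open>(\<alpha> l)\<^sup>2\<close>.\<close>

lemma prox_step_progress:
  assumes p: "curved M (- \<tau>) p" and \<alpha>: "0 < \<alpha>" "\<tau> * \<alpha> \<le> 1 / 2" and L: "\<And>v. norm v \<le> L * mnorm M v"
    and l: "0 \<le> l" "0 \<le> L" and \<tau>: "\<tau> = L\<^sup>2 * \<tau>'" "0 \<le> \<tau>'"
    and lower: "\<And>y. p x - l * norm (y - x) - \<tau>' / 2 * (norm (y - x))\<^sup>2 \<le> p y"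
    and z: "\<And>y. p z + 1 / (2 * \<alpha>) * (mnorm M (z - x))\<^sup>2 \<le> p y + 1 / (2 * \<alpha>) * (mnorm M (y - x))\<^sup>2"
  shows "(1 - \<tau> * \<alpha>) * (mnorm M (y - z))\<^sup>2
    \<le> (mnorm M (y - x))\<^sup>2 + 2 * \<alpha> * (p y - p x) + 2 * (\<alpha> * l * L)\<^sup>2"
proof -
  define a where "a = mnorm M (z - x)"
  define Y where "Y = (mnorm M (y - x))\<^sup>2"
  define Z where "Z = (mnorm M (y - z))\<^sup>2"
  have n: "norm (z - x) \<le> L * a" unfolding a_def by (rule L)
  have g: "p z + 1 / (2 * \<alpha>) * a\<^sup>2 + (1 / \<alpha> - \<tau>) / 2 * Z \<le> p y + 1 / (2 * \<alpha>) * Y"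
    using curved_min_growth[OF curved_prox_objective[OF p] z] by (simp add: a_def Y_def Z_def)
  have "l * norm (z - x) \<le> l * (L * a)" using n l by (intro mult_left_mono)
  moreover have "\<tau>' / 2 * (norm (z - x))\<^sup>2 \<le> \<tau>' / 2 * (L * a)\<^sup>2"
    using n \<tau> by (intro mult_left_mono power_mono) auto
  ultimately have "p x - l * L * a - \<tau> / 2 * a\<^sup>2 \<le> p z"
    using lower[of z] by (simp add: \<tau> power_mult_distrib algebra_simps)
  with g have "1 / (2 * \<alpha>) * a\<^sup>2 + (1 / \<alpha> - \<tau>) / 2 * Z + p x - l * L * a - \<tau> / 2 * a\<^sup>2
      \<le> p y + 1 / (2 * \<alpha>) * Y" by simp
  then have "(2 * \<alpha>) * (1 / (2 * \<alpha>) * a\<^sup>2 + (1 / \<alpha> - \<tau>) / 2 * Z + p x - l * L * a - \<tau> / 2 * a\<^sup>2)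
      \<le> (2 * \<alpha>) * (p y + 1 / (2 * \<alpha>) * Y)"
    using \<alpha> by (intro mult_left_mono) auto
  moreover have e1: "2 * \<alpha> * (1 / (2 * \<alpha>) * u) = u" for u using \<alpha> by simp
  moreover have e2: "2 * \<alpha> * ((1 / \<alpha> - \<tau>) / 2 * Z) = (1 - \<tau> * \<alpha>) * Z" using \<alpha> by (simp add: field_simps)
  moreover have e3: "2 * \<alpha> * (\<tau> / 2 * a\<^sup>2) = \<tau> * \<alpha> * a\<^sup>2" by simp
  ultimately have 1: "a\<^sup>2 + (1 - \<tau> * \<alpha>) * Z + 2 * \<alpha> * p x - 2 * (\<alpha> * l * L) * a - \<tau> * \<alpha> * a\<^sup>2
      \<le> 2 * \<alpha> * p y + Y"
    by (simp only: distrib_left[of "2 * \<alpha>"] right_diff_distrib[of "2 * \<alpha>"] e1 e2 e3)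
  have "\<tau> * \<alpha> * a\<^sup>2 \<le> 1 / 2 * a\<^sup>2" using \<alpha> by (intro mult_right_mono) auto
  \<comment> \<open>completing the square; the other half of \<open>a\<^sup>2\<close> absorbs the weak convexity term\<close>
  moreover have "0 \<le> (a - 2 * (\<alpha> * l * L))\<^sup>2 / 2" by simp
  ultimately have "2 * (\<alpha> * l * L) * a + \<tau> * \<alpha> * a\<^sup>2 - a\<^sup>2 \<le> 2 * (\<alpha> * l * L)\<^sup>2"
    by (simp add: power2_diff field_simps)
  with 1 show ?thesis by (simp add: Y_def Z_def algebra_simps)
qed

section \<open>The gradient of the Moreau envelope\<close>

text \<open>Using \<open>y x\<close> as a competitor at \<open>u\<close> bounds the envelope at \<open>u\<close> from above by a quadratic with slope
\<open>\<rho> M (x - y x)\<close> at \<open>x\<close>.  Exchanging \<open>x\<close> and \<open>u\<close> gives a lower bound with the slope taken at \<open>u\<close>, and strong convexity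
makes the minimizer Lipschitz in the centre, so both bounds agree to second order.\<close>

lemma moreau_gradient:
  assumes h: "curved M (- b) \<phi>" and b: "b < \<rho>" and \<rho>: "0 < \<rho>" and L: "\<And>v. norm v \<le> L * mnorm M v"
    and y: "\<And>x u. \<phi> (y x) + \<rho> / 2 * (mnorm M (y x - x))\<^sup>2 \<le> \<phi> u + \<rho> / 2 * (mnorm M (u - x))\<^sup>2"
  shows "GDERIV (\<lambda>x. \<phi> (y x) + \<rho> / 2 * (mnorm M (y x - x))\<^sup>2) x :> \<rho> *\<^sub>R M (x - y x)"
proof -
  define c where "c = \<rho> - b"
  have c: "c > 0" using b by (simp add: c_def)
  define e where "e x = \<phi> (y x) + \<rho> / 2 * (mnorm M (y x - x))\<^sup>2" for x
  define g where "g x = \<rho> *\<^sub>R M (x - y x)" for x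
  have curv: "curved M c (\<lambda>u. \<phi> u + \<rho> / 2 * (mnorm M (u - x))\<^sup>2)" for x
    using curved_add[OF h curved_quadratic[of \<rho> x]] by (simp add: c_def)
  have growth: "e x + c / 2 * (mnorm M (u - y x))\<^sup>2 \<le> \<phi> u + \<rho> / 2 * (mnorm M (u - x))\<^sup>2" for u x
    unfolding e_def by (rule curved_min_growth[OF curv y])
  have sq: "(mnorm M (w - u))\<^sup>2 = (mnorm M (w - x))\<^sup>2 + 2 * ((x - w) \<bullet> M (u - x)) + (mnorm M (u - x))\<^sup>2" for u w x
    using mnorm_sq_add[of "x - w" "u - x"] mnorm_minus[of w u] mnorm_minus[of w x] by simp
  have upper: "e u \<le> e x + g x \<bullet> (u - x) + \<rho> / 2 * (mnorm M (u - x))\<^sup>2" for u x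
  proof -
    have "e u \<le> \<phi> (y x) + \<rho> / 2 * (mnorm M (y x - u))\<^sup>2"
      unfolding e_def by (rule y)
    also have "\<dots> = e x + g x \<bullet> (u - x) + \<rho> / 2 * (mnorm M (u - x))\<^sup>2"
      unfolding e_def sq[of "y x" u x] g_def inner_scaleR_left sym[of "x - y x" "u - x"]
      by (simp only: distrib_left)
    finally show ?thesis .
  qed
  \<comment> \<open>add the quadratic growth at the two centres; the values of \<open>\<phi>\<close> cancel\<close>
  have lip: "c * mnorm M (y u - y x) \<le> \<rho> * mnorm M (u - x)" for u x
  proof -
    define d where "d = mnorm M (y u - y x)"
    have d0: "0 \<le> d" by (simp add: d_def mnorm_nonneg)
    have 1: "e x + c / 2 * d\<^sup>2 \<le> \<phi> (y u) + \<rho> / 2 * (mnorm M (y u - x))\<^sup>2"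
      using growth[of x "y u"] by (simp add: d_def)
    have 2: "e u + c / 2 * d\<^sup>2 \<le> \<phi> (y x) + \<rho> / 2 * (mnorm M (y x - u))\<^sup>2"
      using growth[of u "y x"] by (simp add: d_def mnorm_minus[of "y x"])
    have "(mnorm M (y u - u))\<^sup>2 = (mnorm M (y u - x))\<^sup>2 + 2 * ((x - y u) \<bullet> M (u - x)) + (mnorm M (u - x))\<^sup>2"
      "(mnorm M (y x - u))\<^sup>2 = (mnorm M (y x - x))\<^sup>2 + 2 * ((x - y x) \<bullet> M (u - x)) + (mnorm M (u - x))\<^sup>2"
      by (rule sq)+
    with 1 2 have "c * d\<^sup>2 \<le> \<rho> * ((x - y x) \<bullet> M (u - x) - (x - y u) \<bullet> M (u - x))"
      by (simp add: e_def algebra_simps)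
    also have "\<dots> = \<rho> * ((y u - y x) \<bullet> M (u - x))"
      by (simp add: inner_diff_left)
    also have "\<dots> \<le> \<rho> * (d * mnorm M (u - x))"
      unfolding d_def using \<rho> by (intro mult_left_mono cauchy_schwarz) auto
    finally have "d * (c * d) \<le> d * (\<rho> * mnorm M (u - x))" by (simp add: power2_eq_square algebra_simps)
    then show ?thesis using d0 \<rho> mnorm_nonneg[of "u - x"] unfolding d_def[symmetric]
      by (cases "d = 0") auto
  qed
  define C where "C = \<rho> / 2 + \<rho> * \<rho> / c"
  have C: "C \<ge> 0" using \<rho> c by (simp add: C_def)
  have approx: "\<bar>e u - e x - (u - x) \<bullet> g x\<bar> \<le> C * (mnorm M (u - x))\<^sup>2" for u
  proof -
    define d where "d = mnorm M (u - x)"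
    have "e x \<le> e u + g u \<bullet> (x - u) + \<rho> / 2 * d\<^sup>2"
      using upper[of x u] by (simp add: d_def mnorm_minus[of x u])
    also have "g u \<bullet> (x - u) = - (g x \<bullet> (u - x)) - \<rho> * d\<^sup>2 + \<rho> * ((y u - y x) \<bullet> M (u - x))"
    proof -
      have "u - y u = (x - y x) + (u - x) - (y u - y x)" by simp
      then have "M (u - y u) = M (x - y x) + M (u - x) - M (y u - y x)"
        by (metis lin linear_add linear_diff)
      then have "M (u - y u) \<bullet> (u - x)
          = M (x - y x) \<bullet> (u - x) + M (u - x) \<bullet> (u - x) - M (y u - y x) \<bullet> (u - x)"
        by (simp only: inner_add_left inner_diff_left)
      moreover have "M (u - x) \<bullet> (u - x) = d\<^sup>2" by (simp add: d_def mnorm_sq inner_commute)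
      moreover have "M (y u - y x) \<bullet> (u - x) = (y u - y x) \<bullet> M (u - x)" by (simp only: sym)
      ultimately have "M (u - y u) \<bullet> (u - x) = M (x - y x) \<bullet> (u - x) + d\<^sup>2 - (y u - y x) \<bullet> M (u - x)"
        by simp
      then have "\<rho> * (M (u - y u) \<bullet> (u - x)) = \<rho> * (M (x - y x) \<bullet> (u - x) + d\<^sup>2 - (y u - y x) \<bullet> M (u - x))"
        by simp
      moreover have "g u \<bullet> (x - u) = - (\<rho> * (M (u - y u) \<bullet> (u - x)))"
        by (simp only: g_def inner_scaleR_left minus_diff_eq[of u x, symmetric] inner_minus_right mult_minus_right)
      ultimately show ?thesis
        by (simp only: g_def inner_scaleR_left) (simp only: distrib_left right_diff_distrib)
    qed
    also have "(y u - y x) \<bullet> M (u - x) \<le> mnorm M (y u - y x) * d"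
      unfolding d_def by (rule cauchy_schwarz)
    also have "mnorm M (y u - y x) \<le> \<rho> / c * d"
      using lip[of u x] c by (simp add: d_def field_simps)
    finally have "e x \<le> e u + (- (g x \<bullet> (u - x)) - \<rho> * d\<^sup>2 + \<rho> * (\<rho> / c * d * d)) + \<rho> / 2 * d\<^sup>2"
      using \<rho> mnorm_nonneg[of "u - x"] by (simp add: d_def mult_left_mono mult_right_mono)
    moreover have "0 \<le> \<rho> * d\<^sup>2" using \<rho> by simp
    ultimately have "g x \<bullet> (u - x) - (e u - e x) \<le> C * d\<^sup>2"
      by (simp add: C_def power2_eq_square algebra_simps)
    moreover have "(e u - e x) - g x \<bullet> (u - x) \<le> C * d\<^sup>2"
    proof -
      have "0 \<le> \<rho> * \<rho> / c * d\<^sup>2" using \<rho> c by simp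
      then show ?thesis using upper[of u x] by (simp add: C_def d_def algebra_simps)
    qed
    ultimately show ?thesis by (simp add: d_def inner_commute abs_le_iff)
  qed
  obtain B where B: "B > 0" "\<And>v. norm (M v) \<le> B * norm v"
    using linear_bounded_pos[OF lin] by blast
  have mB: "(mnorm M v)\<^sup>2 \<le> B * (norm v)\<^sup>2" for v
  proof -
    have "(mnorm M v)\<^sup>2 = v \<bullet> M v" by (rule mnorm_sq)
    also have "\<dots> \<le> norm v * norm (M v)" by (rule norm_cauchy_schwarz)
    also have "\<dots> \<le> norm v * (B * norm v)" by (intro mult_left_mono B) auto
    finally show ?thesis by (simp add: power2_eq_square algebra_simps)
  qed
  have "(e has_derivative (\<lambda>h. h \<bullet> g x)) (at x)"
    unfolding has_derivative_within_alt
  proof (intro conjI allI impI)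
    show "bounded_linear (\<lambda>h. h \<bullet> g x)" by (rule bounded_linear_inner_left)
    fix \<epsilon> :: real assume \<epsilon>: "0 < \<epsilon>"
    define d where "d = \<epsilon> / (C * B + 1)"
    have CB: "C * B \<ge> 0" using C B by simp
    have d: "d > 0" using \<epsilon> CB by (simp add: d_def add_nonneg_pos)
    have "norm (e u - e x - (u - x) \<bullet> g x) \<le> \<epsilon> * norm (u - x)" if u: "norm (u - x) < d" for u
    proof -
      have "norm (e u - e x - (u - x) \<bullet> g x) \<le> C * (mnorm M (u - x))\<^sup>2" using approx[of u] by simp
      also have "\<dots> \<le> C * (B * (norm (u - x))\<^sup>2)" by (intro mult_left_mono mB C)
      also have "\<dots> = (C * B * norm (u - x)) * norm (u - x)" by (simp add: power2_eq_square)
      also have "C * B * norm (u - x) \<le> (C * B + 1) * d"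
        using u CB by (intro mult_mono) auto
      also have "\<dots> = \<epsilon>" using CB by (simp add: d_def)
      finally show ?thesis by (simp add: mult_right_mono)
    qed
    then show "\<exists>d>0. \<forall>u\<in>UNIV. norm (u - x) < d \<longrightarrow> norm (e u - e x - (u - x) \<bullet> g x) \<le> \<epsilon> * norm (u - x)"
      using d by blast
  qed
  then show ?thesis unfolding gderiv_def e_def g_def .
qed

end

section \<open>Almost supermartingales\<close>

text \<open>A part of the Robbins-Siegmund theorem.  The conditional inequality is stated by integrals over the
sets \<open>B\<close> of the past.  After division by the partial products of \<open>q\<close> the sums telescope, which gives summability of \<open>U\<close>;
boundedness of \<open>W\<close> is Doob's maximal inequality, proved by stopping when a level \<open>l\<close> is
first reached.\<close>

lemma (in prob_space) almost_supermartingale_bounded_summable: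
  fixes F :: "nat \<Rightarrow> 'a measure" and W U :: "nat \<Rightarrow> 'a \<Rightarrow> real" and q b :: "nat \<Rightarrow> real"
  assumes F: "\<And>n. subalgebra M (F n)" "\<And>n. sets (F n) \<subseteq> sets (F (Suc n))"
    and W: "\<And>n. W n \<in> borel_measurable (F n)" "\<And>n. integrable M (W n)"
    and U: "\<And>n. integrable M (U n)"
    and W0: "\<And>n x. x \<in> space M \<Longrightarrow> 0 \<le> W n x" and U0: "\<And>n x. x \<in> space M \<Longrightarrow> 0 \<le> U n x"
    and step: "\<And>n B. B \<in> sets (F n) \<Longrightarrow>
      (\<integral>x. indicator B x * W (Suc n) x \<partial>M) + (\<integral>x. indicator B x * U n x \<partial>M)
        \<le> q n * (\<integral>x. indicator B x * W n x \<partial>M) + b n"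
    and q: "\<And>n. 1 \<le> q n" "\<And>n. (\<Prod>i<n. q i) \<le> C"
    and b: "\<And>n. 0 \<le> b n" "summable b"
  shows "AE x in M. summable (\<lambda>n. U n x) \<and> (\<exists>K. \<forall>n. W n x \<le> K)"
proof -
  define Q where "Q n = (\<Prod>i<n. q i)" for n
  define V where "V n x = W n x / Q n" for n x
  define K0 where "K0 = expectation (V 0) + (\<Sum>i. b i)"
  have Q1: "1 \<le> Q n" for n unfolding Q_def using q(1) by (intro prod_ge_1) auto
  have QC: "Q n \<le> C" for n unfolding Q_def by (rule q(2))
  have C1: "1 \<le> C" using Q1[of 0] QC[of 0] by linarith
  have Qpos: "0 < Q n" for n using Q1[of n] by linarith
  have QS: "Q (Suc n) = q n * Q n" for n by (simp add: Q_def mult.commute)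
  have FM: "B \<in> sets (F n) \<Longrightarrow> B \<in> sets M" for B n using F(1)[of n] by (auto simp: subalgebra_def)
  have spF: "space (F n) = space M" for n using F(1)[of n] by (auto simp: subalgebra_def)
  have Vint: "integrable M (V n)" for n unfolding V_def using W(2)[of n] by simp
  have V0: "x \<in> space M \<Longrightarrow> 0 \<le> V n x" for n x using W0 Qpos[of n] by (simp add: V_def)
  have Vint': "integrable M (\<lambda>x. indicator B x * V n x)" if "B \<in> sets M" for B n
    using integrable_mult_indicator[OF that Vint[of n]] by simp
  have Vstep: "(\<integral>x. indicator B x * V (Suc n) x \<partial>M) + (\<integral>x. indicator B x * U n x \<partial>M) / C
      \<le> (\<integral>x. indicator B x * V n x \<partial>M) + b n" if B: "B \<in> sets (F n)" for B n
  proof -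
    have VI: "(\<integral>x. indicator B x * V k x \<partial>M) = (\<integral>x. indicator B x * W k x \<partial>M) / Q k" for k
      by (simp add: V_def)
    have UI: "0 \<le> (\<integral>x. indicator B x * U n x \<partial>M)"
      using U0 by (intro integral_nonneg_AE AE_I2) auto
    have "(\<integral>x. indicator B x * U n x \<partial>M) / C \<le> (\<integral>x. indicator B x * U n x \<partial>M) / Q (Suc n)"
      using UI QC Qpos by (intro divide_left_mono) (auto intro: mult_pos_pos order.strict_trans2)
    moreover have "((\<integral>x. indicator B x * W (Suc n) x \<partial>M) + (\<integral>x. indicator B x * U n x \<partial>M)) / Q (Suc n)
      \<le> (q n * (\<integral>x. indicator B x * W n x \<partial>M) + b n) / Q (Suc n)"
      using step[OF B] Qpos[of "Suc n"] by (intro divide_right_mono) auto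
    moreover have "q n * (\<integral>x. indicator B x * W n x \<partial>M) / Q (Suc n) = (\<integral>x. indicator B x * V n x \<partial>M)"
      using q(1)[of n] by (simp add: VI QS)
    moreover have "b n / Q (Suc n) \<le> b n"
      using b(1)[of n] Q1[of "Suc n"] by (simp add: divide_le_eq mult_le_cancel_left1 Qpos)
    ultimately show ?thesis by (simp add: VI add_divide_distrib)
  qed
  have K0: "expectation (V 0) + (\<Sum>i<n. b i) \<le> K0" for n
    unfolding K0_def using b by (intro add_left_mono sum_le_suminf) auto

  have sumU: "expectation (V n) + (\<Sum>i<n. expectation (U i) / C) \<le> expectation (V 0) + (\<Sum>i<n. b i)" for n
  proof (induction n)
    case (Suc n)
    have "space M \<in> sets (F n)" using spF[of n] sets.top[of "F n"] by simp
    from Vstep[OF this]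
    have "expectation (V (Suc n)) + expectation (U n) / C \<le> expectation (V n) + b n"
      by (simp cong: Bochner_Integration.integral_cong)
    with Suc show ?case by simp
  qed simp
  have EU: "(\<Sum>i<n. expectation (U i)) \<le> C * K0" for n
  proof -
    have "0 \<le> expectation (V n)" using V0 by (intro integral_nonneg_AE AE_I2) auto
    then have "(\<Sum>i<n. expectation (U i)) / C \<le> K0"
      using sumU[of n] K0[of n] by (simp add: sum_divide_distrib)
    then show ?thesis using C1 by (simp add: divide_le_eq mult.commute)
  qed
  have "(\<integral>\<^sup>+x. (\<Sum>i. ennreal (U i x)) \<partial>M) = (\<Sum>i. \<integral>\<^sup>+x. ennreal (U i x) \<partial>M)"
    using U by (intro nn_integral_suminf) auto
  also have "\<dots> = (\<Sum>i. ennreal (expectation (U i)))"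
    using U U0 by (intro suminf_cong nn_integral_eq_integral) auto
  also have "\<dots> \<le> ennreal (C * K0)"
  proof (rule suminf_le_const)
    fix n
    have "0 \<le> expectation (U i)" for i using U0 by (intro integral_nonneg_AE AE_I2) auto
    then have "(\<Sum>i<n. ennreal (expectation (U i))) = ennreal (\<Sum>i<n. expectation (U i))"
      by (simp add: sum_ennreal)
    also have "\<dots> \<le> ennreal (C * K0)" using EU by (intro ennreal_leI)
    finally show "(\<Sum>i<n. ennreal (expectation (U i))) \<le> ennreal (C * K0)" .
  qed simp
  finally have "(\<integral>\<^sup>+x. (\<Sum>i. ennreal (U i x)) \<partial>M) \<noteq> \<infinity>"
    by (auto simp: top_unique)
  then have "AE x in M. (\<Sum>i. ennreal (U i x)) \<noteq> \<infinity>"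
    using U by (intro nn_integral_PInf_AE) auto
  then have AE_U: "AE x in M. summable (\<lambda>n. U n x)"
  proof (rule AE_mp, intro AE_I2 impI)
    fix x assume "x \<in> space M" "(\<Sum>i. ennreal (U i x)) \<noteq> \<infinity>"
    then show "summable (\<lambda>n. U n x)" using U0 by (intro summable_suminf_not_top) auto
  qed

  \<comment> \<open>the level \<open>l\<close> has been reached by time \<open>n\<close>\<close>
  define A where "A l n = {x \<in> space M. \<exists>i\<le>n. real l \<le> V i x}" for l n
  have A_F: "A l n \<in> sets (F n)" for l n
  proof -
    have "{x \<in> space M. real l \<le> V i x} \<in> sets (F n)" if "i \<le> n" for i
    proof -
      have [measurable]: "W i \<in> borel_measurable (F i)" by (rule W(1))
      have "{x \<in> space (F i). real l \<le> V i x} \<in> sets (F i)" unfolding V_def by measurable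
      moreover have "sets (F i) \<subseteq> sets (F n)" using that lift_Suc_mono_le[of "\<lambda>n. sets (F n)"] F(2) by blast
      ultimately show ?thesis by (auto simp: spF)
    qed
    moreover have "A l n = (\<Union>i\<in>{..n}. {x \<in> space M. real l \<le> V i x})" by (auto simp: A_def)
    ultimately show ?thesis by auto
  qed
  have A_M [measurable]: "A l n \<in> sets M" for l n using A_F FM by blast
  have A_int [simp]: "integrable M (indicat_real (A l n))" for l n
    by (auto intro!: integrable_real_indicator simp: emeasure_eq_measure)
  have doob: "real l * prob (A l n) + (\<integral>x. indicator (space M - A l n) x * V n x \<partial>M)
      \<le> expectation (V 0) + (\<Sum>i<n. b i)" for l n
  proof (induction n)
    case 0
    have "real l * prob (A l 0) + (\<integral>x. indicator (space M - A l 0) x * V 0 x \<partial>M)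
      = (\<integral>x. real l * indicator (A l 0) x + indicator (space M - A l 0) x * V 0 x \<partial>M)"
      by (subst Bochner_Integration.integral_add) (auto intro!: Vint')
    also have "\<dots> \<le> expectation (V 0)"
    proof (intro integral_mono Bochner_Integration.integrable_add Vint' Vint)
      fix x assume "x \<in> space M"
      then show "real l * indicator (A l 0) x + indicator (space M - A l 0) x * V 0 x \<le> V 0 x"
        using V0[of x 0] by (cases "x \<in> A l 0") (auto simp: A_def)
    qed auto
    finally show ?case by simp
  next
    case (Suc n)
    let ?B = "space M - A l n"
    have B: "?B \<in> sets (F n)" using A_F[of l n] sets.compl_sets[of "A l n" "F n"] spF[of n] by simp
    have sub: "A l n \<subseteq> A l (Suc n)" unfolding A_def using le_SucI by blast
    have "real l * prob (A l (Suc n)) + (\<integral>x. indicator (space M - A l (Suc n)) x * V (Suc n) x \<partial>M)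
      = (\<integral>x. real l * indicator (A l (Suc n)) x + indicator (space M - A l (Suc n)) x * V (Suc n) x \<partial>M)"
      by (subst Bochner_Integration.integral_add) (auto intro!: Vint')
    \<comment> \<open>paths that reach the level at time \<open>Suc n\<close> carry at least \<open>l\<close>\<close>
    also have "\<dots> \<le> (\<integral>x. real l * indicator (A l n) x + indicator ?B x * V (Suc n) x \<partial>M)"
    proof (intro integral_mono Bochner_Integration.integrable_add Vint')
      fix x assume "x \<in> space M"
      then show "real l * indicator (A l (Suc n)) x + indicator (space M - A l (Suc n)) x * V (Suc n) x
          \<le> real l * indicator (A l n) x + indicator ?B x * V (Suc n) x"
        using sub by (auto simp: indicator_def) (auto simp: A_def le_Suc_eq)
    qed auto
    also have "\<dots> = real l * prob (A l n) + (\<integral>x. indicator ?B x * V (Suc n) x \<partial>M)"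
      by (subst Bochner_Integration.integral_add) (auto intro!: Vint')
    also have "(\<integral>x. indicator ?B x * V (Suc n) x \<partial>M) \<le> (\<integral>x. indicator ?B x * V n x \<partial>M) + b n"
    proof -
      have "0 \<le> (\<integral>x. indicator ?B x * U n x \<partial>M) / C"
        using U0 C1 by (intro divide_nonneg_nonneg integral_nonneg_AE AE_I2) auto
      then show ?thesis using Vstep[OF B] by linarith
    qed
    finally show ?case using Suc by simp
  qed
  have PA: "real l * prob (A l n) \<le> K0" for l n
  proof -
    have "0 \<le> (\<integral>x. indicator (space M - A l n) x * V n x \<partial>M)"
      using V0 by (intro integral_nonneg_AE AE_I2) auto
    then show ?thesis using doob[of l n] K0[of n] by linarith
  qed
  have PU: "real l * prob (\<Union>n. A l n) \<le> K0" for l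
  proof -
    have "(\<lambda>n. prob (A l n)) \<longlonglongrightarrow> prob (\<Union>n. A l n)"
    proof (rule finite_Lim_measure_incseq)
      show "range (A l) \<subseteq> events" using A_M by blast
      show "incseq (A l)" unfolding incseq_def A_def using le_trans by blast
    qed
    then have "(\<lambda>n. real l * prob (A l n)) \<longlonglongrightarrow> real l * prob (\<Union>n. A l n)" by (intro tendsto_intros)
    then show ?thesis by (rule LIMSEQ_le_const2) (auto intro: PA)
  qed
  define N where "N = (\<Inter>l. \<Union>n. A l n)"
  have N [measurable]: "N \<in> sets M" unfolding N_def by measurable
  have "prob N = 0"
  proof (rule ccontr)
    assume "prob N \<noteq> 0"
    then have pN: "0 < prob N" using measure_nonneg[of M N] by linarith
    obtain l :: nat where l: "K0 / prob N < real l" using reals_Archimedean2 by blast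
    have "K0 < real l * prob N" using l pN by (simp add: divide_less_eq)
    also have "\<dots> \<le> real l * prob (\<Union>n. A l n)"
      unfolding N_def by (intro mult_left_mono finite_measure_mono) auto
    also have "\<dots> \<le> K0" by (rule PU)
    finally show False by simp
  qed
  then have "AE x in M. x \<notin> N" by (simp add: AE_iff_null_sets[OF N, symmetric] null_sets_def emeasure_eq_measure)
  then have AE_W: "AE x in M. \<exists>K. \<forall>n. W n x \<le> K"
  proof (rule AE_mp, intro AE_I2 impI)
    fix x assume w: "x \<in> space M" "x \<notin> N"
    then obtain l where "\<And>n. x \<notin> A l n" by (auto simp: N_def)
    then have "V n x < real l" for n using w by (auto simp: A_def not_le)
    then have Wl: "W n x \<le> real l * C" for n
    proof -
      have "W n x \<le> real l * Q n" using \<open>V n x < real l\<close> Qpos[of n] by (simp add: V_def divide_less_eq)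
      also have "\<dots> \<le> real l * C" using QC by (intro mult_left_mono) auto
      finally show ?thesis .
    qed
    then show "\<exists>K. \<forall>n. W n x \<le> K" by blast
  qed
  from AE_U AE_W show ?thesis by eventually_elim blast
qed

section \<open>Samples that are independent of the past\<close>

text \<open>A fresh sample \<open>S\<close> may be integrated out while everything known in the past \<open>F\<close> is kept fixed.  The map
\<open>x \<mapsto> (x, S x)\<close>, with its first component seen in \<open>F\<close>, has a product law, so this is Fubini's theorem.\<close>

lemma (in prob_space) freezing:
  fixes g :: "'a \<Rightarrow> 's \<Rightarrow> real"
  assumes F: "subalgebra M F" and P: "prob_space P" and S: "S \<in> measurable M P" "distr M P S = P"
    and ind: "\<And>A B. A \<in> sets F \<Longrightarrow> B \<in> sets P \<Longrightarrow>
      prob (A \<inter> (S -` B \<inter> space M)) = prob A * prob (S -` B \<inter> space M)"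
    and g: "(\<lambda>(x, s). g x s) \<in> borel_measurable (F \<Otimes>\<^sub>M P)"
    and int: "\<And>x. x \<in> space M \<Longrightarrow> integrable P (g x)" "integrable M (\<lambda>x. \<integral>s. \<bar>g x s\<bar> \<partial>P)"
  shows "integrable M (\<lambda>x. g x (S x))" and "integrable M (\<lambda>x. \<integral>s. g x s \<partial>P)"
    and "(\<integral>x. g x (S x) \<partial>M) = (\<integral>x. (\<integral>s. g x s \<partial>P) \<partial>M)"
proof -
  interpret P: prob_space P by (rule P)
  have spF: "space F = space M" and FM: "sets F \<subseteq> sets M" using F by (auto simp: subalgebra_def)
  have id: "(\<lambda>x. x) \<in> measurable M F" using spF FM by (auto intro!: measurableI sets.sets_into_space)
  define R where "R = distr M F (\<lambda>x. x)"
  interpret R: prob_space R unfolding R_def by (rule prob_space_distr[OF id])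
  interpret RP: pair_prob_space R P ..
  have sR: "sets R = sets F" by (simp add: R_def)
  have pm: "(\<lambda>x. (x, S x)) \<in> measurable M (F \<Otimes>\<^sub>M P)" using id S(1) by measurable
  have eq: "R \<Otimes>\<^sub>M P = distr M (F \<Otimes>\<^sub>M P) (\<lambda>x. (x, S x))"
  proof (rule pair_measure_eqI)
    show "sigma_finite_measure R" "sigma_finite_measure P" by unfold_locales
    show "sets (R \<Otimes>\<^sub>M P) = sets (distr M (F \<Otimes>\<^sub>M P) (\<lambda>x. (x, S x)))"
      using sR by (simp cong: sets_pair_measure_cong)
    fix A B assume A: "A \<in> sets R" and B: "B \<in> sets P"
    then have AF: "A \<in> sets F" using sR by simp
    have AM: "A \<subseteq> space M" using AF spF sets.sets_into_space by blast
    have "emeasure R A = prob A"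
      using AF AM id by (simp add: R_def emeasure_distr Int_absorb2 emeasure_eq_measure)
    moreover have "emeasure P B = prob (S -` B \<inter> space M)"
      using emeasure_distr[OF S(1) B] S(2) by (simp add: emeasure_eq_measure)
    moreover have "emeasure (distr M (F \<Otimes>\<^sub>M P) (\<lambda>x. (x, S x))) (A \<times> B) = prob (A \<inter> (S -` B \<inter> space M))"
    proof -
      have "(\<lambda>x. (x, S x)) -` (A \<times> B) \<inter> space M = A \<inter> (S -` B \<inter> space M)" by auto
      then show ?thesis using AF B by (simp add: emeasure_distr[OF pm] emeasure_eq_measure)
    qed
    ultimately show "emeasure R A * emeasure P B = emeasure (distr M (F \<Otimes>\<^sub>M P) (\<lambda>x. (x, S x))) (A \<times> B)"
      using ind[OF AF B] by (simp add: ennreal_mult)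
  qed
  have gR: "(\<lambda>(x, s). g x s) \<in> borel_measurable (R \<Otimes>\<^sub>M P)"
    using g sR by (simp cong: measurable_cong_sets sets_pair_measure_cong)
  have mabs: "(\<lambda>x. \<integral>s. \<bar>g x s\<bar> \<partial>P) \<in> borel_measurable F"
    using g by (intro P.borel_measurable_lebesgue_integral) (simp add: split_beta')
  have mg: "(\<lambda>x. \<integral>s. g x s \<partial>P) \<in> borel_measurable F"
    using g by (intro P.borel_measurable_lebesgue_integral) (simp add: split_beta')
  have ig: "integrable (R \<Otimes>\<^sub>M P) (\<lambda>(x, s). g x s)"
  proof (rule RP.Fubini_integrable[OF gR])
    show "integrable R (\<lambda>x. \<integral>s. norm (case (x, s) of (x, s) \<Rightarrow> g x s) \<partial>P)"
      using int(2) mabs by (simp add: R_def integrable_distr_eq[OF id])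
    show "AE x in R. integrable P (\<lambda>s. case (x, s) of (x, s) \<Rightarrow> g x s)"
      using int(1) spF by (intro AE_I2) (simp add: R_def)
  qed
  show "integrable M (\<lambda>x. g x (S x))"
    using ig unfolding eq by (subst (asm) integrable_distr_eq[OF pm g]) simp
  show "integrable M (\<lambda>x. \<integral>s. g x s \<partial>P)"
    using RP.integrable_fst'[OF ig] mg by (simp add: R_def integrable_distr_eq[OF id])
  have "(\<integral>x. g x (S x) \<partial>M) = (\<integral>p. (case p of (x, s) \<Rightarrow> g x s) \<partial>(R \<Otimes>\<^sub>M P))"
    unfolding eq by (subst integral_distr[OF pm g]) simp
  also have "\<dots> = (\<integral>x. (\<integral>s. g x s \<partial>P) \<partial>R)"
    using RP.integral_fst'[OF ig] by simp
  also have "\<dots> = (\<integral>x. (\<integral>s. g x s \<partial>P) \<partial>M)"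
    unfolding R_def by (rule integral_distr[OF id mg])
  finally show "(\<integral>x. g x (S x) \<partial>M) = (\<integral>x. (\<integral>s. g x s \<partial>P) \<partial>M)" .
qed

lemma sets_minibatch_filtration:
  "sets (minibatch_filtration \<Omega> P m S n) = sigma_sets (space \<Omega>)
     (\<Union>p\<in>{1..n} \<times> {1..m}. {S (fst p) (snd p) -` A \<inter> space \<Omega> |A. A \<in> sets P})"
proof -
  have "{S j i -` A \<inter> space \<Omega> | j i A. j \<in> {1..n} \<and> i \<in> {1..m} \<and> A \<in> sets P} =
     (\<Union>p\<in>{1..n} \<times> {1..m}. {S (fst p) (snd p) -` A \<inter> space \<Omega> |A. A \<in> sets P})" by fastforce
  then show ?thesis unfolding minibatch_filtration_def by (subst sets_measure_of) auto
qed

lemma space_minibatch_filtration: "space (minibatch_filtration \<Omega> P m S n) = space \<Omega>"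
  unfolding minibatch_filtration_def by (rule space_measure_of) auto

lemma minibatch_filtration_mono:
  "sets (minibatch_filtration \<Omega> P m S n) \<subseteq> sets (minibatch_filtration \<Omega> P m S (Suc n))"
  unfolding sets_minibatch_filtration by (rule sigma_sets_mono') fastforce

text \<open>The last claim groups the index pairs into those of the first \<open>n\<close> rounds and the single pair
\<open>(Suc n, i)\<close>.\<close>

lemma (in prob_space)
  assumes iid: "iid_minibatches M P m S"
  shows subalgebra_minibatch_filtration: "subalgebra M (minibatch_filtration M P m S n)"
    and measurable_minibatch: "k \<ge> 1 \<Longrightarrow> i \<in> {1..m} \<Longrightarrow> S k i \<in> measurable M P"
    and minibatch_indep: "i \<in> {1..m} \<Longrightarrow> A \<in> sets (minibatch_filtration M P m S n) \<Longrightarrow> B \<in> sets P \<Longrightarrow>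
      prob (A \<inter> (S (Suc n) i -` B \<inter> space M)) = prob A * prob (S (Suc n) i -` B \<inter> space M)"
proof -
  define E where "E p = {S (fst p) (snd p) -` A \<inter> space M |A. A \<in> sets P}" for p
  have iv: "indep_vars (\<lambda>_. P) (\<lambda>(k, i). S k i) ({1..} \<times> {1..m})"
    using iid by (simp add: iid_minibatches_def)
  show meas: "k \<ge> 1 \<Longrightarrow> i \<in> {1..m} \<Longrightarrow> S k i \<in> measurable M P" for k i
    using iv unfolding indep_vars_def by auto
  show "subalgebra M (minibatch_filtration M P m S n)"
    unfolding subalgebra_def sets_minibatch_filtration space_minibatch_filtration
    by (auto intro!: sets.sigma_sets_subset measurable_sets[OF meas])
  assume i: "i \<in> {1..m}" and A: "A \<in> sets (minibatch_filtration M P m S n)" and B: "B \<in> sets P"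
  define I where "I b = (if b then {1..n} \<times> {1..m} else {(Suc n, i)})" for b
  have "indep_sets E ({1..} \<times> {1..m})"
    using iv unfolding indep_vars_def2 E_def by (auto simp: split_beta')
  then have "indep_sets E (\<Union>b\<in>UNIV. I b)"
    by (rule indep_sets_mono_index[rotated]) (use i in \<open>auto simp: I_def split: if_splits\<close>)
  then have ind: "indep_sets (\<lambda>b. sigma_sets (space M) (\<Union>p\<in>I b. E p)) UNIV"
  proof (rule indep_sets_collect_sigma)
    show "disjoint_family_on I UNIV" by (auto simp: disjoint_family_on_def I_def)
    fix b p
    show "Int_stable (E p)"
    proof (rule Int_stableI)
      fix a c assume "a \<in> E p" "c \<in> E p"
      then obtain a' c' where "a' \<in> sets P" "c' \<in> sets P" "a = S (fst p) (snd p) -` a' \<inter> space M"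
        "c = S (fst p) (snd p) -` c' \<inter> space M" by (auto simp: E_def)
      then show "a \<inter> c \<in> E p" by (auto simp: E_def intro!: exI[of _ "a' \<inter> c'"])
    qed
  qed
  define X where "X b = (if b then A else S (Suc n) i -` B \<inter> space M)" for b
  have "prob (\<Inter>b\<in>UNIV. X b) = (\<Prod>b\<in>UNIV. prob (X b))"
  proof (rule indep_setsD[OF ind])
    show "\<forall>b\<in>UNIV. X b \<in> sigma_sets (space M) (\<Union>p\<in>I b. E p)"
      using A B unfolding sets_minibatch_filtration
      by (auto simp: X_def I_def E_def intro!: sigma_sets.Basic)
  qed auto
  then show "prob (A \<inter> (S (Suc n) i -` B \<inter> space M)) = prob A * prob (S (Suc n) i -` B \<inter> space M)"
    by (simp add: UNIV_bool X_def Int_commute mult.commute)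
qed

section \<open>Random metrics and random minimizers\<close>

lemma borel_measurable_linear_apply:
  fixes N :: "'w \<Rightarrow> 'a::euclidean_space \<Rightarrow> 'a"
  assumes "\<And>x. x \<in> space F \<Longrightarrow> linear (N x)" and N [measurable]: "\<And>v. (\<lambda>x. N x v) \<in> borel_measurable F"
    and Y [measurable]: "Y \<in> borel_measurable F"
  shows "(\<lambda>x. N x (Y x)) \<in> borel_measurable F"
proof -
  have "(\<lambda>x. \<Sum>b\<in>Basis. (Y x \<bullet> b) *\<^sub>R N x b) \<in> borel_measurable F" by measurable
  also have "?this \<longleftrightarrow> ?thesis"
  proof (rule measurable_cong)
    fix x assume "x \<in> space F"
    then interpret N: linear "N x" by (rule assms(1))
    have "N x (Y x) = N x (\<Sum>b\<in>Basis. (Y x \<bullet> b) *\<^sub>R b)" by (simp add: euclidean_representation)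
    then show "(\<Sum>b\<in>Basis. (Y x \<bullet> b) *\<^sub>R N x b) = N x (Y x)" by (simp add: N.sum N.scaleR)
  qed
  finally show ?thesis .
qed

lemma borel_measurable_mnorm:
  fixes N :: "'w \<Rightarrow> 'a::euclidean_space \<Rightarrow> 'a"
  assumes "\<And>x. x \<in> space F \<Longrightarrow> spd (N x)" and N [measurable]: "\<And>v. (\<lambda>x. N x v) \<in> borel_measurable F"
    and Y [measurable]: "Y \<in> borel_measurable F"
  shows "(\<lambda>x. mnorm (N x) (Y x)) \<in> borel_measurable F"
proof -
  have [measurable]: "(\<lambda>x. N x (Y x)) \<in> borel_measurable F"
  proof (rule borel_measurable_linear_apply[OF _ N Y])
    show "\<And>x. x \<in> space F \<Longrightarrow> linear (N x)" using assms(1) unfolding spd_def by blast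
  qed
  show ?thesis unfolding mnorm_def by measurable
qed

text \<open>The minimizer is the limit of near minimizers taken from a countable dense set, each chosen as the
first good one in an enumeration and hence measurable.  Where there is no quadratic growth the limit
is arbitrary but still measurable, so the exceptional set need not belong to the sigma-algebra.\<close>

lemma measurable_argmin:
  fixes h :: "'w \<Rightarrow> 'a::euclidean_space \<Rightarrow> real"
  assumes h [measurable]: "\<And>y. (\<lambda>x. h x y) \<in> borel_measurable F"
    and cont: "\<And>x. x \<in> space F \<Longrightarrow> continuous_on UNIV (h x)"
    and bd: "\<And>x y. x \<in> space F \<Longrightarrow> l \<le> h x y"
  obtains Y where "Y \<in> borel_measurable F"
    "\<And>x c z. x \<in> space F \<Longrightarrow> 0 < c \<Longrightarrow> (\<And>y. h x z + c * (norm (y - z))\<^sup>2 \<le> h x y) \<Longrightarrow> Y x = z"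
proof -
  obtain D :: "'a set" where D: "countable D" "\<And>X. open X \<Longrightarrow> X \<noteq> {} \<Longrightarrow> \<exists>d\<in>D. d \<in> X"
    using countable_dense_setE by blast
  have "D \<noteq> {}" using D(2)[of UNIV] by auto
  define q where "q = from_nat_into D"
  have q: "\<exists>n. q n \<in> X" if "open X" "X \<noteq> {}" for X
    using D(2)[OF that] D(1) \<open>D \<noteq> {}\<close> by (metis from_nat_into_surj q_def)
  define I where "I x = (INF n. h x (q n))" for x
  have bdd: "bdd_below (range (\<lambda>n. h x (q n)))" if "x \<in> space F" for x
    using bd[OF that] by (auto intro!: bdd_belowI[of _ l])
  have I [measurable]: "I \<in> borel_measurable F"
    unfolding I_def by (rule borel_measurable_cINF) (auto intro: bdd)
  define Y where "Y j x = q (LEAST n. h x (q n) < I x + 1 / real (Suc j))" for j x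
  have Ym [measurable]: "Y j \<in> borel_measurable F" for j
    unfolding Y_def by (rule measurable_compose[of _ _ "count_space UNIV"]) measurable
  have Yh: "h x (Y j x) < I x + 1 / real (Suc j)" if "x \<in> space F" for j x
  proof -
    have "\<exists>n. h x (q n) < I x + 1 / real (Suc j)"
      using cINF_less_iff[OF _ bdd[OF that], of "I x + 1 / real (Suc j)"] by (auto simp: I_def)
    from LeastI_ex[OF this] show ?thesis unfolding Y_def .
  qed
  show ?thesis
  proof
    show "(\<lambda>x. lim (\<lambda>j. Y j x)) \<in> borel_measurable F" by measurable
    fix x c z assume w: "x \<in> space F" and c: "0 < c" and z: "\<And>y. h x z + c * (norm (y - z))\<^sup>2 \<le> h x y"
    have "I x \<le> h x z"
    proof (rule field_le_epsilon)
      fix e :: real assume e: "0 < e"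
      have "open {y. h x y < h x z + e}"
        using cont[OF w] by (intro open_Collect_less continuous_on_const)
      moreover have "z \<in> {y. h x y < h x z + e}" using e by simp
      ultimately obtain n where "h x (q n) < h x z + e" using q by blast
      moreover have "I x \<le> h x (q n)" unfolding I_def by (rule cINF_lower[OF bdd[OF w]]) simp
      ultimately show "I x \<le> h x z + e" by simp
    qed
    have "(norm (Y j x - z))\<^sup>2 \<le> 1 / c * (1 / real (Suc j))" for j
    proof -
      have "c * (norm (Y j x - z))\<^sup>2 \<le> 1 / real (Suc j)"
        using z[of "Y j x"] Yh[OF w, of j] \<open>I x \<le> h x z\<close> by linarith
      then have "1 / c * (c * (norm (Y j x - z))\<^sup>2) \<le> 1 / c * (1 / real (Suc j))"
        using c by (intro mult_left_mono) auto
      then show ?thesis using c by simp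
    qed
    note le = this
    have "(\<lambda>j. 1 / c * (1 / real (Suc j))) \<longlonglongrightarrow> 1 / c * 0"
      by (intro tendsto_mult tendsto_const LIMSEQ_Suc[OF lim_1_over_n])
    then have lim: "(\<lambda>j. 1 / c * (1 / real (Suc j))) \<longlonglongrightarrow> 0" by simp
    have ev0: "\<forall>\<^sub>F j in sequentially. 0 \<le> (norm (Y j x - z))\<^sup>2" by simp
    have ev1: "\<forall>\<^sub>F j in sequentially. (norm (Y j x - z))\<^sup>2 \<le> 1 / c * (1 / real (Suc j))"
      by (intro always_eventually allI le)
    have "(\<lambda>j. (norm (Y j x - z))\<^sup>2) \<longlonglongrightarrow> 0"
      by (rule tendsto_sandwich[OF ev0 ev1 tendsto_const lim])
    then have "(\<lambda>j. sqrt ((norm (Y j x - z))\<^sup>2)) \<longlonglongrightarrow> sqrt 0" by (intro tendsto_real_sqrt)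
    then have "(\<lambda>j. norm (Y j x - z)) \<longlonglongrightarrow> 0" by simp
    then have "(\<lambda>j. Y j x) \<longlonglongrightarrow> z" by (rule LIM_zero_cancel[OF tendsto_norm_zero_cancel])
    then show "lim (\<lambda>j. Y j x) = z" by (rule limI)
  qed
qed

text \<open>The bound on the conditional mean of the ratio of norms is given for each fixed vector, with a null set
that depends on the vector.  It extends to a random vector that is known in \<open>F\<close>: first to one with
finitely many values, then by dominated convergence.\<close>

lemma (in prob_space) random_vector_norm_ratio:
  fixes N N' :: "'a \<Rightarrow> 'v::euclidean_space \<Rightarrow> 'v"
  assumes F: "subalgebra M F"
    and N: "\<And>x. x \<in> space M \<Longrightarrow> spd (N x)" "\<And>v. (\<lambda>x. N x v) \<in> borel_measurable F"
    and N': "\<And>x. x \<in> space M \<Longrightarrow> spd (N' x)" "\<And>v. (\<lambda>x. N' x v) \<in> borel_measurable M"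
    and bN: "AE x in M. \<forall>v. mnorm (N x) v \<le> K * norm v"
    and bN': "AE x in M. \<forall>v. mnorm (N' x) v \<le> K * norm v"
    and cond: "\<And>v. v \<noteq> 0 \<Longrightarrow> AE x in M.
      real_cond_exp M F (\<lambda>x. (mnorm (N' x) v)\<^sup>2 / (mnorm (N x) v)\<^sup>2) x \<le> c"
    and Y: "Y \<in> borel_measurable F" "integrable M (\<lambda>x. (norm (Y x))\<^sup>2)"
  shows "integrable M (\<lambda>x. (mnorm (N' x) (Y x))\<^sup>2)"
    and "(\<integral>x. (mnorm (N' x) (Y x))\<^sup>2 \<partial>M) \<le> c * (\<integral>x. (mnorm (N x) (Y x))\<^sup>2 \<partial>M)"
proof -
  interpret FS: finite_measure_subalgebra M F by unfold_locales (rule F)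
  have spF: "space F = space M" and FM: "sets F \<subseteq> sets M" using F by (auto simp: subalgebra_def)
  have toM: "f \<in> borel_measurable F \<Longrightarrow> f \<in> borel_measurable M" for f :: "'a \<Rightarrow> 'b::topological_space"
    using measurable_from_subalg[OF F] .
  have mN: "(\<lambda>x. mnorm (N x) (Z x)) \<in> borel_measurable F" if "Z \<in> borel_measurable F" for Z
    using spF by (intro borel_measurable_mnorm N that) auto
  have mN': "(\<lambda>x. mnorm (N' x) (Z x)) \<in> borel_measurable M" if "Z \<in> borel_measurable F" for Z
    by (intro borel_measurable_mnorm N' toM[OF that])
  have sqb: "(mnorm A v)\<^sup>2 \<le> K\<^sup>2 * B" if "spd A" "mnorm A v \<le> K * norm v" "(norm v)\<^sup>2 \<le> B"
    for A :: "'v \<Rightarrow> 'v" and v B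
  proof -
    have "0 \<le> mnorm A v" using that(1) spd_map.mnorm_nonneg[OF spd_map.intro] by blast
    then have "(mnorm A v)\<^sup>2 \<le> (K * norm v)\<^sup>2" using that(2) by (intro power_mono)
    also have "\<dots> \<le> K\<^sup>2 * B" using that(3) by (simp add: power_mult_distrib mult_left_mono)
    finally show ?thesis .
  qed
  have spd: "\<forall>x\<in>space M. spd (N x)" "\<forall>x\<in>space M. spd (N' x)" using N(1) N'(1) by blast+
  have int: "integrable M (\<lambda>x. (mnorm (A x) (Z x))\<^sup>2)"
    if A: "\<forall>x\<in>space M. spd (A x)" "\<And>v. (\<lambda>x. A x v) \<in> borel_measurable M"
      "AE x in M. \<forall>v. mnorm (A x) v \<le> K * norm v"
      and Z: "Z \<in> borel_measurable F" "integrable M B" "\<And>x. x \<in> space M \<Longrightarrow> (norm (Z x))\<^sup>2 \<le> B x" for A :: "'a \<Rightarrow> 'v \<Rightarrow> 'v" and Z B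
  proof (rule Bochner_Integration.integrable_bound)
    show "integrable M (\<lambda>x. K\<^sup>2 * B x)" using Z(2) by simp
    have [measurable]: "(\<lambda>x. mnorm (A x) (Z x)) \<in> borel_measurable M"
      using A(1) by (intro borel_measurable_mnorm A(2) toM[OF Z(1)]) blast
    show "(\<lambda>x. (mnorm (A x) (Z x))\<^sup>2) \<in> borel_measurable M" by measurable
    have B0: "0 \<le> B x" if "x \<in> space M" for x using Z(3)[OF that] by (meson order_trans zero_le_power2)
    show "AE x in M. norm ((mnorm (A x) (Z x))\<^sup>2) \<le> norm (K\<^sup>2 * B x)"
      using A(3) AE_space by eventually_elim (use A(1) Z(3) B0 in \<open>simp add: sqb\<close>)
  qed
  note iN = int[OF spd(1) toM[OF N(2)] bN] and iN' = int[OF spd(2) N'(2) bN']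
  show "integrable M (\<lambda>x. (mnorm (N' x) (Y x))\<^sup>2)"
    by (rule iN'[OF Y]) simp

  have fixed: "(\<integral>x. indicator B x * (mnorm (N' x) v)\<^sup>2 \<partial>M) \<le> c * (\<integral>x. indicator B x * (mnorm (N x) v)\<^sup>2 \<partial>M)"
    if B: "B \<in> sets F" for B v
  proof (cases "v = 0")
    case True then show ?thesis by (simp add: mnorm_def)
  next
    case False
    \<comment> \<open>the old norm is known in \<open>F\<close> and can be moved across the conditional expectation\<close>
    define f where "f x = indicator B x * (mnorm (N x) v)\<^sup>2" for x
    define g where "g x = (mnorm (N' x) v)\<^sup>2 / (mnorm (N x) v)\<^sup>2" for x
    note [measurable] = mN[OF borel_measurable_const[of v]] mN'[OF borel_measurable_const[of v]] toM[OF mN[OF borel_measurable_const[of v]]] B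
    have BM: "B \<in> sets M" using B FM by blast
    have f: "f \<in> borel_measurable F" unfolding f_def by measurable
    have g: "g \<in> borel_measurable M" unfolding g_def by measurable
    have fg: "f x * g x = indicator B x * (mnorm (N' x) v)\<^sup>2" if "x \<in> space M" for x
    proof -
      have "(mnorm (N x) v)\<^sup>2 \<noteq> 0"
        using N(1)[OF that] False spd_map.pos[OF spd_map.intro, of "N x" v] by (auto simp: mnorm_def)
      then show ?thesis by (simp add: f_def g_def)
    qed
    have i1: "integrable M (\<lambda>x. indicator B x * (mnorm (N' x) v)\<^sup>2)"
      using integrable_mult_indicator[OF BM iN'[of "\<lambda>_. v" "\<lambda>_. (norm v)\<^sup>2"]] by simp
    have i2: "integrable M f"
      unfolding f_def using integrable_mult_indicator[OF BM iN[of "\<lambda>_. v" "\<lambda>_. (norm v)\<^sup>2"]] by simp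
    have i3: "integrable M (\<lambda>x. f x * g x)"
      using i1 by (subst Bochner_Integration.integrable_cong[OF refl fg]) auto
    have "(\<integral>x. indicator B x * (mnorm (N' x) v)\<^sup>2 \<partial>M) = (\<integral>x. f x * g x \<partial>M)"
      using fg by (intro Bochner_Integration.integral_cong) auto
    also have "\<dots> = (\<integral>x. f x * real_cond_exp M F g x \<partial>M)"
      by (rule FS.real_cond_exp_intg(2)[OF i3 f g, symmetric])
    also have "\<dots> \<le> (\<integral>x. c * f x \<partial>M)"
    proof (rule integral_mono_AE)
      show "integrable M (\<lambda>x. f x * real_cond_exp M F g x)" by (rule FS.real_cond_exp_intg(1)[OF i3 f g])
      show "integrable M (\<lambda>x. c * f x)" using i2 by simp
      show "AE x in M. f x * real_cond_exp M F g x \<le> c * f x"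
        using cond[OF False] unfolding g_def[symmetric, abs_def]
      proof eventually_elim
        case (elim x)
        then have "f x * real_cond_exp M F g x \<le> f x * c"
          by (intro mult_left_mono) (auto simp: f_def g_def[abs_def])
        then show ?case by (simp add: mult.commute)
      qed
    qed
    finally show ?thesis by (simp add: f_def)
  qed

  have simple: "(\<integral>x. (mnorm (N' x) (s x))\<^sup>2 \<partial>M) \<le> c * (\<integral>x. (mnorm (N x) (s x))\<^sup>2 \<partial>M)"
    if s: "simple_function F s" for s
  proof -
    define V where "V = s ` space M"
    define B where "B v = s -` {v} \<inter> space M" for v
    have fin: "finite V" using simple_functionD(1)[OF s] spF by (simp add: V_def)
    have B: "B v \<in> sets F" for v
      using simple_functionD(2)[OF s, of "{v}"] spF by (simp add: B_def)
    then have BM: "B v \<in> sets M" for v using FM by blast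
    have split: "(h x (s x) :: real) = (\<Sum>v\<in>V. indicator (B v) x * h x v)" if "x \<in> space M" for h x
    proof -
      have "(\<Sum>v\<in>V. indicator (B v) x * h x v) = (\<Sum>v\<in>V. if v = s x then h x v else 0)"
        using that by (intro sum.cong) (auto simp: B_def indicator_def)
      also have "\<dots> = h x (s x)" using that fin by (simp add: V_def)
      finally show ?thesis by simp
    qed
    have i1: "integrable M (\<lambda>x. indicator (B v) x * (mnorm (N' x) v)\<^sup>2)" for v
      using integrable_mult_indicator[OF BM iN'[of "\<lambda>_. v" "\<lambda>_. (norm v)\<^sup>2"]] by simp
    have i2: "integrable M (\<lambda>x. indicator (B v) x * (mnorm (N x) v)\<^sup>2)" for v
      using integrable_mult_indicator[OF BM iN[of "\<lambda>_. v" "\<lambda>_. (norm v)\<^sup>2"]] by simp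
    have "(\<integral>x. (mnorm (N' x) (s x))\<^sup>2 \<partial>M) = (\<integral>x. (\<Sum>v\<in>V. indicator (B v) x * (mnorm (N' x) v)\<^sup>2) \<partial>M)"
      by (intro Bochner_Integration.integral_cong refl split[of _ "\<lambda>x v. (mnorm (N' x) v)\<^sup>2"])
    also have "\<dots> = (\<Sum>v\<in>V. \<integral>x. indicator (B v) x * (mnorm (N' x) v)\<^sup>2 \<partial>M)"
      by (intro Bochner_Integration.integral_sum i1)
    also have "\<dots> \<le> (\<Sum>v\<in>V. c * (\<integral>x. indicator (B v) x * (mnorm (N x) v)\<^sup>2 \<partial>M))"
      by (intro sum_mono fixed B)
    also have "\<dots> = c * (\<integral>x. (\<Sum>v\<in>V. indicator (B v) x * (mnorm (N x) v)\<^sup>2) \<partial>M)"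
      by (simp add: sum_distrib_left Bochner_Integration.integral_sum[OF i2])
    also have "(\<integral>x. (\<Sum>v\<in>V. indicator (B v) x * (mnorm (N x) v)\<^sup>2) \<partial>M) = (\<integral>x. (mnorm (N x) (s x))\<^sup>2 \<partial>M)"
      by (intro Bochner_Integration.integral_cong refl split[of _ "\<lambda>x v. (mnorm (N x) v)\<^sup>2", symmetric])
    finally show ?thesis .
  qed

  obtain s where s: "\<And>i. simple_function F (s i)" and lim: "\<And>x. x \<in> space M \<Longrightarrow> (\<lambda>i. s i x) \<longlonglongrightarrow> Y x"
    and bd: "\<And>i x. x \<in> space M \<Longrightarrow> norm (s i x) \<le> 2 * norm (Y x)"
    using borel_measurable_implies_sequence_metric[OF Y(1), of 0] spF by simp metis
  have s_m: "s i \<in> borel_measurable F" for i using s by (rule borel_measurable_simple_function)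
  have iB: "integrable M (\<lambda>x. K\<^sup>2 * (4 * (norm (Y x))\<^sup>2))" using Y(2) by simp
  have bd2: "(norm (s i x))\<^sup>2 \<le> 4 * (norm (Y x))\<^sup>2" if "x \<in> space M" for i x
    using power_mono[OF bd[OF that, of i] norm_ge_zero, of 2] by (simp add: power_mult_distrib)
  have cont: "(\<lambda>i. (mnorm A (s i x))\<^sup>2) \<longlonglongrightarrow> (mnorm A (Y x))\<^sup>2" if "spd A" "x \<in> space M" for A x
  proof -
    interpret A: spd_map A by unfold_locales (rule that)
    have "isCont (\<lambda>v. (mnorm A (v - 0))\<^sup>2) (Y x)"
      using A.continuous_mnorm[of UNIV 0] continuous_on_eq_continuous_at[OF open_UNIV] by blast
    from isCont_tendsto_compose[OF this lim[OF that(2)]] show ?thesis by simp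
  qed
  have L: "(\<lambda>i. \<integral>x. (mnorm (A x) (s i x))\<^sup>2 \<partial>M) \<longlonglongrightarrow> (\<integral>x. (mnorm (A x) (Y x))\<^sup>2 \<partial>M)"
    if A: "\<forall>x\<in>space M. spd (A x)" "\<And>v. (\<lambda>x. A x v) \<in> borel_measurable M"
      "AE x in M. \<forall>v. mnorm (A x) v \<le> K * norm v" for A :: "'a \<Rightarrow> 'v \<Rightarrow> 'v"
  proof (rule integral_dominated_convergence[OF _ _ iB])
    have mA: "(\<lambda>x. mnorm (A x) (Z x)) \<in> borel_measurable M" if "Z \<in> borel_measurable F" for Z
      using A(1) by (intro borel_measurable_mnorm A(2) toM[OF that]) blast
    show "(\<lambda>x. (mnorm (A x) (Y x))\<^sup>2) \<in> borel_measurable M" using mA[OF Y(1)] by measurable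
    show "(\<lambda>x. (mnorm (A x) (s i x))\<^sup>2) \<in> borel_measurable M" for i using mA[OF s_m[of i]] by measurable
    show "AE x in M. (\<lambda>i. (mnorm (A x) (s i x))\<^sup>2) \<longlonglongrightarrow> (mnorm (A x) (Y x))\<^sup>2"
      using cont A(1) by (intro AE_I2) auto
    show "AE x in M. norm ((mnorm (A x) (s i x))\<^sup>2) \<le> K\<^sup>2 * (4 * (norm (Y x))\<^sup>2)" for i
      using A(3) AE_space by eventually_elim (use A(1) bd2 in \<open>simp add: sqb del: mult.left_commute\<close>)
  qed
  show "(\<integral>x. (mnorm (N' x) (Y x))\<^sup>2 \<partial>M) \<le> c * (\<integral>x. (mnorm (N x) (Y x))\<^sup>2 \<partial>M)"
    by (rule LIMSEQ_le[OF L[OF spd(2) N'(2) bN'] tendsto_mult_left[OF L[OF spd(1) toM[OF N(2)] bN]]]) (use simple[OF s] in blast)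
qed

section \<open>The real-valued process\<close>

lemma young_square:
  fixes u e b :: real
  assumes "0 < b"
  shows "(u + e)\<^sup>2 \<le> (1 + b) * u\<^sup>2 + (1 + 1 / b) * e\<^sup>2"
proof -
  have "0 \<le> (b * u - e)\<^sup>2 / b" using assms by simp
  also have "\<dots> = b * u\<^sup>2 - 2 * u * e + e\<^sup>2 / b"
    using assms by (simp add: power2_eq_square field_simps)
  finally show ?thesis by (simp add: power2_sum algebra_simps)
qed

text \<open>The algorithm with real-valued models \<open>\<psi> x y s\<close> on the whole space, reindexed from 0: \<open>X n\<close> and \<open>M n\<close> are known after
\<open>n\<close> minibatches, and the step to \<open>X (Suc n)\<close> uses the stepsize \<open>\<alpha> n\<close> and the metric \<open>M (Suc n)\<close>.  Thus \<open>a n\<close> stands for the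
nominal stepsize and \<open>c n\<close> for the squared distortion of the metric in that step; \<open>K\<close> and \<open>L\<close> bound the metrics above and below,
\<open>A\<close> bounds the nominal stepsizes, \<open>B\<close> the distortions and \<open>C\<close> their partial products.  The Lipschitz condition enters only
through its consequence at the centre of the model, \<open>\<psi>_lower\<close>: there the growth function is
evaluated at the current iterate, which the stepsize rule compensates.\<close>

locale model_prox_process = Om: prob_space \<Omega> + P: prob_space P
  for \<Omega> :: "'w measure" and P :: "'s measure" +
  fixes m :: nat and S :: "nat \<Rightarrow> nat \<Rightarrow> 'w \<Rightarrow> 's"
    and M :: "nat \<Rightarrow> 'w \<Rightarrow> 'a::euclidean_space \<Rightarrow> 'a"
    and X :: "nat \<Rightarrow> 'w \<Rightarrow> 'a" and x1 :: 'a
    and a c :: "nat \<Rightarrow> real"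
    and \<psi> :: "'a \<Rightarrow> 'a \<Rightarrow> 's \<Rightarrow> real" and \<phi> :: "'a \<Rightarrow> real" and \<ll> :: "'s \<Rightarrow> real" and G :: "real \<Rightarrow> real"
    and \<tau> \<eta> K L \<rho> \<gamma> A B C \<phi>inf :: real
  fixes F :: "nat \<Rightarrow> 'w measure" and \<alpha> :: "nat \<Rightarrow> 'w \<Rightarrow> real" and p :: "nat \<Rightarrow> 'w \<Rightarrow> 'a \<Rightarrow> real"
  defines "F \<equiv> minibatch_filtration \<Omega> P m S"
    and "\<alpha> \<equiv> \<lambda>n \<omega>. a n / max 1 (G (norm (X n \<omega>)))"
    and "p \<equiv> \<lambda>n \<omega> u. 1 / real m * (\<Sum>i=1..m. \<psi> (X n \<omega>) u (S (Suc n) i \<omega>))"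
  assumes m: "1 \<le> m" and iid: "iid_minibatches \<Omega> P m S"
    and pre: "preconditioners \<Omega> F M"
    and metric: "\<And>n. AE \<omega> in \<Omega>. \<forall>v. mnorm (M n \<omega>) v \<le> K * norm v \<and> norm v \<le> L * mnorm (M n \<omega>) v"
    and L: "1 \<le> L"
    and cond: "\<And>n v. v \<noteq> 0 \<Longrightarrow> AE \<omega> in \<Omega>.
      real_cond_exp \<Omega> (F n) (\<lambda>\<omega>. (mnorm (M (Suc n) \<omega>) v)\<^sup>2 / (mnorm (M n \<omega>) v)\<^sup>2) \<omega> \<le> c n"
    and c: "\<And>n. 1 \<le> c n" "\<And>n. c n \<le> B" "\<And>n. (\<Prod>i<n. c i) \<le> C"
    and \<psi>_meas: "(\<lambda>(x, y, s). \<psi> x y s) \<in> borel_measurable (borel \<Otimes>\<^sub>M borel \<Otimes>\<^sub>M P)"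
    and \<psi>_int: "\<And>x y. integrable P (\<psi> x y)"
    and \<psi>_mean: "\<And>x y. \<bar>(\<integral>s. \<psi> x y s \<partial>P) - \<phi> y\<bar> \<le> \<eta> / 2 * (norm (y - x))\<^sup>2"
    and \<psi>_curved: "AE s in P. \<forall>x. curved id (- \<tau>) (\<lambda>y. \<psi> x y s)"
    and \<psi>_lower: "AE s in P. \<forall>x y. \<psi> x x s - \<ll> s * G (norm x) * norm (y - x) - \<tau> / 2 * (norm (y - x))\<^sup>2 \<le> \<psi> x y s"
    and \<ll>: "\<ll> \<in> borel_measurable P" "\<And>s. s \<in> space P \<Longrightarrow> 0 \<le> \<ll> s" "integrable P (\<lambda>s. (\<ll> s)\<^sup>2)"
    and G: "continuous_on {0..} G" "mono_on {0..} G" "\<And>u. 0 \<le> u \<Longrightarrow> 0 \<le> G u"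
    and \<phi>inf: "\<And>u. \<phi>inf \<le> \<phi> u" and sublevel: "\<And>t. bounded {u. \<phi> u \<le> t}"
    and \<tau>\<eta>: "0 \<le> \<tau>" "0 \<le> \<eta>" "B * (L\<^sup>2 * \<eta> + 2 * (L\<^sup>2 * \<tau>)) < \<rho>"
    and a: "\<And>n. 0 < a n" "\<And>n. a n \<le> A" "A < 1 / (2 * \<rho>)" "summable (\<lambda>n. (a n)\<^sup>2)"
    and \<gamma>: "0 \<le> \<gamma>"
    and X0: "\<And>\<omega>. \<omega> \<in> space \<Omega> \<Longrightarrow> X 0 \<omega> = x1" and X_meas: "\<And>n. X n \<in> borel_measurable (F n)"
    and step: "\<And>n. AE \<omega> in \<Omega>. inexact_prox_step (L\<^sup>2 * \<tau>) (M (Suc n) \<omega>) (\<alpha> n \<omega>) (\<gamma> * (\<alpha> n \<omega>)\<^sup>2)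
      (\<lambda>u. ereal (p n \<omega> u)) (X n \<omega>) (X (Suc n) \<omega>)"
begin

definition "\<tau>L = L\<^sup>2 * \<tau>"
definition "\<eta>L = L\<^sup>2 * \<eta>"

lemma \<tau>L: "0 \<le> \<tau>L" and \<eta>L: "0 \<le> \<eta>L"
  using \<tau>\<eta> by (auto simp: \<tau>L_def \<eta>L_def)

lemma B: "1 \<le> B" using c(1,2)[of 0] by linarith

lemma \<rho>_large: "\<eta>L + 2 * \<tau>L < \<rho>"
proof -
  have "1 * (\<eta>L + 2 * \<tau>L) \<le> B * (\<eta>L + 2 * \<tau>L)" using B \<tau>L \<eta>L by (intro mult_right_mono) auto
  then show ?thesis using \<tau>\<eta>(3) by (simp add: \<tau>L_def \<eta>L_def)
qed

lemma \<rho>: "0 < \<rho>" using \<rho>_large \<tau>L \<eta>L by linarith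

lemma spF: "space (F n) = space \<Omega>"
  unfolding F_def by (rule space_minibatch_filtration)

lemma subalg: "subalgebra \<Omega> (F n)"
  unfolding F_def by (rule Om.subalgebra_minibatch_filtration[OF iid])

lemma F_to_\<Omega>: "f \<in> borel_measurable (F n) \<Longrightarrow> f \<in> borel_measurable \<Omega>"
  by (rule measurable_from_subalg[OF subalg])

lemma M_spd: "\<omega> \<in> space \<Omega> \<Longrightarrow> spd (M n \<omega>)" and M_meas: "(\<lambda>\<omega>. M n \<omega> v) \<in> borel_measurable (F n)"
  using pre by (auto simp: preconditioners_def)

lemma mnorm_meas: "Z \<in> borel_measurable (F n) \<Longrightarrow> (\<lambda>\<omega>. mnorm (M n \<omega>) (Z \<omega>)) \<in> borel_measurable (F n)"
  using M_spd spF by (intro borel_measurable_mnorm M_meas) auto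

text \<open>The mean of the model built at \<open>w\<close> agrees with \<open>\<phi>\<close> at \<open>w\<close> and differs from it by at most a quadratic
elsewhere.  Weak convexity of that model along a segment through \<open>w\<close> therefore passes to \<open>\<phi>\<close>.\<close>

lemma \<phi>_curved: "curved id (- (\<eta> + \<tau>)) \<phi>"
  unfolding curved_def mnorm_id
proof (intro allI impI)
  fix y z :: 'a and t :: real assume t: "0 \<le> t \<and> t \<le> 1"
  define w where "w = (1 - t) *\<^sub>R y + t *\<^sub>R z"
  define d where "d = (norm (z - y))\<^sup>2"
  have "y - w = (- t) *\<^sub>R (z - y)" "z - w = (1 - t) *\<^sub>R (z - y)" by (simp_all add: w_def algebra_simps)
  then have yw: "(norm (y - w))\<^sup>2 = t\<^sup>2 * d" and zw: "(norm (z - w))\<^sup>2 = (1 - t)\<^sup>2 * d"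
    by (simp_all only: norm_scaleR power_mult_distrib d_def power2_abs power2_minus)
  have "\<phi> w \<le> (\<integral>s. \<psi> w w s \<partial>P)" using \<psi>_mean[of w w] by simp
  also have "\<dots> \<le> (\<integral>s. (1 - t) * \<psi> w y s + t * \<psi> w z s + \<tau> / 2 * (t * (1 - t)) * d \<partial>P)"
  proof (rule integral_mono_AE)
    show "AE s in P. \<psi> w w s \<le> (1 - t) * \<psi> w y s + t * \<psi> w z s + \<tau> / 2 * (t * (1 - t)) * d"
      using \<psi>_curved
    proof eventually_elim
      case (elim s)
      then show ?case
        using curvedD[of id "- \<tau>" "\<lambda>y. \<psi> w y s" t y z] t by (simp add: mnorm_id d_def w_def)
    qed
  qed (intro Bochner_Integration.integrable_add integrable_mult_right \<psi>_int P.integrable_const)+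
  also have "\<dots> = (1 - t) * (\<integral>s. \<psi> w y s \<partial>P) + t * (\<integral>s. \<psi> w z s \<partial>P) + \<tau> / 2 * (t * (1 - t)) * d"
    by (simp add: \<psi>_int P.prob_space)
  also have "\<dots> \<le> (1 - t) * (\<phi> y + \<eta> / 2 * (t\<^sup>2 * d)) + t * (\<phi> z + \<eta> / 2 * ((1 - t)\<^sup>2 * d)) + \<tau> / 2 * (t * (1 - t)) * d"
  proof (intro add_right_mono add_mono mult_left_mono)
    show "(\<integral>s. \<psi> w y s \<partial>P) \<le> \<phi> y + \<eta> / 2 * (t\<^sup>2 * d)" using \<psi>_mean[of w y] unfolding yw by linarith
    show "(\<integral>s. \<psi> w z s \<partial>P) \<le> \<phi> z + \<eta> / 2 * ((1 - t)\<^sup>2 * d)" using \<psi>_mean[of w z] unfolding zw by linarith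
  qed (use t in auto)
  also have "\<dots> = (1 - t) * \<phi> y + t * \<phi> z - - (\<eta> + \<tau>) / 2 * (t * (1 - t)) * d"
    by (simp add: power2_eq_square field_simps)
  finally show "\<phi> ((1 - t) *\<^sub>R y + t *\<^sub>R z)
      \<le> (1 - t) * \<phi> y + t * \<phi> z - - (\<eta> + \<tau>) / 2 * (t * (1 - t)) * (norm (z - y))\<^sup>2"
    by (simp add: w_def d_def)
qed

lemma \<phi>_continuous: "continuous_on UNIV \<phi>"
  using spd_map.curved_continuous[OF spd_map.intro[OF spd_id] \<phi>_curved] .

lemma \<phi>_measurable [measurable]: "\<phi> \<in> borel_measurable borel"
  using \<phi>_continuous by (rule borel_measurable_continuous_onI)

definition "h n \<omega> u = \<phi> u + \<rho> / 2 * (mnorm (M n \<omega>) (u - X n \<omega>))\<^sup>2"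

text \<open>The paths on which the norm equivalence holds; on all others the envelope problem
need not be strongly convex.\<close>

definition "good n \<omega> \<longleftrightarrow> \<omega> \<in> space \<Omega> \<and>
  (\<forall>v. mnorm (M n \<omega>) v \<le> K * norm v \<and> norm v \<le> L * mnorm (M n \<omega>) v)"

lemma AE_good: "AE \<omega> in \<Omega>. good n \<omega>"
  using metric[of n] AE_space by eventually_elim (simp add: good_def)

lemma good_spd_map: "good n \<omega> \<Longrightarrow> spd_map (M n \<omega>)"
  using M_spd by (auto simp: good_def intro: spd_map.intro)

lemma h_curved:
  assumes g: "good n \<omega>"
  shows "curved (M n \<omega>) (\<rho> - \<eta>L - \<tau>L) (h n \<omega>)"
proof -
  interpret spd_map "M n \<omega>" by (rule good_spd_map[OF g])
  have "curved (M n \<omega>) (- (L\<^sup>2 * (\<eta> + \<tau>))) \<phi>"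
    using \<phi>_curved \<tau>\<eta> g by (intro curved_change_metric) (auto simp: good_def)
  from curved_add[OF this curved_quadratic[of \<rho> "X n \<omega>"]] show ?thesis
    by (simp add: h_def[abs_def] \<eta>L_def \<tau>L_def algebra_simps)
qed

lemma h_growth:
  assumes "good n \<omega>" "\<And>u. h n \<omega> z \<le> h n \<omega> u"
  shows "h n \<omega> z + (\<rho> - \<eta>L - \<tau>L) / 2 * (mnorm (M n \<omega>) (u - z))\<^sup>2 \<le> h n \<omega> u"
  by (rule spd_map.curved_min_growth[OF good_spd_map h_curved]) (fact assms)+

lemma h_minimizer_exists:
  assumes g: "good n \<omega>"
  shows "\<exists>z. \<forall>u. h n \<omega> z \<le> h n \<omega> u"
proof -
  have pos: "0 < \<rho> - \<eta>L - \<tau>L" using \<rho>_large \<tau>L by linarith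
  have L': "norm v \<le> L * mnorm (M n \<omega>) v" for v using g by (simp add: good_def)
  show ?thesis using spd_map.curved_has_min[OF good_spd_map[OF g] h_curved[OF g] pos L'] by metis
qed

lemma measurable_prox_point:
  "\<exists>y. y \<in> borel_measurable (F n) \<and> (AE \<omega> in \<Omega>. \<forall>u. h n \<omega> (y \<omega>) \<le> h n \<omega> u)"
proof -
  have [measurable]: "X n \<in> borel_measurable (F n)" by (rule X_meas)
  obtain y where y: "y \<in> borel_measurable (F n)"
    and sel: "\<And>\<omega> e z. \<omega> \<in> space (F n) \<Longrightarrow> 0 < e \<Longrightarrow> (\<And>u. h n \<omega> z + e * (norm (u - z))\<^sup>2 \<le> h n \<omega> u) \<Longrightarrow> y \<omega> = z"
  proof (rule measurable_argmin[of "h n" "F n" \<phi>inf])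
    show "(\<lambda>\<omega>. h n \<omega> u) \<in> borel_measurable (F n)" for u
    proof -
      have [measurable]: "(\<lambda>\<omega>. mnorm (M n \<omega>) (u - X n \<omega>)) \<in> borel_measurable (F n)"
        by (rule mnorm_meas) measurable
      show ?thesis unfolding h_def by measurable
    qed
    fix \<omega> assume w: "\<omega> \<in> space (F n)"
    interpret spd_map "M n \<omega>" using M_spd w spF by unfold_locales auto
    show "continuous_on UNIV (h n \<omega>)" unfolding h_def
      by (intro continuous_on_add continuous_on_mult continuous_on_const \<phi>_continuous continuous_mnorm)
    show "\<phi>inf \<le> h n \<omega> u" for u
      unfolding h_def using \<phi>inf[of u] \<rho> by (intro order_trans[OF \<phi>inf[of u]]) simp
  qed blast
  have "AE \<omega> in \<Omega>. \<forall>u. h n \<omega> (y \<omega>) \<le> h n \<omega> u"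
    using AE_good[of n]
  proof eventually_elim
    case (elim \<omega>)
    from h_minimizer_exists[OF elim] obtain z where z: "\<And>u. h n \<omega> z \<le> h n \<omega> u" by blast
    define s where "s = (\<rho> - \<eta>L - \<tau>L) / 2"
    have s: "0 < s" using \<rho>_large \<tau>L by (simp add: s_def)
    have "h n \<omega> z + s / L\<^sup>2 * (norm (u - z))\<^sup>2 \<le> h n \<omega> u" for u
    proof -
      have "norm (u - z) \<le> L * mnorm (M n \<omega>) (u - z)" using elim by (simp add: good_def)
      then have "(norm (u - z))\<^sup>2 \<le> L\<^sup>2 * (mnorm (M n \<omega>) (u - z))\<^sup>2"
        using power_mono[of "norm (u - z)" "L * mnorm (M n \<omega>) (u - z)" 2] by (simp add: power_mult_distrib)
      then have "s / L\<^sup>2 * (norm (u - z))\<^sup>2 \<le> s / L\<^sup>2 * (L\<^sup>2 * (mnorm (M n \<omega>) (u - z))\<^sup>2)"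
        using s by (intro mult_left_mono) auto
      then show ?thesis using h_growth[OF elim z, of u] L by (simp add: s_def)
    qed
    then have "y \<omega> = z"
      using sel[of \<omega> "s / L\<^sup>2" z] s L elim spF by (auto simp: good_def)
    then show ?case using z by simp
  qed
  with y show ?thesis by blast
qed

definition "y n = (SOME y. y \<in> borel_measurable (F n) \<and> (AE \<omega> in \<Omega>. \<forall>u. h n \<omega> (y \<omega>) \<le> h n \<omega> u))"

lemma y_meas: "y n \<in> borel_measurable (F n)" and y_min: "AE \<omega> in \<Omega>. \<forall>u. h n \<omega> (y n \<omega>) \<le> h n \<omega> u"
  using someI_ex[OF measurable_prox_point[of n]] by (auto simp: y_def)

text \<open>\<open>y n\<close> is the proximal point of the true objective, \<open>D n\<close> measures the stationarity of \<open>X n\<close>, and \<open>W n\<close>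
is the envelope at \<open>X n\<close> above the lower bound \<open>\<phi>inf\<close>.\<close>

definition "D n \<omega> = (mnorm (M n \<omega>) (y n \<omega> - X n \<omega>))\<^sup>2"
definition "W n \<omega> = h n \<omega> (y n \<omega>) - \<phi>inf"

lemma W_eq: "W n \<omega> = (\<phi> (y n \<omega>) - \<phi>inf) + \<rho> / 2 * D n \<omega>"
  by (simp add: W_def h_def D_def)

lemma D_nonneg: "0 \<le> D n \<omega>" by (simp add: D_def)

lemma W_nonneg: "0 \<le> W n \<omega>"
  using \<phi>inf[of "y n \<omega>"] D_nonneg[of n \<omega>] \<rho> by (simp add: W_eq)

lemma D_le_W: "\<rho> / 2 * D n \<omega> \<le> W n \<omega>"
  using \<phi>inf[of "y n \<omega>"] by (simp add: W_eq)

lemma D_meas: "D n \<in> borel_measurable (F n)" and W_meas: "W n \<in> borel_measurable (F n)"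
proof -
  note [measurable] = X_meas[of n] y_meas[of n]
  have [measurable]: "(\<lambda>\<omega>. mnorm (M n \<omega>) (y n \<omega> - X n \<omega>)) \<in> borel_measurable (F n)"
    by (rule mnorm_meas) measurable
  show D: "D n \<in> borel_measurable (F n)" unfolding D_def by measurable
  show "W n \<in> borel_measurable (F n)" unfolding W_eq[abs_def] using D by measurable
qed

lemma \<phi>_decrease:
  assumes "good n \<omega>" "\<And>u. h n \<omega> (y n \<omega>) \<le> h n \<omega> u"
  shows "\<phi> (y n \<omega>) - \<phi> (X n \<omega>) \<le> - (2 * \<rho> - \<eta>L - \<tau>L) / 2 * D n \<omega>"
proof -
  interpret spd_map "M n \<omega>" by (rule good_spd_map[OF assms(1)])
  show ?thesis using h_growth[OF assms, of "X n \<omega>"]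
    by (simp add: h_def D_def mnorm_zero mnorm_minus[of "X n \<omega>"] field_simps)
qed

lemma norm_le_D:
  assumes "good n \<omega>"
  shows "(norm (y n \<omega> - X n \<omega>))\<^sup>2 \<le> L\<^sup>2 * D n \<omega>"
  using assms power_mono[of "norm (y n \<omega> - X n \<omega>)" "L * mnorm (M n \<omega>) (y n \<omega> - X n \<omega>)" 2]
  by (simp add: good_def D_def power_mult_distrib)

text \<open>The third bound is what the growth function in the denominator is for; the fourth keeps the subproblems uniformly
strongly convex.\<close>

lemma \<alpha>: "0 < \<alpha> n \<omega>" "\<alpha> n \<omega> \<le> a n" "\<alpha> n \<omega> * G (norm (X n \<omega>)) \<le> a n" "\<tau>L * \<alpha> n \<omega> \<le> 1 / 4"
proof -
  define g where "g = max 1 (G (norm (X n \<omega>)))"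
  have g: "1 \<le> g" "G (norm (X n \<omega>)) \<le> g" by (auto simp: g_def)
  have \<alpha>g: "\<alpha> n \<omega> = a n / g" by (simp add: \<alpha>_def g_def)
  show p: "0 < \<alpha> n \<omega>" using a(1)[of n] g by (simp add: \<alpha>g)
  show le: "\<alpha> n \<omega> \<le> a n" using a(1)[of n] g by (simp add: \<alpha>g divide_le_eq mult_le_cancel_left1)
  have "\<alpha> n \<omega> * G (norm (X n \<omega>)) \<le> \<alpha> n \<omega> * g" using p g by (intro mult_left_mono) auto
  also have "\<dots> = a n" using g by (simp add: \<alpha>g)
  finally show "\<alpha> n \<omega> * G (norm (X n \<omega>)) \<le> a n" .
  have "\<tau>L * \<alpha> n \<omega> \<le> \<rho> / 2 * (1 / (2 * \<rho>))"
    using \<rho>_large \<eta>L \<tau>L \<rho> le a(2)[of n] a(3) p by (intro mult_mono) auto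
  then show "\<tau>L * \<alpha> n \<omega> \<le> 1 / 4" using \<rho> by simp
qed

lemma \<alpha>_meas: "\<alpha> n \<in> borel_measurable (F n)"
proof -
  have "continuous_on UNIV (\<lambda>v::'a. G (norm v))"
    by (rule continuous_on_compose2[OF G(1) continuous_on_norm_id]) auto
  then have [measurable]: "(\<lambda>v::'a. G (norm v)) \<in> borel_measurable borel" by (rule borel_measurable_continuous_onI)
  note [measurable] = X_meas[of n]
  show ?thesis unfolding \<alpha>_def by measurable
qed

section \<open>One step of the algorithm\<close>

text \<open>From \<open>X n\<close> to \<open>y n\<close> the mean model decreases by at least \<open>\<beta> / 2 * D n\<close>.  \<open>\<Delta>\<close> is the change of the
sampled model between the same points, times \<open>2 * \<alpha>\<close>, and \<open>\<kappa>\<close> collects the factor lost to weak convexity of the subproblem and to its inexact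
solution.\<close>

definition "\<beta> = 2 * \<rho> - 2 * \<eta>L - \<tau>L"

lemma \<beta>: "0 < \<beta>"
  unfolding \<beta>_def using \<rho>_large \<eta>L \<tau>L by linarith

definition "\<Delta> n \<omega> = 2 * \<alpha> n \<omega> * (p n \<omega> (y n \<omega>) - p n \<omega> (X n \<omega>))"
definition "\<kappa> n \<omega> = (1 + (a n)\<^sup>2) / (1 - \<tau>L * \<alpha> n \<omega>)"
definition "\<kappa>max = 2 * (1 + A\<^sup>2)"
definition "\<ll>2 n \<omega> = 1 / real m * (\<Sum>i=1..m. (\<ll> (S (Suc n) i \<omega>))\<^sup>2)"
definition "C1 = \<gamma>\<^sup>2 * (1 + A\<^sup>2)"

lemma a_sq_le: "(a n)\<^sup>2 \<le> A\<^sup>2"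
  using a(1,2)[of n] by (intro power_mono) auto

lemma \<kappa>: "0 \<le> \<kappa> n \<omega>" "\<kappa> n \<omega> \<le> \<kappa>max"
proof -
  have d: "1 / 2 \<le> 1 - \<tau>L * \<alpha> n \<omega>" using \<alpha>(4)[of n \<omega>] by linarith
  show "0 \<le> \<kappa> n \<omega>" using d by (simp add: \<kappa>_def)
  have "\<kappa> n \<omega> \<le> (1 + A\<^sup>2) / (1 / 2)"
    unfolding \<kappa>_def using d a_sq_le[of n] by (intro frac_le) auto
  then show "\<kappa> n \<omega> \<le> \<kappa>max" by (simp add: \<kappa>max_def)
qed

lemma \<kappa>_meas: "\<kappa> n \<in> borel_measurable (F n)"
  unfolding \<kappa>_def using \<alpha>_meas[of n] by measurable

lemma AE_samples:
  assumes "AE s in P. Q s"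
  shows "AE \<omega> in \<Omega>. \<forall>i\<in>{1..m}. Q (S (Suc n) i \<omega>)"
proof (rule AE_finite_allI)
  fix i assume i: "i \<in> {1..m}"
  have "distr \<Omega> P (S (Suc n) i) = P" using iid i by (simp add: iid_minibatches_def)
  with assms have "AE s in distr \<Omega> P (S (Suc n) i). Q s" by (simp only:)
  then show "AE \<omega> in \<Omega>. Q (S (Suc n) i \<omega>)"
    by (intro AE_distrD[OF Om.measurable_minibatch[OF iid _ i]]) auto
qed simp

lemma p_curved:
  assumes "\<forall>i\<in>{1..m}. \<forall>x. curved id (- \<tau>) (\<lambda>y. \<psi> x y (S (Suc n) i \<omega>))"
  shows "curved id (- \<tau>) (p n \<omega>)"
proof -
  have "curved id (real (card {1..m}) * (- \<tau>)) (\<lambda>u. \<Sum>i=1..m. \<psi> (X n \<omega>) u (S (Suc n) i \<omega>))"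
    using assms by (intro curved_sum) auto
  from curved_cmult[OF this, of "1 / real m"] show ?thesis
    using m by (simp add: p_def)
qed

lemma p_lower:
  assumes "\<forall>i\<in>{1..m}. \<forall>x y. \<psi> x x (S (Suc n) i \<omega>) - \<ll> (S (Suc n) i \<omega>) * G (norm x) * norm (y - x)
      - \<tau> / 2 * (norm (y - x))\<^sup>2 \<le> \<psi> x y (S (Suc n) i \<omega>)"
  shows "p n \<omega> (X n \<omega>) - (1 / real m * (\<Sum>i=1..m. \<ll> (S (Suc n) i \<omega>)) * G (norm (X n \<omega>))) * norm (u - X n \<omega>)
      - \<tau> / 2 * (norm (u - X n \<omega>))\<^sup>2 \<le> p n \<omega> u"
proof -
  define g where "g = G (norm (X n \<omega>)) * norm (u - X n \<omega>)"
  define q where "q = \<tau> / 2 * (norm (u - X n \<omega>))\<^sup>2"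
  have "(\<Sum>i=1..m. \<psi> (X n \<omega>) (X n \<omega>) (S (Suc n) i \<omega>) - \<ll> (S (Suc n) i \<omega>) * g - q)
      \<le> (\<Sum>i=1..m. \<psi> (X n \<omega>) u (S (Suc n) i \<omega>))"
    using assms by (intro sum_mono) (auto simp: g_def q_def mult.assoc)
  then have "(\<Sum>i=1..m. \<psi> (X n \<omega>) (X n \<omega>) (S (Suc n) i \<omega>)) - (\<Sum>i=1..m. \<ll> (S (Suc n) i \<omega>)) * g - real m * q
      \<le> (\<Sum>i=1..m. \<psi> (X n \<omega>) u (S (Suc n) i \<omega>))"
    by (simp add: sum_subtractf sum_distrib_right)
  then have "1 / real m * ((\<Sum>i=1..m. \<psi> (X n \<omega>) (X n \<omega>) (S (Suc n) i \<omega>)) - (\<Sum>i=1..m. \<ll> (S (Suc n) i \<omega>)) * g - real m * q)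
      \<le> 1 / real m * (\<Sum>i=1..m. \<psi> (X n \<omega>) u (S (Suc n) i \<omega>))"
    by (intro mult_left_mono) auto
  then show ?thesis
    using m by (simp add: p_def right_diff_distrib g_def q_def mult.assoc diff_divide_distrib)
qed

text \<open>\<open>prox_step_progress\<close> is applied with the competitor \<open>y n\<close>, the inexactness
is split off by Young's inequality with weight \<open>(a n)\<^sup>2\<close>, and \<open>y n\<close> serves as competitor in the next
envelope problem.\<close>

lemma one_step:
  "AE \<omega> in \<Omega>. W (Suc n) \<omega> \<le> (\<phi> (y n \<omega>) - \<phi>inf) + \<rho> / 2 * (\<kappa> n \<omega> *
     ((mnorm (M (Suc n) \<omega>) (y n \<omega> - X n \<omega>))\<^sup>2 + \<Delta> n \<omega>
       + 2 * (a n * L)\<^sup>2 * \<ll>2 n \<omega>) + C1 * (a n)\<^sup>2)"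
proof -
  have "AE s in P. 0 \<le> \<ll> s" using \<ll>(2) by (intro AE_I2)
  note AE_samples[OF \<psi>_curved, of n] AE_samples[OF \<psi>_lower, of n] AE_samples[OF this, of n]
    AE_good[of "Suc n"] y_min[of "Suc n"] step[of n]
  then show ?thesis
  proof eventually_elim
    case (elim \<omega>)
    note g = elim(4)
    interpret spd_map "M (Suc n) \<omega>" by (rule good_spd_map[OF g])
    define x x' yy l where "x = X n \<omega>" and "x' = X (Suc n) \<omega>" and "yy = y n \<omega>"
      and "l = 1 / real m * (\<Sum>i=1..m. \<ll> (S (Suc n) i \<omega>)) * G (norm (X n \<omega>))"
    have L': "norm v \<le> L * mnorm (M (Suc n) \<omega>) v" for v using g by (simp add: good_def)
    have lbar: "0 \<le> 1 / real m * (\<Sum>i=1..m. \<ll> (S (Suc n) i \<omega>))" 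
      using elim(3) by (intro mult_nonneg_nonneg sum_nonneg) auto
    have l0: "0 \<le> l" unfolding l_def by (rule mult_nonneg_nonneg[OF lbar G(3)]) simp
    have pc: "curved (M (Suc n) \<omega>) (- \<tau>L) (p n \<omega>)"
      unfolding \<tau>L_def by (rule curved_change_metric[OF p_curved[OF elim(1)] \<tau>\<eta>(1) L'])
    obtain z where z1: "mnorm (M (Suc n) \<omega>) (x' - z) \<le> \<gamma> * (\<alpha> n \<omega>)\<^sup>2"
      and z2: "\<And>u. p n \<omega> z + 1 / (2 * \<alpha> n \<omega>) * (mnorm (M (Suc n) \<omega>) (z - x))\<^sup>2
         \<le> p n \<omega> u + 1 / (2 * \<alpha> n \<omega>) * (mnorm (M (Suc n) \<omega>) (u - x))\<^sup>2"
    proof (rule inexact_prox_step_close[OF pc _ _ L'])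
      show "inexact_prox_step \<tau>L (M (Suc n) \<omega>) (\<alpha> n \<omega>) (\<gamma> * (\<alpha> n \<omega>)\<^sup>2) (\<lambda>u. ereal (p n \<omega> u)) x x'"
        using elim(6) by (simp add: \<tau>L_def x_def x'_def)
    qed (use \<alpha>(1,4)[of n \<omega>] \<gamma> in auto)
    have "(1 - \<tau>L * \<alpha> n \<omega>) * (mnorm (M (Suc n) \<omega>) (yy - z))\<^sup>2
      \<le> (mnorm (M (Suc n) \<omega>) (yy - x))\<^sup>2 + 2 * \<alpha> n \<omega> * (p n \<omega> yy - p n \<omega> x) + 2 * (\<alpha> n \<omega> * l * L)\<^sup>2"
    proof (rule prox_step_progress[OF pc _ _ L' l0 _ \<tau>L_def \<tau>\<eta>(1)])
      show "p n \<omega> x - l * norm (u - x) - \<tau> / 2 * (norm (u - x))\<^sup>2 \<le> p n \<omega> u" for u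
        using p_lower[OF elim(2)] by (simp add: x_def l_def)
    qed (use \<alpha>(1,4)[of n \<omega>] L z2 in auto)
    also have "(\<alpha> n \<omega> * l * L)\<^sup>2 \<le> (a n * L)\<^sup>2 * \<ll>2 n \<omega>"
    proof -
      define lb where "lb = 1 / real m * (\<Sum>i=1..m. \<ll> (S (Suc n) i \<omega>))"
      have "\<alpha> n \<omega> * l = (\<alpha> n \<omega> * G (norm x)) * lb" by (simp add: l_def x_def lb_def)
      also have "\<dots> \<le> a n * lb" using \<alpha>(3)[of n \<omega>] lbar by (intro mult_right_mono) (auto simp: x_def lb_def)
      finally have "(\<alpha> n \<omega> * l * L)\<^sup>2 \<le> (a n * lb * L)\<^sup>2"
        using L l0 \<alpha>(1)[of n \<omega>] by (intro power_mono mult_right_mono mult_nonneg_nonneg) auto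
      also have "\<dots> = (a n * L)\<^sup>2 * lb\<^sup>2" by (simp add: power_mult_distrib)
      also have "lb\<^sup>2 \<le> \<ll>2 n \<omega>"
      proof -
        have "(\<Sum>i=1..m. \<ll> (S (Suc n) i \<omega>))\<^sup>2 \<le> (\<Sum>i=1..m. (\<ll> (S (Suc n) i \<omega>))\<^sup>2) * real (card {1..m})"
          by (rule sum_squared_le_sum_of_squares)
        then have "(\<Sum>i=1..m. \<ll> (S (Suc n) i \<omega>))\<^sup>2 / (real m)\<^sup>2 \<le> (\<Sum>i=1..m. (\<ll> (S (Suc n) i \<omega>))\<^sup>2) * real m / (real m)\<^sup>2"
          by (intro divide_right_mono) auto
        then show ?thesis
          using m by (simp add: lb_def \<ll>2_def power_divide power2_eq_square)
      qed
      finally show ?thesis by (simp add: mult_left_mono)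
    qed
    finally have "(1 - \<tau>L * \<alpha> n \<omega>) * (mnorm (M (Suc n) \<omega>) (yy - z))\<^sup>2 \<le> (mnorm (M (Suc n) \<omega>) (yy - x))\<^sup>2
        + 2 * \<alpha> n \<omega> * (p n \<omega> yy - p n \<omega> x) + 2 * (a n * L)\<^sup>2 * \<ll>2 n \<omega>" (is "_ \<le> ?R")
      by simp
    then have yz: "(mnorm (M (Suc n) \<omega>) (yy - z))\<^sup>2 \<le> ?R / (1 - \<tau>L * \<alpha> n \<omega>)"
      using \<alpha>(4)[of n \<omega>] by (simp add: pos_le_divide_eq mult.commute)
    have ep: "\<gamma> * (\<alpha> n \<omega>)\<^sup>2 \<le> \<gamma> * (a n)\<^sup>2"
      using \<alpha>(1,2)[of n \<omega>] \<gamma> by (intro mult_left_mono power_mono) auto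
    have "mnorm (M (Suc n) \<omega>) (yy - x') \<le> mnorm (M (Suc n) \<omega>) (yy - z) + mnorm (M (Suc n) \<omega>) (z - x')"
      using mnorm_triangle[of "yy - z" "z - x'"] by simp
    then have tri: "mnorm (M (Suc n) \<omega>) (yy - x') \<le> mnorm (M (Suc n) \<omega>) (yy - z) + \<gamma> * (a n)\<^sup>2"
      using z1 ep by (simp add: mnorm_minus[of z x'])
    have "(mnorm (M (Suc n) \<omega>) (yy - x'))\<^sup>2 \<le> (mnorm (M (Suc n) \<omega>) (yy - z) + \<gamma> * (a n)\<^sup>2)\<^sup>2"
      by (rule power_mono[OF tri mnorm_nonneg])
    also have "\<dots> \<le> (1 + (a n)\<^sup>2) * (mnorm (M (Suc n) \<omega>) (yy - z))\<^sup>2 + (1 + 1 / (a n)\<^sup>2) * (\<gamma> * (a n)\<^sup>2)\<^sup>2"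
      using a(1)[of n] by (intro young_square) simp
    also have "(1 + 1 / (a n)\<^sup>2) * (\<gamma> * (a n)\<^sup>2)\<^sup>2 = \<gamma>\<^sup>2 * (1 + (a n)\<^sup>2) * (a n)\<^sup>2"
      using a(1)[of n] by (simp add: field_simps power2_eq_square)
    also have "\<dots> \<le> C1 * (a n)\<^sup>2"
      unfolding C1_def using a_sq_le[of n] by (intro mult_right_mono mult_left_mono) auto
    also have "(1 + (a n)\<^sup>2) * (mnorm (M (Suc n) \<omega>) (yy - z))\<^sup>2 \<le> (1 + (a n)\<^sup>2) * (?R / (1 - \<tau>L * \<alpha> n \<omega>))"
      using yz by (intro mult_left_mono) auto
    also have "\<dots> = \<kappa> n \<omega> * ?R" by (simp add: \<kappa>_def)
    finally have fin: "(mnorm (M (Suc n) \<omega>) (yy - x'))\<^sup>2 \<le> \<kappa> n \<omega> * ?R + C1 * (a n)\<^sup>2" by simp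
    have "W (Suc n) \<omega> \<le> h (Suc n) \<omega> yy - \<phi>inf" using elim(5) by (simp add: W_def)
    also have "\<dots> = (\<phi> yy - \<phi>inf) + \<rho> / 2 * (mnorm (M (Suc n) \<omega>) (yy - x'))\<^sup>2"
      by (simp add: h_def x'_def)
    also have "\<dots> \<le> (\<phi> yy - \<phi>inf) + \<rho> / 2 * (\<kappa> n \<omega> * ?R + C1 * (a n)\<^sup>2)"
      using \<rho> fin by (intro add_left_mono mult_left_mono) auto
    finally show ?case by (simp add: yy_def x_def \<Delta>_def)
  qed
qed

definition "El = (\<integral>s. \<ll> s \<partial>P)"
definition "El2 = (\<integral>s. (\<ll> s)\<^sup>2 \<partial>P)"

lemma \<ll>_integrable: "integrable P \<ll>"
proof (rule Bochner_Integration.integrable_bound)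
  show "integrable P (\<lambda>s. 1 + (\<ll> s)\<^sup>2)" using \<ll>(3) by simp
  have "\<bar>t\<bar> \<le> 1 + t\<^sup>2" for t :: real
    using zero_le_power2[of "\<bar>t\<bar> - 1"] by (simp add: power2_diff)
  then show "AE s in P. norm (\<ll> s) \<le> norm (1 + (\<ll> s)\<^sup>2)" by (intro AE_I2) (simp add: abs_of_nonneg)
qed (rule \<ll>(1))

lemma El: "0 \<le> El" "0 \<le> El2"
  unfolding El_def El2_def using \<ll>(2) by (auto intro!: integral_nonneg_AE AE_I2)

lemma sample_avg_integral:
  fixes q :: "'w \<Rightarrow> 's \<Rightarrow> real"
  assumes q: "(\<lambda>(\<omega>, s). q \<omega> s) \<in> borel_measurable (F n \<Otimes>\<^sub>M P)"
    and int: "\<And>\<omega>. \<omega> \<in> space \<Omega> \<Longrightarrow> integrable P (q \<omega>)" "integrable \<Omega> (\<lambda>\<omega>. \<integral>s. \<bar>q \<omega> s\<bar> \<partial>P)"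
  shows "integrable \<Omega> (\<lambda>\<omega>. 1 / real m * (\<Sum>i=1..m. q \<omega> (S (Suc n) i \<omega>)))"
    and "integrable \<Omega> (\<lambda>\<omega>. \<integral>s. q \<omega> s \<partial>P)"
    and "(\<integral>\<omega>. 1 / real m * (\<Sum>i=1..m. q \<omega> (S (Suc n) i \<omega>)) \<partial>\<Omega>) = (\<integral>\<omega>. (\<integral>s. q \<omega> s \<partial>P) \<partial>\<Omega>)"
proof -
  have fr: "integrable \<Omega> (\<lambda>\<omega>. q \<omega> (S (Suc n) i \<omega>))" "integrable \<Omega> (\<lambda>\<omega>. \<integral>s. q \<omega> s \<partial>P)"
    "(\<integral>\<omega>. q \<omega> (S (Suc n) i \<omega>) \<partial>\<Omega>) = (\<integral>\<omega>. (\<integral>s. q \<omega> s \<partial>P) \<partial>\<Omega>)" if i: "i \<in> {1..m}" for i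
  proof -
    have P: "prob_space P" by unfold_locales
    have d: "distr \<Omega> P (S (Suc n) i) = P" using iid i by (simp add: iid_minibatches_def)
    have Sm: "S (Suc n) i \<in> measurable \<Omega> P" by (rule Om.measurable_minibatch[OF iid _ i]) simp
    have ind: "Om.prob (U \<inter> (S (Suc n) i -` V \<inter> space \<Omega>)) = Om.prob U * Om.prob (S (Suc n) i -` V \<inter> space \<Omega>)"
      if "U \<in> sets (F n)" "V \<in> sets P" for U V
      using Om.minibatch_indep[OF iid i _ that(2)] that(1) by (simp add: F_def)
    note fz = Om.freezing[OF subalg P Sm d ind q int]
    show "integrable \<Omega> (\<lambda>\<omega>. q \<omega> (S (Suc n) i \<omega>))" "integrable \<Omega> (\<lambda>\<omega>. \<integral>s. q \<omega> s \<partial>P)"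
      "(\<integral>\<omega>. q \<omega> (S (Suc n) i \<omega>) \<partial>\<Omega>) = (\<integral>\<omega>. (\<integral>s. q \<omega> s \<partial>P) \<partial>\<Omega>)"
      by (rule fz; assumption)+
  qed
  show "integrable \<Omega> (\<lambda>\<omega>. 1 / real m * (\<Sum>i=1..m. q \<omega> (S (Suc n) i \<omega>)))"
    using fr(1) by (intro integrable_mult_right Bochner_Integration.integrable_sum)
  show "integrable \<Omega> (\<lambda>\<omega>. \<integral>s. q \<omega> s \<partial>P)" using fr(2)[of 1] m by simp
  have "(\<integral>\<omega>. 1 / real m * (\<Sum>i=1..m. q \<omega> (S (Suc n) i \<omega>)) \<partial>\<Omega>)
      = 1 / real m * (\<Sum>i=1..m. \<integral>\<omega>. q \<omega> (S (Suc n) i \<omega>) \<partial>\<Omega>)"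
    using fr(1) by (simp add: Bochner_Integration.integral_sum)
  also have "\<dots> = (\<integral>\<omega>. (\<integral>s. q \<omega> s \<partial>P) \<partial>\<Omega>)" using fr(3) m by simp
  finally show "(\<integral>\<omega>. 1 / real m * (\<Sum>i=1..m. q \<omega> (S (Suc n) i \<omega>)) \<partial>\<Omega>) = (\<integral>\<omega>. (\<integral>s. q \<omega> s \<partial>P) \<partial>\<Omega>)" .
qed

lemma \<ll>2_integral: "integrable \<Omega> (\<ll>2 n)" "(\<integral>\<omega>. \<ll>2 n \<omega> \<partial>\<Omega>) = El2"
proof -
  have q: "(\<lambda>(\<omega>, s). (\<ll> s)\<^sup>2) \<in> borel_measurable (F n \<Otimes>\<^sub>M P)" using \<ll>(1) by measurable
  note sa = sample_avg_integral[OF q \<ll>(3)]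
  show "integrable \<Omega> (\<ll>2 n)" unfolding \<ll>2_def by (rule sa(1)) simp
  have "(\<integral>\<omega>. \<ll>2 n \<omega> \<partial>\<Omega>) = (\<integral>\<omega>. El2 \<partial>\<Omega>)" unfolding \<ll>2_def El2_def by (rule sa(3)) simp
  then show "(\<integral>\<omega>. \<ll>2 n \<omega> \<partial>\<Omega>) = El2" by (simp add: Om.prob_space)
qed

text \<open>The lower bound on the models makes the negative part of their increment integrable with an explicit
bound; the positive part is then controlled by the mean.\<close>

lemma abs_increment_integral:
  "(\<integral>s. \<bar>\<psi> x u s - \<psi> x x s\<bar> \<partial>P)
    \<le> (\<phi> u - \<phi> x) + \<eta> / 2 * (norm (u - x))\<^sup>2 + 2 * (El * G (norm x) * norm (u - x) + \<tau> / 2 * (norm (u - x))\<^sup>2)"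
    (is ?abs)
  and mean_increment: "(\<integral>s. \<psi> x u s \<partial>P) - (\<integral>s. \<psi> x x s \<partial>P) \<le> (\<phi> u - \<phi> x) + \<eta> / 2 * (norm (u - x))\<^sup>2"
proof -
  show mi: "(\<integral>s. \<psi> x u s \<partial>P) - (\<integral>s. \<psi> x x s \<partial>P) \<le> (\<phi> u - \<phi> x) + \<eta> / 2 * (norm (u - x))\<^sup>2"
  proof -
    have "(\<integral>s. \<psi> x x s \<partial>P) = \<phi> x" using \<psi>_mean[of x x] by simp
    then show ?thesis using \<psi>_mean[of x u] unfolding abs_le_iff by linarith
  qed
  have int: "integrable P (\<lambda>s. (\<psi> x u s - \<psi> x x s) + 2 * (\<ll> s * G (norm x) * norm (u - x) + \<tau> / 2 * (norm (u - x))\<^sup>2))"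
    by (intro Bochner_Integration.integrable_add Bochner_Integration.integrable_diff integrable_mult_right
        integrable_mult_left \<psi>_int \<ll>_integrable P.integrable_const)
  have "(\<integral>s. \<bar>\<psi> x u s - \<psi> x x s\<bar> \<partial>P)
      \<le> (\<integral>s. (\<psi> x u s - \<psi> x x s) + 2 * (\<ll> s * G (norm x) * norm (u - x) + \<tau> / 2 * (norm (u - x))\<^sup>2) \<partial>P)"
  proof (rule integral_mono_AE[OF _ int])
    show "integrable P (\<lambda>s. \<bar>\<psi> x u s - \<psi> x x s\<bar>)" by (intro integrable_abs Bochner_Integration.integrable_diff \<psi>_int)
    show "AE s in P. \<bar>\<psi> x u s - \<psi> x x s\<bar>
        \<le> (\<psi> x u s - \<psi> x x s) + 2 * (\<ll> s * G (norm x) * norm (u - x) + \<tau> / 2 * (norm (u - x))\<^sup>2)"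
      using \<psi>_lower AE_space
    proof eventually_elim
      case (elim s)
      have low: "\<psi> x x s - \<ll> s * G (norm x) * norm (u - x) - \<tau> / 2 * (norm (u - x))\<^sup>2 \<le> \<psi> x u s"
        using elim(1) by blast
      have "0 \<le> \<ll> s * G (norm x) * norm (u - x)" using \<ll>(2)[OF elim(2)] G(3) by simp
      moreover have "0 \<le> \<tau> / 2 * (norm (u - x))\<^sup>2" using \<tau>\<eta> by simp
      moreover have "\<bar>v - u\<bar> \<le> (v - u) + 2 * (b + d)" if "0 \<le> b" "0 \<le> d" "u - b - d \<le> v" for u v b d :: real
        using that by (simp add: abs_le_iff)
      ultimately show ?case using low by blast
    qed
  qed
  also have "\<dots> = ((\<integral>s. \<psi> x u s \<partial>P) - (\<integral>s. \<psi> x x s \<partial>P)) + 2 * (El * G (norm x) * norm (u - x) + \<tau> / 2 * (norm (u - x))\<^sup>2)"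
    by (simp add: \<psi>_int \<ll>_integrable P.prob_space El_def)
  finally show ?abs using mi by linarith
qed

lemma D_integrable:
  assumes "integrable \<Omega> (W n)" shows "integrable \<Omega> (D n)"
proof (rule Bochner_Integration.integrable_bound)
  show "integrable \<Omega> (\<lambda>\<omega>. 2 / \<rho> * W n \<omega>)" using assms by simp
  show "D n \<in> borel_measurable \<Omega>" by (rule F_to_\<Omega>[OF D_meas])
  have "D n \<omega> \<le> 2 / \<rho> * W n \<omega>" for \<omega> using D_le_W[of n \<omega>] \<rho> by (simp add: field_simps)
  then show "AE \<omega> in \<Omega>. norm (D n \<omega>) \<le> norm (2 / \<rho> * W n \<omega>)"
    using D_nonneg W_nonneg \<rho> by (intro AE_I2) (simp add: abs_of_nonneg)
qed

text \<open>The conditional mean of \<open>\<Delta>\<close> is at most \<open>- \<alpha> \<beta> D\<close>, because the sample is independent of \<open>X n\<close> and \<open>y n\<close>.  Here \<open>W\<close> is assumed integrable so that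
\<open>D\<close>, and with it the increments, are integrable.\<close>

lemma model_increment:
  assumes W: "integrable \<Omega> (W n)" and E: "E \<in> sets (F n)"
  shows "integrable \<Omega> (\<lambda>\<omega>. indicator E \<omega> * \<kappa> n \<omega> * \<Delta> n \<omega>)"
    and "(\<integral>\<omega>. indicator E \<omega> * \<kappa> n \<omega> * \<Delta> n \<omega> \<partial>\<Omega>)
      \<le> (\<integral>\<omega>. indicator E \<omega> * \<kappa> n \<omega> * (- (\<alpha> n \<omega> * \<beta> * D n \<omega>)) \<partial>\<Omega>)"
proof -
  note [measurable] = X_meas[of n] y_meas[of n] \<alpha>_meas[of n] \<kappa>_meas[of n] D_meas[of n] E
  have D: "integrable \<Omega> (D n)" by (rule D_integrable[OF W])
  have E\<Omega>: "E \<in> sets \<Omega>" using E subalg[of n] by (auto simp: subalgebra_def)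
  define w where "w \<omega> = indicator E \<omega> * \<kappa> n \<omega> * (2 * \<alpha> n \<omega>)" for \<omega>
  define q where "q \<omega> s = w \<omega> * (\<psi> (X n \<omega>) (y n \<omega>) s - \<psi> (X n \<omega>) (X n \<omega>) s)" for \<omega> s
  have w_meas [measurable]: "w \<in> borel_measurable (F n)" unfolding w_def by measurable
  have w0: "0 \<le> w \<omega>" for \<omega> using \<kappa>(1)[of n \<omega>] \<alpha>(1)[of n \<omega>] by (simp add: w_def)
  have w1: "w \<omega> \<le> \<kappa>max * 2 * \<alpha> n \<omega>" for \<omega>
    using \<kappa>[of n \<omega>] \<alpha>(1)[of n \<omega>] by (auto simp: w_def indicator_def)
  have \<psi>m: "(\<lambda>(\<omega>, s). \<psi> (U \<omega>) (V \<omega>) s) \<in> borel_measurable (F n \<Otimes>\<^sub>M P)"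
    if [measurable]: "U \<in> borel_measurable (F n)" "V \<in> borel_measurable (F n)" for U V
  proof -
    have "(\<lambda>(\<omega>, s). (U \<omega>, V \<omega>, s)) \<in> measurable (F n \<Otimes>\<^sub>M P) (borel \<Otimes>\<^sub>M borel \<Otimes>\<^sub>M P)" by measurable
    from measurable_compose[OF this \<psi>_meas] show ?thesis by (simp add: split_beta')
  qed
  have qm: "(\<lambda>(\<omega>, s). q \<omega> s) \<in> borel_measurable (F n \<Otimes>\<^sub>M P)"
  proof -
    note [measurable] = \<psi>m[OF X_meas[of n] y_meas[of n]] \<psi>m[OF X_meas[of n] X_meas[of n]]
    have "(\<lambda>z. w (fst z) * ((case z of (\<omega>, s) \<Rightarrow> \<psi> (X n \<omega>) (y n \<omega>) s) - (case z of (\<omega>, s) \<Rightarrow> \<psi> (X n \<omega>) (X n \<omega>) s)))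
        \<in> borel_measurable (F n \<Otimes>\<^sub>M P)" by measurable
    then show ?thesis by (simp add: q_def split_beta')
  qed
  have qi: "integrable P (q \<omega>)" for \<omega>
    unfolding q_def by (intro integrable_mult_right Bochner_Integration.integrable_diff \<psi>_int)
  have AE_desc: "AE \<omega> in \<Omega>. \<phi> (y n \<omega>) - \<phi> (X n \<omega>) \<le> - (2 * \<rho> - \<eta>L - \<tau>L) / 2 * D n \<omega> \<and>
      (norm (y n \<omega> - X n \<omega>))\<^sup>2 \<le> L\<^sup>2 * D n \<omega>"
    using AE_good[of n] y_min[of n] by eventually_elim (use \<phi>_decrease norm_le_D in blast)
  define H where "H = \<kappa>max * 2 * a n * (\<eta>L / 2 + 2 * El * L\<^sup>2 + \<tau>L)"
  define H' where "H' = \<kappa>max * 2 * a n * (2 * El)"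
  have \<kappa>m: "0 \<le> \<kappa>max" by (simp add: \<kappa>max_def)
  have qabs: "integrable \<Omega> (\<lambda>\<omega>. \<integral>s. \<bar>q \<omega> s\<bar> \<partial>P)"
  proof (rule Bochner_Integration.integrable_bound)
    show "integrable \<Omega> (\<lambda>\<omega>. H * D n \<omega> + H')" using D by simp
    have "(\<lambda>\<omega>. \<integral>s. \<bar>q \<omega> s\<bar> \<partial>P) \<in> borel_measurable (F n)"
      using qm by (intro P.borel_measurable_lebesgue_integral) (simp add: split_beta')
    then show "(\<lambda>\<omega>. \<integral>s. \<bar>q \<omega> s\<bar> \<partial>P) \<in> borel_measurable \<Omega>" by (rule F_to_\<Omega>)
    show "AE \<omega> in \<Omega>. norm (\<integral>s. \<bar>q \<omega> s\<bar> \<partial>P) \<le> norm (H * D n \<omega> + H')"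
      using AE_desc
    proof eventually_elim
      case (elim \<omega>)
      define d where "d = norm (y n \<omega> - X n \<omega>)"
      define g where "g = G (norm (X n \<omega>))"
      have g0: "0 \<le> g" by (simp add: g_def G(3))
      have d2: "d\<^sup>2 \<le> L\<^sup>2 * D n \<omega>" and d0: "0 \<le> d" using elim by (auto simp: d_def)
      have d1: "d \<le> 1 + L\<^sup>2 * D n \<omega>"
        using d2 zero_le_power2[of "d - 1"] d0 by (simp add: power2_diff)
      have "0 \<le> (2 * \<rho> - \<eta>L - \<tau>L) / 2 * D n \<omega>" using \<rho>_large \<eta>L \<tau>L D_nonneg[of n \<omega>] \<rho> by simp
      moreover have "- (2 * \<rho> - \<eta>L - \<tau>L) / 2 * D n \<omega> = - ((2 * \<rho> - \<eta>L - \<tau>L) / 2 * D n \<omega>)"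
        by (simp only: minus_divide_left[symmetric] mult_minus_left)
      ultimately have dec: "\<phi> (y n \<omega>) - \<phi> (X n \<omega>) \<le> 0" using elim by linarith
      have "(\<integral>s. \<bar>q \<omega> s\<bar> \<partial>P) = w \<omega> * (\<integral>s. \<bar>\<psi> (X n \<omega>) (y n \<omega>) s - \<psi> (X n \<omega>) (X n \<omega>) s\<bar> \<partial>P)"
        using w0 by (simp add: q_def abs_mult)
      also have "\<dots> \<le> (\<kappa>max * 2 * \<alpha> n \<omega>) * (\<eta> / 2 * d\<^sup>2 + 2 * (El * g * d + \<tau> / 2 * d\<^sup>2))"
        using abs_increment_integral[of "X n \<omega>" "y n \<omega>"] dec w0 w1 \<kappa>m \<alpha>(1)[of n \<omega>]
        by (intro mult_mono) (auto simp: d_def g_def)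
      also have "\<dots> = \<kappa>max * 2 * (\<alpha> n \<omega> * (\<eta> / 2 + \<tau>) * d\<^sup>2 + 2 * El * (\<alpha> n \<omega> * g) * d)"
        by (simp add: algebra_simps)
      also have "\<dots> \<le> \<kappa>max * 2 * (a n * (\<eta> / 2 + \<tau>) * (L\<^sup>2 * D n \<omega>) + 2 * El * a n * (1 + L\<^sup>2 * D n \<omega>))"
        using \<kappa>m d0 d1 d2 \<tau>\<eta> \<alpha>(1,2,3)[of n \<omega>] El(1) a(1)[of n] g0
        by (intro mult_left_mono add_mono mult_mono) (auto simp: g_def)
      also have "\<dots> = H * D n \<omega> + H'" by (simp add: H_def H'_def \<eta>L_def \<tau>L_def algebra_simps)
      finally have "(\<integral>s. \<bar>q \<omega> s\<bar> \<partial>P) \<le> H * D n \<omega> + H'" .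
      moreover have "0 \<le> (\<integral>s. \<bar>q \<omega> s\<bar> \<partial>P)" by simp
      ultimately show ?case by simp
    qed
  qed
  have eq: "1 / real m * (\<Sum>i=1..m. q \<omega> (S (Suc n) i \<omega>))
      = indicator E \<omega> * \<kappa> n \<omega> * \<Delta> n \<omega>" for \<omega>
    by (simp add: q_def p_def w_def \<Delta>_def sum_distrib_left[symmetric] sum_subtractf right_diff_distrib diff_divide_distrib)
  note sa = sample_avg_integral[OF qm qi qabs, unfolded eq]
  show "integrable \<Omega> (\<lambda>\<omega>. indicator E \<omega> * \<kappa> n \<omega> * \<Delta> n \<omega>)"
    by (rule sa(1))
  have "(\<integral>\<omega>. (\<integral>s. q \<omega> s \<partial>P) \<partial>\<Omega>)
      \<le> (\<integral>\<omega>. indicator E \<omega> * \<kappa> n \<omega> * (- (\<alpha> n \<omega> * \<beta> * D n \<omega>)) \<partial>\<Omega>)"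
  proof (rule integral_mono_AE[OF sa(2)])
    show "integrable \<Omega> (\<lambda>\<omega>. indicator E \<omega> * \<kappa> n \<omega> * (- (\<alpha> n \<omega> * \<beta> * D n \<omega>)))"
    proof (rule Bochner_Integration.integrable_bound)
      show "integrable \<Omega> (\<lambda>\<omega>. \<kappa>max * (a n * \<beta> * D n \<omega>))" using D by simp
      have "(\<lambda>\<omega>. indicator E \<omega> * \<kappa> n \<omega> * (- (\<alpha> n \<omega> * \<beta> * D n \<omega>))) \<in> borel_measurable (F n)"
        by measurable
      then show "(\<lambda>\<omega>. indicator E \<omega> * \<kappa> n \<omega> * (- (\<alpha> n \<omega> * \<beta> * D n \<omega>))) \<in> borel_measurable \<Omega>"
        by (rule F_to_\<Omega>)
      note c3 = less_imp_le[OF \<beta>]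
      have "\<kappa> n \<omega> * (\<alpha> n \<omega> * \<beta> * D n \<omega>) \<le> \<kappa>max * (a n * \<beta> * D n \<omega>)" for \<omega>
        using \<kappa>[of n \<omega>] \<kappa>m \<alpha>(1,2)[of n \<omega>] c3 D_nonneg[of n \<omega>] a(1)[of n]
        by (intro mult_mono mult_nonneg_nonneg) auto
      then show "AE \<omega> in \<Omega>. norm (indicator E \<omega> * \<kappa> n \<omega> * (- (\<alpha> n \<omega> * \<beta> * D n \<omega>)))
          \<le> norm (\<kappa>max * (a n * \<beta> * D n \<omega>))"
        using \<kappa>(1) \<kappa>m \<alpha>(1) c3 D_nonneg a(1)[of n]
        by (intro AE_I2) (auto simp: indicator_def abs_mult less_imp_le)
    qed
    show "AE \<omega> in \<Omega>. (\<integral>s. q \<omega> s \<partial>P)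
        \<le> indicator E \<omega> * \<kappa> n \<omega> * (- (\<alpha> n \<omega> * \<beta> * D n \<omega>))"
      using AE_desc
    proof eventually_elim
      case (elim \<omega>)
      have "(\<integral>s. q \<omega> s \<partial>P) = w \<omega> * ((\<integral>s. \<psi> (X n \<omega>) (y n \<omega>) s \<partial>P) - (\<integral>s. \<psi> (X n \<omega>) (X n \<omega>) s \<partial>P))"
        by (simp add: q_def \<psi>_int)
      also have "\<dots> \<le> w \<omega> * (- (2 * \<rho> - \<eta>L - \<tau>L) / 2 * D n \<omega> + \<eta> / 2 * (L\<^sup>2 * D n \<omega>))"
      proof (intro mult_left_mono w0)
        have "\<eta> / 2 * (norm (y n \<omega> - X n \<omega>))\<^sup>2 \<le> \<eta> / 2 * (L\<^sup>2 * D n \<omega>)"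
          using elim \<tau>\<eta> by (intro mult_left_mono) auto
        then show "(\<integral>s. \<psi> (X n \<omega>) (y n \<omega>) s \<partial>P) - (\<integral>s. \<psi> (X n \<omega>) (X n \<omega>) s \<partial>P)
            \<le> - (2 * \<rho> - \<eta>L - \<tau>L) / 2 * D n \<omega> + \<eta> / 2 * (L\<^sup>2 * D n \<omega>)"
          using mean_increment[of "X n \<omega>" "y n \<omega>"] elim by linarith
      qed
      also have "\<dots> = indicator E \<omega> * \<kappa> n \<omega> * (- (\<alpha> n \<omega> * \<beta> * D n \<omega>))"
        by (simp add: w_def \<eta>L_def \<beta>_def field_simps)
      finally show ?case .
    qed
  qed
  then show "(\<integral>\<omega>. indicator E \<omega> * \<kappa> n \<omega> * \<Delta> n \<omega> \<partial>\<Omega>)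
      \<le> (\<integral>\<omega>. indicator E \<omega> * \<kappa> n \<omega> * (- (\<alpha> n \<omega> * \<beta> * D n \<omega>)) \<partial>\<Omega>)"
    by (simp only: sa(3))
qed


section \<open>The recursion and its consequences\<close>

text \<open>The data of the almost supermartingale \<open>W\<close>: growth factors \<open>q\<close>, errors \<open>b\<close> and decrease \<open>U\<close>.\<close>

definition "\<delta> = \<beta> - \<tau>L * B"
definition "q n = (1 + (a n)\<^sup>2) * c n"
definition "b n = \<rho> / 2 * (\<kappa>max * (2 * (a n * L)\<^sup>2 * El2) + C1 * (a n)\<^sup>2)"
definition "U n \<omega> = \<rho> / 2 * \<delta> * (\<alpha> n \<omega> * D n \<omega>)"

text \<open>This is where the size of \<open>\<rho>\<close> is used in full: the decrease must outweigh the weak convexity error of the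
subproblem after the change of metric.\<close>

lemma \<delta>: "0 < \<delta>"
proof -
  have "1 * \<eta>L \<le> B * \<eta>L" "1 * \<tau>L \<le> B * \<tau>L" using B \<eta>L \<tau>L by (intro mult_right_mono; simp)+
  moreover have "B * \<eta>L + 2 * (B * \<tau>L) < \<rho>" using \<tau>\<eta>(3) by (simp add: \<eta>L_def \<tau>L_def distrib_left)
  moreover have "0 \<le> B * \<tau>L" using B \<tau>L by simp
  ultimately show ?thesis unfolding \<delta>_def \<beta>_def using \<tau>L by (simp add: mult.commute)
qed

lemma U_nonneg: "0 \<le> U n \<omega>"
  using \<rho> \<delta> \<alpha>(1)[of n \<omega>] D_nonneg[of n \<omega>] by (simp add: U_def)

lemma q: "1 \<le> q n"
  using mult_mono[of 1 "1 + (a n)\<^sup>2" 1 "c n"] c(1)[of n] by (simp add: q_def)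

text \<open>Dividing by \<open>1 - \<tau>L * \<alpha>\<close> enlarges \<open>c n\<close> by about \<open>\<tau>L * \<alpha> * c n\<close>, which is at most \<open>\<tau>L * B * \<alpha>\<close>; this is the
part of \<open>\<beta>\<close> that is missing from \<open>\<delta>\<close>.\<close>

lemma contraction_factor: "\<kappa> n \<omega> * (c n - \<alpha> n \<omega> * \<beta>) \<le> q n - \<delta> * \<alpha> n \<omega>"
proof -
  define t where "t = \<alpha> n \<omega>"
  define s where "s = 1 - \<tau>L * t"
  have t: "0 < t" and s: "0 < s" using \<alpha>(1,4)[of n \<omega>] by (auto simp: t_def s_def)
  have "\<tau>L * t * c n \<le> \<tau>L * t * B" using \<tau>L t c(2)[of n] by (intro mult_left_mono) auto
  moreover have "0 \<le> \<delta> * \<tau>L * t * t" using \<delta> \<tau>L t by simp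
  ultimately have "c n - t * \<beta> \<le> (c n - \<delta> * t) * s"
    by (simp add: s_def \<delta>_def algebra_simps)
  then have "(c n - t * \<beta>) / s \<le> c n - \<delta> * t"
    using s by (simp add: pos_divide_le_eq)
  then have "(1 + (a n)\<^sup>2) * ((c n - t * \<beta>) / s) \<le> (1 + (a n)\<^sup>2) * (c n - \<delta> * t)"
    by (intro mult_left_mono) auto
  also have "\<dots> \<le> q n - \<delta> * t" using \<delta> t by (simp add: q_def algebra_simps)
  finally show ?thesis by (simp add: \<kappa>_def s_def t_def)
qed

lemma U_integrable:
  assumes W: "integrable \<Omega> (W n)"
  shows "integrable \<Omega> (U n)"
proof (rule Bochner_Integration.integrable_bound)
  show "integrable \<Omega> (\<lambda>\<omega>. \<rho> / 2 * \<delta> * (a n * D n \<omega>))" using D_integrable[OF W] by simp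
  show "U n \<in> borel_measurable \<Omega>" unfolding U_def
    using F_to_\<Omega>[OF \<alpha>_meas[of n]] F_to_\<Omega>[OF D_meas[of n]] by measurable
  have "U n \<omega> \<le> \<rho> / 2 * \<delta> * (a n * D n \<omega>)" for \<omega>
    unfolding U_def using \<rho> \<delta> \<alpha>(2)[of n \<omega>] D_nonneg[of n \<omega>] by (intro mult_left_mono mult_right_mono) auto
  then show "AE \<omega> in \<Omega>. norm (U n \<omega>) \<le> norm (\<rho> / 2 * \<delta> * (a n * D n \<omega>))"
    using U_nonneg[of n] by (intro AE_I2) (metis abs_ge_self abs_of_nonneg order_trans real_norm_def)
qed

text \<open>Integrate \<open>one_step\<close> over a set \<open>E\<close> of the past.  The vector \<open>y n - X n\<close>, multiplied by the square root of \<open>\<kappa>\<close>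
and by the indicator of \<open>E\<close>, is known in the past, so the change of metric costs the factor \<open>c n\<close>.\<close>

lemma recursion:
  assumes W: "integrable \<Omega> (W n)"
  shows "integrable \<Omega> (W (Suc n))"
    and "E \<in> sets (F n) \<Longrightarrow> (\<integral>\<omega>. indicator E \<omega> * W (Suc n) \<omega> \<partial>\<Omega>) + (\<integral>\<omega>. indicator E \<omega> * U n \<omega> \<partial>\<Omega>)
        \<le> q n * (\<integral>\<omega>. indicator E \<omega> * W n \<omega> \<partial>\<Omega>) + b n"
proof -
  note [measurable] = F_to_\<Omega>[OF X_meas[of n]] F_to_\<Omega>[OF y_meas[of n]] F_to_\<Omega>[OF \<alpha>_meas[of n]]
    F_to_\<Omega>[OF \<kappa>_meas[of n]] F_to_\<Omega>[OF D_meas[of n]] F_to_\<Omega>[OF W_meas[of n]] F_to_\<Omega>[OF W_meas[of "Suc n"]]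
  have D: "integrable \<Omega> (D n)" by (rule D_integrable[OF W])
  have \<kappa>m: "0 \<le> \<kappa>max" by (simp add: \<kappa>max_def)
  define N' where "N' \<omega> = (mnorm (M (Suc n) \<omega>) (y n \<omega> - X n \<omega>))\<^sup>2" for \<omega>
  \<comment> \<open>the bound of \<open>one_step\<close>, restricted to \<open>E\<close>\<close>
  define T where "T E \<omega> = indicator E \<omega> * (\<phi> (y n \<omega>) - \<phi>inf) + \<rho> / 2 * (indicator E \<omega> * \<kappa> n \<omega> * N' \<omega>
      + indicator E \<omega> * \<kappa> n \<omega> * \<Delta> n \<omega> + indicator E \<omega> * (\<kappa> n \<omega> * (2 * (a n * L)\<^sup>2 * \<ll>2 n \<omega>))
      + indicator E \<omega> * (C1 * (a n)\<^sup>2))" for E \<omega>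
  have ind_int: "integrable \<Omega> (\<lambda>\<omega>. indicator E \<omega> * f \<omega>)" if "E \<in> sets (F n)" "integrable \<Omega> f" for E and f :: "'w \<Rightarrow> real"
  proof -
    have "E \<in> sets \<Omega>" using that(1) subalg[of n] by (auto simp: subalgebra_def)
    from integrable_mult_indicator[OF this that(2)] show ?thesis by simp
  qed
  have i\<kappa>: "integrable \<Omega> (\<lambda>\<omega>. \<kappa> n \<omega> * f \<omega>)" if f: "integrable \<Omega> f" for f
  proof (rule Bochner_Integration.integrable_bound)
    show "integrable \<Omega> (\<lambda>\<omega>. \<kappa>max * f \<omega>)" using f by simp
    show "(\<lambda>\<omega>. \<kappa> n \<omega> * f \<omega>) \<in> borel_measurable \<Omega>" using borel_measurable_integrable[OF f] by measurable
    show "AE \<omega> in \<Omega>. norm (\<kappa> n \<omega> * f \<omega>) \<le> norm (\<kappa>max * f \<omega>)"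
      using \<kappa> \<kappa>m by (intro AE_I2) (auto simp: abs_mult intro!: mult_right_mono)
  qed
  have i1: "integrable \<Omega> (\<lambda>\<omega>. \<phi> (y n \<omega>) - \<phi>inf)"
  proof (rule Bochner_Integration.integrable_bound[OF W])
    show "AE \<omega> in \<Omega>. norm (\<phi> (y n \<omega>) - \<phi>inf) \<le> norm (W n \<omega>)"
      using \<phi>inf \<rho> D_nonneg[of n] by (intro AE_I2) (simp add: W_eq)
  qed measurable
  have i4: "integrable \<Omega> (\<lambda>\<omega>. \<kappa> n \<omega> * (2 * (a n * L)\<^sup>2 * \<ll>2 n \<omega>))"
    by (intro i\<kappa> integrable_mult_right \<ll>2_integral)
  have T2: "integrable \<Omega> (\<lambda>\<omega>. indicator E \<omega> * \<kappa> n \<omega> * N' \<omega>)" (is ?T2a)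
    "(\<integral>\<omega>. indicator E \<omega> * \<kappa> n \<omega> * N' \<omega> \<partial>\<Omega>) \<le> c n * (\<integral>\<omega>. indicator E \<omega> * \<kappa> n \<omega> * D n \<omega> \<partial>\<Omega>)" (is ?T2b)
    if E: "E \<in> sets (F n)" for E
  proof -
    note [measurable] = E X_meas[of n] y_meas[of n] \<kappa>_meas[of n]
    define w where "w \<omega> = indicator E \<omega> * sqrt (\<kappa> n \<omega>)" for \<omega>
    define Y where "Y \<omega> = w \<omega> *\<^sub>R (y n \<omega> - X n \<omega>)" for \<omega>
    have w2: "(w \<omega>)\<^sup>2 = indicator E \<omega> * \<kappa> n \<omega>" for \<omega>
      using \<kappa>(1)[of n \<omega>] by (simp add: w_def indicator_def)
    have Y_meas: "Y \<in> borel_measurable (F n)" unfolding Y_def w_def by measurable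
    have Y_int: "integrable \<Omega> (\<lambda>\<omega>. (norm (Y \<omega>))\<^sup>2)"
    proof (rule Bochner_Integration.integrable_bound)
      show "integrable \<Omega> (\<lambda>\<omega>. \<kappa>max * (L\<^sup>2 * D n \<omega>))" using D by simp
      show "(\<lambda>\<omega>. (norm (Y \<omega>))\<^sup>2) \<in> borel_measurable \<Omega>" using F_to_\<Omega>[OF Y_meas] by measurable
      show "AE \<omega> in \<Omega>. norm ((norm (Y \<omega>))\<^sup>2) \<le> norm (\<kappa>max * (L\<^sup>2 * D n \<omega>))"
        using AE_good[of n]
      proof eventually_elim
        case (elim \<omega>)
        have "(norm (Y \<omega>))\<^sup>2 = (indicator E \<omega> * \<kappa> n \<omega>) * (norm (y n \<omega> - X n \<omega>))\<^sup>2"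
          by (simp add: Y_def power_mult_distrib w2)
        also have "\<dots> \<le> \<kappa>max * (L\<^sup>2 * D n \<omega>)"
          using norm_le_D[OF elim] \<kappa>[of n \<omega>] \<kappa>m by (intro mult_mono) (auto simp: indicator_def)
        finally show ?case using \<kappa>m D_nonneg[of n \<omega>] by simp
      qed
    qed
    have sq: "(mnorm (M j \<omega>) (Y \<omega>))\<^sup>2 = indicator E \<omega> * \<kappa> n \<omega> * (mnorm (M j \<omega>) (y n \<omega> - X n \<omega>))\<^sup>2"
      if "\<omega> \<in> space \<Omega>" for j \<omega>
      using spd_map.mnorm_sq_scale[OF spd_map.intro[OF M_spd[OF that]]] by (simp add: Y_def w2)
    have bnd: "AE \<omega> in \<Omega>. \<forall>v. mnorm (M j \<omega>) v \<le> K * norm v" for j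
      using metric[of j] by eventually_elim blast
    note rv = Om.random_vector_norm_ratio[OF subalg M_spd M_meas M_spd F_to_\<Omega>[OF M_meas] bnd bnd cond Y_meas Y_int]
    have "integrable \<Omega> (\<lambda>\<omega>. (mnorm (M (Suc n) \<omega>) (Y \<omega>))\<^sup>2)" by (rule rv(1))
    then show ?T2a
      by (subst Bochner_Integration.integrable_cong[OF refl, of _ _ "\<lambda>\<omega>. (mnorm (M (Suc n) \<omega>) (Y \<omega>))\<^sup>2"])
        (simp_all add: sq N'_def)
    have "(\<integral>\<omega>. indicator E \<omega> * \<kappa> n \<omega> * N' \<omega> \<partial>\<Omega>) = (\<integral>\<omega>. (mnorm (M (Suc n) \<omega>) (Y \<omega>))\<^sup>2 \<partial>\<Omega>)"
      by (intro Bochner_Integration.integral_cong) (simp_all add: sq N'_def)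
    also have "\<dots> \<le> c n * (\<integral>\<omega>. (mnorm (M n \<omega>) (Y \<omega>))\<^sup>2 \<partial>\<Omega>)" by (rule rv(2))
    also have "(\<integral>\<omega>. (mnorm (M n \<omega>) (Y \<omega>))\<^sup>2 \<partial>\<Omega>) = (\<integral>\<omega>. indicator E \<omega> * \<kappa> n \<omega> * D n \<omega> \<partial>\<Omega>)"
      by (intro Bochner_Integration.integral_cong) (simp_all add: sq D_def)
    finally show ?T2b .
  qed
  have T_int: "integrable \<Omega> (T E)" if E: "E \<in> sets (F n)" for E
    unfolding T_def using model_increment(1)[OF W E] E
    by (intro Bochner_Integration.integrable_add integrable_mult_right ind_int[OF E] i1 i4 T2 Om.integrable_const)
       simp_all
  have T_bound: "AE \<omega> in \<Omega>. indicator E \<omega> * W (Suc n) \<omega> \<le> T E \<omega>" for E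
    using one_step[of n] by eventually_elim (simp add: T_def indicator_def N'_def algebra_simps)
  have sp: "space \<Omega> \<in> sets (F n)" using sets.top[of "F n"] by (simp add: spF)
  show W': "integrable \<Omega> (W (Suc n))"
  proof (rule Bochner_Integration.integrable_bound[OF T_int[OF sp]])
    show "AE \<omega> in \<Omega>. norm (W (Suc n) \<omega>) \<le> norm (T (space \<Omega>) \<omega>)"
      using T_bound[of "space \<Omega>"] AE_space
    proof eventually_elim
      case (elim \<omega>)
      then show ?case using W_nonneg[of "Suc n" \<omega>] by (simp add: abs_if)
    qed
  qed measurable
  assume E: "E \<in> sets (F n)"
  have iU: "integrable \<Omega> (U n)" by (rule U_integrable[OF W])
  have ikD: "integrable \<Omega> (\<lambda>\<omega>. indicator E \<omega> * \<kappa> n \<omega> * D n \<omega>)"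
    using ind_int[OF E i\<kappa>[OF D]] by (simp add: mult.assoc)
  have ikaD: "integrable \<Omega> (\<lambda>\<omega>. indicator E \<omega> * \<kappa> n \<omega> * (- (\<alpha> n \<omega> * \<beta> * D n \<omega>)))"
  proof -
    have "integrable \<Omega> (\<lambda>\<omega>. - (2 * \<beta> / (\<rho> * \<delta>)) * U n \<omega>)" using iU by simp
    then have "integrable \<Omega> (\<lambda>\<omega>. - (\<alpha> n \<omega> * \<beta> * D n \<omega>))"
      using \<rho> \<delta> by (simp add: U_def field_simps)
    from ind_int[OF E i\<kappa>[OF this]] show ?thesis by (simp add: mult.assoc)
  qed
  have "(\<integral>\<omega>. indicator E \<omega> * W (Suc n) \<omega> \<partial>\<Omega>) \<le> (\<integral>\<omega>. T E \<omega> \<partial>\<Omega>)"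
    by (rule integral_mono_AE[OF ind_int[OF E W'] T_int[OF E] T_bound])
  also have "\<dots> = (\<integral>\<omega>. indicator E \<omega> * (\<phi> (y n \<omega>) - \<phi>inf) \<partial>\<Omega>) + \<rho> / 2 * ((\<integral>\<omega>. indicator E \<omega> * \<kappa> n \<omega> * N' \<omega> \<partial>\<Omega>)
      + (\<integral>\<omega>. indicator E \<omega> * \<kappa> n \<omega> * \<Delta> n \<omega> \<partial>\<Omega>) + (\<integral>\<omega>. indicator E \<omega> * (\<kappa> n \<omega> * (2 * (a n * L)\<^sup>2 * \<ll>2 n \<omega>)) \<partial>\<Omega>)
      + (\<integral>\<omega>. indicator E \<omega> * (C1 * (a n)\<^sup>2) \<partial>\<Omega>))"
  proof -
    note ints = ind_int[OF E i1] T2(1)[OF E] ind_int[OF E i4] ind_int[OF E Om.integrable_const[of "C1 * (a n)\<^sup>2"]]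
      model_increment(1)[OF W E]
    show ?thesis unfolding T_def
      by (subst Bochner_Integration.integral_add integral_mult_right_zero;
          (intro Bochner_Integration.integrable_add integrable_mult_right ints)?)+ simp
  qed
  also have "\<dots> \<le> (\<integral>\<omega>. indicator E \<omega> * (\<phi> (y n \<omega>) - \<phi>inf) \<partial>\<Omega>) + \<rho> / 2 * (c n * (\<integral>\<omega>. indicator E \<omega> * \<kappa> n \<omega> * D n \<omega> \<partial>\<Omega>)
      + (\<integral>\<omega>. indicator E \<omega> * \<kappa> n \<omega> * (- (\<alpha> n \<omega> * \<beta> * D n \<omega>)) \<partial>\<Omega>) + \<kappa>max * (2 * (a n * L)\<^sup>2 * El2)
      + C1 * (a n)\<^sup>2)"
  proof (intro add_left_mono mult_left_mono add_mono)
    show "(\<integral>\<omega>. indicator E \<omega> * \<kappa> n \<omega> * N' \<omega> \<partial>\<Omega>) \<le> c n * (\<integral>\<omega>. indicator E \<omega> * \<kappa> n \<omega> * D n \<omega> \<partial>\<Omega>)"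
      by (rule T2(2)[OF E])
    show "(\<integral>\<omega>. indicator E \<omega> * \<kappa> n \<omega> * \<Delta> n \<omega> \<partial>\<Omega>) \<le> (\<integral>\<omega>. indicator E \<omega> * \<kappa> n \<omega> * (- (\<alpha> n \<omega> * \<beta> * D n \<omega>)) \<partial>\<Omega>)"
      using model_increment(2)[OF W E] by (simp only:)
    have l0: "0 \<le> \<ll>2 n \<omega>" for \<omega> by (simp add: \<ll>2_def sum_nonneg)
    have "(\<integral>\<omega>. indicator E \<omega> * (\<kappa> n \<omega> * (2 * (a n * L)\<^sup>2 * \<ll>2 n \<omega>)) \<partial>\<Omega>) \<le> (\<integral>\<omega>. \<kappa>max * (2 * (a n * L)\<^sup>2 * \<ll>2 n \<omega>) \<partial>\<Omega>)"
    proof (rule integral_mono[OF ind_int[OF E i4]])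
      show "integrable \<Omega> (\<lambda>\<omega>. \<kappa>max * (2 * (a n * L)\<^sup>2 * \<ll>2 n \<omega>))"
        by (intro integrable_mult_right \<ll>2_integral)
      fix \<omega>
      have "\<kappa> n \<omega> * (2 * (a n * L)\<^sup>2 * \<ll>2 n \<omega>) \<le> \<kappa>max * (2 * (a n * L)\<^sup>2 * \<ll>2 n \<omega>)"
        using \<kappa>(2) l0 by (intro mult_right_mono mult_nonneg_nonneg) auto
      then show "indicator E \<omega> * (\<kappa> n \<omega> * (2 * (a n * L)\<^sup>2 * \<ll>2 n \<omega>)) \<le> \<kappa>max * (2 * (a n * L)\<^sup>2 * \<ll>2 n \<omega>)"
        using \<kappa>m l0[of \<omega>] by (cases "\<omega> \<in> E") auto
    qed
    also have "\<dots> = \<kappa>max * (2 * (a n * L)\<^sup>2 * El2)" by (simp add: \<ll>2_integral)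
    finally show "(\<integral>\<omega>. indicator E \<omega> * (\<kappa> n \<omega> * (2 * (a n * L)\<^sup>2 * \<ll>2 n \<omega>)) \<partial>\<Omega>) \<le> \<kappa>max * (2 * (a n * L)\<^sup>2 * El2)" .
    have "(\<integral>\<omega>. indicator E \<omega> * (C1 * (a n)\<^sup>2) \<partial>\<Omega>) \<le> (\<integral>\<omega>. C1 * (a n)\<^sup>2 \<partial>\<Omega>)"
    proof (rule integral_mono[OF ind_int[OF E Om.integrable_const] Om.integrable_const])
      have "0 \<le> C1 * (a n)\<^sup>2" by (simp add: C1_def)
      then show "indicator E \<omega> * (C1 * (a n)\<^sup>2) \<le> C1 * (a n)\<^sup>2" for \<omega> by (cases "\<omega> \<in> E") auto
    qed
    then show "(\<integral>\<omega>. indicator E \<omega> * (C1 * (a n)\<^sup>2) \<partial>\<Omega>) \<le> C1 * (a n)\<^sup>2" by (simp add: Om.prob_space)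
  qed (use \<rho> in simp)
  also have "\<dots> = (\<integral>\<omega>. indicator E \<omega> * (\<phi> (y n \<omega>) - \<phi>inf) + \<rho> / 2 * (c n * (indicator E \<omega> * \<kappa> n \<omega> * D n \<omega>)
      + indicator E \<omega> * \<kappa> n \<omega> * (- (\<alpha> n \<omega> * \<beta> * D n \<omega>))) \<partial>\<Omega>) + b n"
  proof -
    note ints = ind_int[OF E i1] ikD ikaD
    have "(\<integral>\<omega>. indicator E \<omega> * (\<phi> (y n \<omega>) - \<phi>inf) + \<rho> / 2 * (c n * (indicator E \<omega> * \<kappa> n \<omega> * D n \<omega>)
      + indicator E \<omega> * \<kappa> n \<omega> * (- (\<alpha> n \<omega> * \<beta> * D n \<omega>))) \<partial>\<Omega>)
      = (\<integral>\<omega>. indicator E \<omega> * (\<phi> (y n \<omega>) - \<phi>inf) \<partial>\<Omega>) + \<rho> / 2 * (c n * (\<integral>\<omega>. indicator E \<omega> * \<kappa> n \<omega> * D n \<omega> \<partial>\<Omega>)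
      + (\<integral>\<omega>. indicator E \<omega> * \<kappa> n \<omega> * (- (\<alpha> n \<omega> * \<beta> * D n \<omega>)) \<partial>\<Omega>))"
      by (subst Bochner_Integration.integral_add integral_mult_right_zero;
          (intro Bochner_Integration.integrable_add integrable_mult_right ints)?)+ simp
    then show ?thesis by (simp add: b_def distrib_left)
  qed
  also have "(\<integral>\<omega>. indicator E \<omega> * (\<phi> (y n \<omega>) - \<phi>inf) + \<rho> / 2 * (c n * (indicator E \<omega> * \<kappa> n \<omega> * D n \<omega>)
      + indicator E \<omega> * \<kappa> n \<omega> * (- (\<alpha> n \<omega> * \<beta> * D n \<omega>))) \<partial>\<Omega>)
      \<le> (\<integral>\<omega>. q n * (indicator E \<omega> * W n \<omega>) - indicator E \<omega> * U n \<omega> \<partial>\<Omega>)"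
  proof (rule integral_mono)
    fix \<omega>
    have "\<phi> (y n \<omega>) - \<phi>inf + \<rho> / 2 * (\<kappa> n \<omega> * (c n - \<alpha> n \<omega> * \<beta>) * D n \<omega>) \<le> q n * (\<phi> (y n \<omega>) - \<phi>inf) + \<rho> / 2 * ((q n - \<delta> * \<alpha> n \<omega>) * D n \<omega>)"
    proof (intro add_mono mult_left_mono mult_right_mono)
      show "\<phi> (y n \<omega>) - \<phi>inf \<le> q n * (\<phi> (y n \<omega>) - \<phi>inf)"
        using q[of n] \<phi>inf[of "y n \<omega>"] by (simp add: mult_le_cancel_right1)
      show "\<kappa> n \<omega> * (c n - \<alpha> n \<omega> * \<beta>) \<le> q n - \<delta> * \<alpha> n \<omega>"
        by (rule contraction_factor)
    qed (use \<rho> D_nonneg in auto)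
    then have "\<phi> (y n \<omega>) - \<phi>inf + \<rho> / 2 * (c n * (\<kappa> n \<omega> * D n \<omega>) + \<kappa> n \<omega> * (- (\<alpha> n \<omega> * \<beta> * D n \<omega>))) \<le> q n * W n \<omega> - U n \<omega>"
      by (simp add: W_eq U_def algebra_simps)
    then show "indicator E \<omega> * (\<phi> (y n \<omega>) - \<phi>inf) + \<rho> / 2 * (c n * (indicator E \<omega> * \<kappa> n \<omega> * D n \<omega>)
      + indicator E \<omega> * \<kappa> n \<omega> * (- (\<alpha> n \<omega> * \<beta> * D n \<omega>))) \<le> q n * (indicator E \<omega> * W n \<omega>) - indicator E \<omega> * U n \<omega>"
      by (cases "\<omega> \<in> E") simp_all
  qed (intro Bochner_Integration.integrable_add Bochner_Integration.integrable_diff integrable_mult_right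
        ind_int[OF E] i1 W iU ikD ikaD)+
  also have "(\<integral>\<omega>. q n * (indicator E \<omega> * W n \<omega>) - indicator E \<omega> * U n \<omega> \<partial>\<Omega>)
      = q n * (\<integral>\<omega>. indicator E \<omega> * W n \<omega> \<partial>\<Omega>) - (\<integral>\<omega>. indicator E \<omega> * U n \<omega> \<partial>\<Omega>)"
    by (subst Bochner_Integration.integral_diff) (auto intro!: integrable_mult_right ind_int[OF E] W iU)
  finally show "(\<integral>\<omega>. indicator E \<omega> * W (Suc n) \<omega> \<partial>\<Omega>) + (\<integral>\<omega>. indicator E \<omega> * U n \<omega> \<partial>\<Omega>)
        \<le> q n * (\<integral>\<omega>. indicator E \<omega> * W n \<omega> \<partial>\<Omega>) + b n" by simp
qed

lemma W_integrable: "integrable \<Omega> (W n)"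
proof (induction n)
  case 0
  show ?case
  proof (rule Bochner_Integration.integrable_bound[OF Om.integrable_const])
    show "W 0 \<in> borel_measurable \<Omega>" by (rule F_to_\<Omega>[OF W_meas])
    show "AE \<omega> in \<Omega>. norm (W 0 \<omega>) \<le> norm (\<phi> x1 - \<phi>inf)"
      using y_min[of 0] AE_space
    proof eventually_elim
      case (elim \<omega>)
      then have "h 0 \<omega> (y 0 \<omega>) \<le> h 0 \<omega> x1" by blast
      then have "W 0 \<omega> \<le> \<phi> x1 - \<phi>inf" using X0[OF elim(2)] by (simp add: W_def h_def mnorm_def)
      then show ?case using W_nonneg[of 0 \<omega>] by simp
    qed
  qed
qed (rule recursion(1))

lemma q_prod: "(\<Prod>i<n. q i) \<le> exp (\<Sum>i. (a i)\<^sup>2) * C"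
proof -
  have "(\<Prod>i<n. 1 + (a i)\<^sup>2) \<le> (\<Prod>i<n. exp ((a i)\<^sup>2))"
    by (intro prod_mono) (auto simp: add_nonneg_nonneg)
  also have "\<dots> = exp (\<Sum>i<n. (a i)\<^sup>2)" by (simp add: exp_sum)
  also have "\<dots> \<le> exp (\<Sum>i. (a i)\<^sup>2)" using a(4) by (simp add: sum_le_suminf)
  finally have 1: "(\<Prod>i<n. 1 + (a i)\<^sup>2) \<le> exp (\<Sum>i. (a i)\<^sup>2)" .
  have "0 \<le> c i" for i using c(1)[of i] by linarith
  then have "0 \<le> (\<Prod>i<n. c i)" by (intro prod_nonneg) auto
  with 1 show ?thesis unfolding q_def prod.distrib using c(3)[of n] by (intro mult_mono) auto
qed

lemma b: "0 \<le> b n" "summable b"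
proof -
  show "0 \<le> b n" unfolding b_def using \<rho> El(2) by (simp add: \<kappa>max_def C1_def)
  have "b = (\<lambda>n. \<rho> / 2 * (\<kappa>max * (2 * L\<^sup>2 * El2) + C1) * (a n)\<^sup>2)"
    by (simp add: b_def fun_eq_iff power_mult_distrib algebra_simps)
  then show "summable b" using a(4) by (simp add: summable_mult)
qed

lemma energy_bounded_summable:
  "AE \<omega> in \<Omega>. summable (\<lambda>n. U n \<omega>) \<and> (\<exists>K. \<forall>n. W n \<omega> \<le> K)"
proof (rule Om.almost_supermartingale_bounded_summable[OF subalg _ W_meas W_integrable U_integrable[OF W_integrable]
      W_nonneg U_nonneg recursion(2)[OF W_integrable] q q_prod b])
  show "sets (F n) \<subseteq> sets (F (Suc n))" for n unfolding F_def by (rule minibatch_filtration_mono)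
qed

text \<open>If \<open>D\<close> stayed above some \<open>e > 0\<close>, summability of \<open>\<alpha> n * D n\<close> would make \<open>\<alpha>\<close> summable, and on a bounded
path \<open>\<alpha> n\<close> is at least a fixed fraction of \<open>a n\<close>.\<close>

lemma iterates_bounded_gaps_vanish:
  "AE \<omega> in \<Omega>. (\<exists>R. \<forall>n. norm (X n \<omega>) \<le> R) \<and>
     (\<not> summable a \<longrightarrow> (\<forall>e>0. \<forall>N. \<exists>n\<ge>N. D n \<omega> < e))"
proof -
  have "AE \<omega> in \<Omega>. \<forall>n. good n \<omega>" unfolding AE_all_countable using AE_good by blast
  then show ?thesis using energy_bounded_summable
  proof eventually_elim
    case (elim \<omega>)
    then obtain K0 where K0: "\<And>n. W n \<omega> \<le> K0" and U: "summable (\<lambda>n. U n \<omega>)" by blast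
    have "bounded {u. \<phi> u \<le> K0 + \<phi>inf}" by (rule sublevel)
    then obtain R0 where R0: "\<And>u. \<phi> u \<le> K0 + \<phi>inf \<Longrightarrow> norm u \<le> R0" by (auto simp: bounded_iff)
    have bound: "norm (X n \<omega>) \<le> R0 + sqrt (L\<^sup>2 * (2 / \<rho> * K0))" for n
    proof -
      have "0 \<le> \<rho> / 2 * D n \<omega>" using \<rho> D_nonneg[of n \<omega>] by simp
      then have "\<phi> (y n \<omega>) \<le> K0 + \<phi>inf" using K0[of n] unfolding W_eq by linarith
      then have 1: "norm (y n \<omega>) \<le> R0" by (rule R0)
      have "\<rho> / 2 * D n \<omega> \<le> K0" using K0[of n] D_le_W[of n \<omega>] by linarith
      then have "D n \<omega> \<le> 2 / \<rho> * K0" using \<rho> by (simp add: field_simps)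
      then have "L\<^sup>2 * D n \<omega> \<le> L\<^sup>2 * (2 / \<rho> * K0)" by (intro mult_left_mono) auto
      then have "(norm (y n \<omega> - X n \<omega>))\<^sup>2 \<le> L\<^sup>2 * (2 / \<rho> * K0)" using norm_le_D[of n \<omega>] elim(1) by (meson order_trans)
      then have "norm (y n \<omega> - X n \<omega>) \<le> sqrt (L\<^sup>2 * (2 / \<rho> * K0))" by (rule real_le_rsqrt)
      then show ?thesis using 1 norm_triangle_sub[of "X n \<omega>" "y n \<omega>"] by (simp add: norm_minus_commute)
    qed
    define R where "R = R0 + sqrt (L\<^sup>2 * (2 / \<rho> * K0))"
    have R: "norm (X n \<omega>) \<le> R" for n using bound by (simp add: R_def)
    have "\<forall>e>0. \<forall>N. \<exists>n\<ge>N. D n \<omega> < e" if ns: "\<not> summable a"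
    proof (rule ccontr)
      assume "\<not> ?thesis"
      then obtain e N where e: "0 < e" and eN: "\<And>n. n \<ge> N \<Longrightarrow> e \<le> D n \<omega>" by (auto simp: not_less)
      define g where "g = max 1 (G R)"
      have g: "1 \<le> g" by (simp add: g_def)
      have ag: "a n \<le> g * \<alpha> n \<omega>" for n
      proof -
        have "G (norm (X n \<omega>)) \<le> G R"
          using R[of n] order_trans[OF norm_ge_zero R[of n]] by (intro mono_onD[OF G(2)]) auto
        then have "a n / g \<le> \<alpha> n \<omega>"
          unfolding \<alpha>_def g_def using a(1)[of n] by (intro divide_left_mono) auto
        then show ?thesis using g by (simp add: divide_le_eq mult.commute)
      qed
      have "summable (\<lambda>n. 2 * g / (\<rho> * \<delta> * e) * U n \<omega>)" using U by (rule summable_mult)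
      then have "summable a"
      proof (rule summable_comparison_test_ev[rotated])
        show "\<forall>\<^sub>F n in sequentially. norm (a n) \<le> 2 * g / (\<rho> * \<delta> * e) * U n \<omega>"
          using eventually_ge_at_top[of N]
        proof eventually_elim
          case (elim n)
          have "g * \<alpha> n \<omega> * e \<le> g * \<alpha> n \<omega> * D n \<omega>"
            using eN[OF elim] g \<alpha>(1)[of n \<omega>] by (intro mult_left_mono) auto
          moreover have "a n * e \<le> g * \<alpha> n \<omega> * e" using ag[of n] e by (intro mult_right_mono) auto
          ultimately have "a n * e \<le> g * (\<alpha> n \<omega> * D n \<omega>)" by (simp add: mult.assoc)
          then have "a n \<le> g * (\<alpha> n \<omega> * D n \<omega>) / e" using e by (simp add: pos_le_divide_eq)
          also have "\<dots> = 2 * g / (\<rho> * \<delta> * e) * U n \<omega>" using \<rho> \<delta> e by (simp add: U_def)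
          finally show ?case using a(1)[of n] by simp
        qed
      qed
      with ns show False by simp
    qed
    with R show ?case by blast
  qed
qed

lemma envelope_gradient:
  assumes g: "good n \<omega>" and y: "\<And>u. h n \<omega> (y n \<omega>) \<le> h n \<omega> u"
  obtains v where "GDERIV (\<lambda>u. real_of_ereal (envelope (M n \<omega>) (1 / \<rho>) (\<lambda>u. ereal (\<phi> u)) u)) (X n \<omega>) :> v"
    "norm v \<le> \<rho> * (K * sqrt (D n \<omega>))"
proof -
  interpret spd_map "M n \<omega>" by (rule good_spd_map[OF g])
  define H where "H x u = \<phi> u + \<rho> / 2 * (mnorm (M n \<omega>) (u - x))\<^sup>2" for x u
  have L': "norm v \<le> L * mnorm (M n \<omega>) v" for v using g by (simp add: good_def)
  have c\<phi>: "curved (M n \<omega>) (- (L\<^sup>2 * (\<eta> + \<tau>))) \<phi>"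
    using \<phi>_curved \<tau>\<eta> L' by (intro curved_change_metric) auto
  have lt: "L\<^sup>2 * (\<eta> + \<tau>) < \<rho>" using \<rho>_large \<tau>L by (simp add: \<eta>L_def \<tau>L_def algebra_simps)
  have cv: "curved (M n \<omega>) (- (L\<^sup>2 * (\<eta> + \<tau>)) + \<rho>) (H x)" for x
    unfolding H_def by (rule curved_add[OF c\<phi> curved_quadratic])
  have pos: "0 < - (L\<^sup>2 * (\<eta> + \<tau>)) + \<rho>" using lt by simp
  have "\<exists>z. \<forall>u. H x z \<le> H x u" for x using curved_has_min[OF cv pos L'] by metis
  then obtain Z where Z: "\<And>x u. H x (Z x) \<le> H x u" by metis
  define Y where "Y = Z(X n \<omega> := y n \<omega>)"
  have Y: "H x (Y x) \<le> H x u" for x u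
    using Z y by (auto simp: Y_def H_def h_def)
  have env: "envelope (M n \<omega>) (1 / \<rho>) (\<lambda>u. ereal (\<phi> u)) x = ereal (H x (Y x))" for x
    unfolding envelope_def prox_objective_def
    using Y[of x] by (intro INF_eqI) (auto simp: H_def)
  have "GDERIV (\<lambda>x. H x (Y x)) (X n \<omega>) :> \<rho> *\<^sub>R M n \<omega> (X n \<omega> - Y (X n \<omega>))"
    unfolding H_def using moreau_gradient[OF c\<phi> lt \<rho> L'] Y by (simp add: H_def)
  then have grad: "GDERIV (\<lambda>u. real_of_ereal (envelope (M n \<omega>) (1 / \<rho>) (\<lambda>u. ereal (\<phi> u)) u)) (X n \<omega>)
      :> \<rho> *\<^sub>R M n \<omega> (X n \<omega> - y n \<omega>)"
    by (simp add: env Y_def)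
  have nM: "norm (M n \<omega> v) \<le> K * mnorm (M n \<omega>) v" for v
  proof -
    have "norm (M n \<omega> v) * norm (M n \<omega> v) = v \<bullet> M n \<omega> (M n \<omega> v)"
      by (simp add: sym dot_square_norm[symmetric] power2_eq_square[symmetric])
    also have "\<dots> \<le> mnorm (M n \<omega>) v * mnorm (M n \<omega>) (M n \<omega> v)" by (rule cauchy_schwarz)
    also have "\<dots> \<le> mnorm (M n \<omega>) v * (K * norm (M n \<omega> v))"
      using g by (intro mult_left_mono mnorm_nonneg) (simp add: good_def)
    finally have "norm (M n \<omega> v) * norm (M n \<omega> v) \<le> norm (M n \<omega> v) * (K * mnorm (M n \<omega>) v)"
      by (simp add: mult_ac)
    moreover have "0 \<le> K * mnorm (M n \<omega>) v"
    proof (cases "v = 0")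
      case False
      have "0 \<le> mnorm (M n \<omega>) v" by (rule mnorm_nonneg)
      also have "\<dots> \<le> K * norm v" using g by (simp add: good_def)
      finally have "0 \<le> K" using False by (simp add: zero_le_mult_iff)
      then show ?thesis using mnorm_nonneg by simp
    qed (simp add: mnorm_zero)
    ultimately show ?thesis by (cases "M n \<omega> v = 0") auto
  qed
  have "norm (\<rho> *\<^sub>R M n \<omega> (X n \<omega> - y n \<omega>)) \<le> \<rho> * (K * sqrt (D n \<omega>))"
    using nM[of "X n \<omega> - y n \<omega>"] \<rho> mnorm_nonneg[of "y n \<omega> - X n \<omega>"]
    by (simp add: D_def mnorm_minus[of "X n \<omega>"])
  with grad show ?thesis by (rule that)
qed

end

section \<open>From the model conditions to the real-valued process\<close>

text \<open>At \<open>z = y\<close> the local Lipschitz bound says that \<open>model_obj\<close> is finite on \<open>V\<close>.  Suppose \<open>V\<close> had a boundary point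
\<open>b\<close>.  Along the segment from \<open>x1\<close> to \<open>b\<close> the bound makes the model objective Lipschitz, hence bounded; the
model accuracy and closedness of \<open>f\<close> keep \<open>fm\<close> bounded below there, so \<open>r\<close> stays bounded
above.  Since \<open>r\<close> is closed, \<open>r b\<close> would be finite, but the domain of \<open>r\<close> lies in \<open>V\<close> and \<open>b\<close> does not.\<close>

lemma model_domain_is_everything:
  assumes P: "prob_space P" and fam: "model_family P r V fm" and acc: "model_accuracy P f V fm \<eta>"
    and reg: "regularity P f r V fm \<tau>" and lip: "local_lipschitz_growth P r V fm L\<phi> G"
    and G: "mono_on {0..} G" "\<forall>u\<ge>0. 0 \<le> G u" and L\<phi>: "\<forall>s\<in>space P. 0 \<le> L\<phi> s"
    and x1: "x1 \<in> V"
  shows "V = UNIV" and "\<bar>r u\<bar> \<noteq> \<infinity>"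
proof -
  interpret P: prob_space P by (rule P)
  have V: "open V" "convex V" "edom r \<subseteq> V" using fam by (auto simp: model_family_def)
  have r: "r v \<noteq> -\<infinity>" "closed (eepigraph r)" for v
    using reg by (auto simp: regularity_def proper_fun_def closed_fun_def)
  have "AE s in P. s \<in> space P \<and>
      (\<forall>x\<in>V. \<forall>y\<in>V. ereal (fm x x s) = f x s \<and> \<bar>ereal (fm x y s) - f y s\<bar> \<le> ereal (\<eta> / 2 * (norm (y - x))\<^sup>2)) \<and>
      (proper_fun (\<lambda>x. f x s) \<and> closed_fun (\<lambda>x. f x s)) \<and>
      (\<forall>x\<in>V. \<forall>y\<in>V. \<forall>\<^sub>F z in nhds y. \<bar>model_obj fm r x y s - model_obj fm r x z s\<bar>
          \<le> ereal (L\<phi> s * G (max (norm x) (norm y)) * norm (y - z)))"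
  proof -
    have "AE s in P. proper_fun (\<lambda>x. f x s) \<and> closed_fun (\<lambda>x. f x s) \<and> edom r \<subseteq> edom (\<lambda>x. f x s) \<and>
        (\<forall>x\<in>V. weakly_convex \<tau> (\<lambda>y. model_obj fm r x y s))"
      using reg unfolding regularity_def by blast
    then show ?thesis
      using acc[unfolded model_accuracy_def] lip[unfolded local_lipschitz_growth_def] AE_space
    proof eventually_elim
      case (elim s)
      show ?case
        by (intro conjI elim(2-4) elim(1)[THEN conjunct1] elim(1)[THEN conjunct2, THEN conjunct1])
    qed
  qed
  from eventually_happens'[OF P.ae_filter_bot this] obtain s where s: "s \<in> space P"
    and acc0: "\<forall>x\<in>V. \<forall>y\<in>V. ereal (fm x x s) = f x s \<and> \<bar>ereal (fm x y s) - f y s\<bar> \<le> ereal (\<eta> / 2 * (norm (y - x))\<^sup>2)"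
    and f: "proper_fun (\<lambda>x. f x s)" "closed_fun (\<lambda>x. f x s)"
    and lip0: "\<forall>x\<in>V. \<forall>y\<in>V. \<forall>\<^sub>F z in nhds y. \<bar>model_obj fm r x y s - model_obj fm r x z s\<bar>
          \<le> ereal (L\<phi> s * G (max (norm x) (norm y)) * norm (y - z))"
    by (elim exE conjE) (rule that)
  have accs: "\<bar>ereal (fm x y s) - f y s\<bar> \<le> ereal (\<eta> / 2 * (norm (y - x))\<^sup>2)" if "x \<in> V" "y \<in> V" for x y
    using acc0[rule_format, OF that] by (rule conjunct2)
  have lips: "\<forall>\<^sub>F z in nhds y. \<bar>model_obj fm r x y s - model_obj fm r x z s\<bar>
          \<le> ereal (L\<phi> s * G (max (norm x) (norm y)) * norm (y - z))" if "x \<in> V" "y \<in> V" for x y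
    by (rule lip0[rule_format, OF that])
  have rfin: "\<bar>r v\<bar> \<noteq> \<infinity>" if "v \<in> V" for v
  proof -
    have "\<bar>model_obj fm r v v s - model_obj fm r v v s\<bar>
        \<le> ereal (L\<phi> s * G (max (norm v) (norm v)) * norm (v - v))"
      by (rule eventually_nhds_x_imp_x[OF lips[OF that that]])
    then show ?thesis using r(1)[of v] by (cases "r v") (auto simp: model_obj_def)
  qed
  show VU: "V = UNIV"
  proof (rule ccontr)
    assume "V \<noteq> UNIV"
    then have "\<not> closed V" using V(1) x1 clopen[of V] by auto
    then obtain b where b: "b \<in> closure V" "b \<notin> V" using closure_subset_eq[of V] by blast
    \<comment> \<open>the segment towards \<open>b\<close>, on which \<open>Kc\<close> below bounds the Lipschitz constant of \<open>g\<close>\<close>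
    define w where "w t = x1 + t *\<^sub>R (b - x1)" for t :: real
    have wV: "w t \<in> V" if t: "0 \<le> t" "t < 1" for t
    proof (cases "t = 0")
      case True then show ?thesis using x1 by (simp add: w_def)
    next
      case False
      have "w t = (1 - t) *\<^sub>R x1 + t *\<^sub>R b" by (simp add: w_def algebra_simps)
      then have "w t \<in> open_segment x1 b"
        using False t b(2) x1 by (auto simp: in_segment intro!: exI[of _ t])
      then show ?thesis
        using in_interior_closure_convex_segment[OF V(2), of x1 b] x1 b(1) V(1) interior_open by blast
    qed
    define g where "g t = fm x1 (w t) s + real_of_ereal (r (w t))" for t
    define Kc where "Kc = L\<phi> s * G (norm x1 + norm (b - x1)) * norm (b - x1)"
    have obj: "model_obj fm r x1 (w t) s = ereal (g t)" if "w t \<in> V" for t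
      using rfin[OF that] by (cases "r (w t)") (auto simp: model_obj_def g_def)
    have wcont: "filterlim w (nhds (w t)) (nhds t)" for t
      unfolding w_def by (intro tendsto_intros filterlim_ident)
    \<comment> \<open>local Lipschitz estimates are chained by bisection\<close>
    have g_le: "\<bar>g T - g 0\<bar> \<le> Kc * (T - 0)" if T: "0 \<le> T" "T < 1" for T
      using T(1)
    proof (induction rule: Bolzano)
      case (trans a b c) then show ?case by (simp add: algebra_simps)
    next
      case (local t)
      have wt: "w t \<in> V" using local T by (intro wV) auto
      have "\<forall>\<^sub>F z in nhds (w t). z \<in> V \<and> \<bar>model_obj fm r x1 (w t) s - model_obj fm r x1 z s\<bar>
          \<le> ereal (L\<phi> s * G (max (norm x1) (norm (w t))) * norm (w t - z))"
        using lips[OF x1 wt] eventually_nhds_in_open[OF V(1) wt] by eventually_elim simp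
      then have "\<forall>\<^sub>F t' in nhds t. w t' \<in> V \<and> \<bar>model_obj fm r x1 (w t) s - model_obj fm r x1 (w t') s\<bar>
          \<le> ereal (L\<phi> s * G (max (norm x1) (norm (w t))) * norm (w t - w t'))"
        by (rule eventually_compose_filterlim[OF _ wcont])
      then obtain d where d: "d > 0" and near: "\<And>t'. dist t' t < d \<Longrightarrow> w t' \<in> V \<and>
          \<bar>model_obj fm r x1 (w t) s - model_obj fm r x1 (w t') s\<bar>
          \<le> ereal (L\<phi> s * G (max (norm x1) (norm (w t))) * norm (w t - w t'))"
        unfolding eventually_nhds_metric by blast
      have near': "\<bar>g t - g t'\<bar> \<le> Kc * \<bar>t - t'\<bar>" if "\<bar>t' - t\<bar> < d" for t'
      proof -
        have w': "w t' \<in> V" and le: "\<bar>model_obj fm r x1 (w t) s - model_obj fm r x1 (w t') s\<bar>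
          \<le> ereal (L\<phi> s * G (max (norm x1) (norm (w t))) * norm (w t - w t'))"
          using near[of t'] that by (auto simp: dist_real_def)
        have "\<bar>g t - g t'\<bar> \<le> L\<phi> s * G (max (norm x1) (norm (w t))) * norm (w t - w t')"
          using le by (simp add: obj[OF wt] obj[OF w'])
        also have "\<dots> \<le> L\<phi> s * G (norm x1 + norm (b - x1)) * norm (w t - w t')"
        proof -
          have "norm (w t) \<le> norm x1 + norm (t *\<^sub>R (b - x1))" unfolding w_def by (rule norm_triangle_ineq)
          also have "norm (t *\<^sub>R (b - x1)) \<le> 1 * norm (b - x1)"
            unfolding norm_scaleR using local T by (intro mult_right_mono) auto
          finally have "norm (w t) \<le> norm x1 + norm (b - x1)" by simp
          then have "G (max (norm x1) (norm (w t))) \<le> G (norm x1 + norm (b - x1))"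
            by (intro mono_onD[OF G(1)]) (auto intro: max.coboundedI1)
          then show ?thesis using L\<phi> s by (intro mult_right_mono mult_left_mono) auto
        qed
        also have "norm (w t - w t') = \<bar>t - t'\<bar> * norm (b - x1)"
        proof -
          have "w t - w t' = (t - t') *\<^sub>R (b - x1)" by (simp add: w_def scaleR_left_diff_distrib)
          then show ?thesis by simp
        qed
        finally show ?thesis by (simp add: Kc_def mult_ac)
      qed
      show ?case
      proof (intro exI[of _ d] conjI d allI impI)
        fix u v assume "u \<le> t \<and> t \<le> v \<and> v - u < d"
        then have "\<bar>g t - g u\<bar> \<le> Kc * (t - u)" "\<bar>g t - g v\<bar> \<le> Kc * (v - t)"
          using near'[of u] near'[of v] by auto
        moreover have "Kc * (v - u) = Kc * (t - u) + Kc * (v - t)" by (simp add: algebra_simps)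
        ultimately show "\<bar>g v - g u\<bar> \<le> Kc * (v - u)" by linarith
      qed
    qed
    have Kc0: "0 \<le> Kc" unfolding Kc_def using L\<phi> s G(2) by (intro mult_nonneg_nonneg) auto
    have g_bound: "g t \<le> g 0 + Kc" if "0 \<le> t" "t < 1" for t
    proof -
      have "Kc * t \<le> Kc * 1" using Kc0 that by (intro mult_left_mono) auto
      then show ?thesis using g_le[OF that] by (simp add: abs_le_iff)
    qed
    have fb: "f b s \<noteq> -\<infinity>" using f(1) by (simp add: proper_fun_def)
    then obtain l where l: "ereal l < f b s"
      using ereal_dense2[of "-\<infinity>" "f b s"] by auto
    have wlim: "(w \<longlongrightarrow> b) (at_left 1)"
    proof -
      have "(w \<longlongrightarrow> x1 + 1 *\<^sub>R (b - x1)) (at_left 1)" unfolding w_def by (intro tendsto_intros)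
      then show ?thesis by simp
    qed
    have ev01: "\<forall>\<^sub>F t in at_left (1::real). 0 \<le> t \<and> t < 1"
      using eventually_at_left_real[of 0 1] by (rule eventually_mono) auto
    have "((\<lambda>t. (w t, l)) \<longlongrightarrow> (b, l)) (at_left 1)" by (intro tendsto_Pair wlim tendsto_const)
    moreover have "open (- eepigraph (\<lambda>x. f x s))" using f(2) unfolding closed_fun_def by (rule open_Compl)
    moreover have "(b, l) \<in> - eepigraph (\<lambda>x. f x s)" using l by (simp add: eepigraph_def not_le)
    ultimately have "\<forall>\<^sub>F t in at_left 1. (w t, l) \<in> - eepigraph (\<lambda>x. f x s)" by (rule topological_tendstoD)
    then have f_low: "\<forall>\<^sub>F t in at_left 1. ereal l < f (w t) s"
      by (rule eventually_mono) (simp add: eepigraph_def not_le)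
    define K2 where "K2 = g 0 + Kc - l + \<bar>\<eta>\<bar> / 2 * (norm (b - x1))\<^sup>2"
    have "\<forall>\<^sub>F t in at_left 1. (w t, K2) \<in> eepigraph r"
      using f_low ev01
    proof eventually_elim
      case (elim t)
      then have wt: "w t \<in> V" by (intro wV) auto
      have fin: "\<bar>ereal (fm x1 (w t) s) - f (w t) s\<bar> \<le> ereal (\<eta> / 2 * (norm (w t - x1))\<^sup>2)"
        by (rule accs[OF x1 wt])
      then obtain fv where fv: "f (w t) s = ereal fv" by (cases "f (w t) s") auto
      have "\<eta> / 2 * (norm (w t - x1))\<^sup>2 \<le> \<bar>\<eta>\<bar> / 2 * (norm (b - x1))\<^sup>2"
      proof -
        have "norm (w t - x1) \<le> norm (b - x1)" using elim by (simp add: w_def mult_left_le_one_le)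
        then have "(norm (w t - x1))\<^sup>2 \<le> (norm (b - x1))\<^sup>2" by (intro power_mono) auto
        then have "\<bar>\<eta>\<bar> / 2 * (norm (w t - x1))\<^sup>2 \<le> \<bar>\<eta>\<bar> / 2 * (norm (b - x1))\<^sup>2" by (intro mult_left_mono) auto
        moreover have "\<eta> / 2 * (norm (w t - x1))\<^sup>2 \<le> \<bar>\<eta>\<bar> / 2 * (norm (w t - x1))\<^sup>2" by (intro mult_right_mono) auto
        ultimately show ?thesis by linarith
      qed
      moreover have "\<bar>fm x1 (w t) s - fv\<bar> \<le> \<eta> / 2 * (norm (w t - x1))\<^sup>2" using fin by (simp add: fv)
      moreover have "l < fv" using elim by (simp add: fv)
      moreover have "g t \<le> g 0 + Kc" using g_bound elim by simp
      ultimately have "real_of_ereal (r (w t)) \<le> K2" unfolding g_def[of t] K2_def by linarith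
      then show ?case using rfin[OF wt] by (cases "r (w t)") (auto simp: eepigraph_def)
    qed
    then have "(b, K2) \<in> eepigraph r"
      by (rule Lim_in_closed_set[OF r(2) _ _ tendsto_Pair[OF wlim tendsto_const]]) simp
    then have "r b \<le> ereal K2" by (simp add: eepigraph_def)
    then have "r b < \<infinity>" by (rule le_less_trans) simp
    then have "b \<in> edom r" by (simp add: edom_def)
    with V(3) b(2) show False by blast
  qed
  show "\<bar>r u\<bar> \<noteq> \<infinity>" by (rule rfin) (simp add: VU)
qed

lemma weakly_convex_imp_curved:
  assumes "weakly_convex \<tau> (\<lambda>y. ereal (h y))"
  shows "curved id (- \<tau>) (h :: 'a::euclidean_space \<Rightarrow> real)"
proof -
  define k where "k y = h y + \<tau> / 2 * (norm y)\<^sup>2" for y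
  have ep: "eepigraph (\<lambda>x. ereal (h x) + ereal (\<tau> / 2 * (norm x)\<^sup>2)) = {(x, t). k x \<le> t}"
    by (auto simp: eepigraph_def k_def)
  have cv: "convex {(x, t). k x \<le> t}"
    using assms unfolding weakly_convex_def convex_fun_def ep .
  have k: "curved id 0 k"
    unfolding curved_def
  proof (intro allI impI)
    fix y z and t :: real assume t: "0 \<le> t \<and> t \<le> 1"
    have "(1 - t) *\<^sub>R (y, k y) + t *\<^sub>R (z, k z) \<in> {(x, t). k x \<le> t}"
      using t by (intro convexD[OF cv]) auto
    then show "k ((1 - t) *\<^sub>R y + t *\<^sub>R z) \<le> (1 - t) * k y + t * k z - 0 / 2 * (t * (1 - t)) * (mnorm id (z - y))\<^sup>2"
      by simp
  qed
  have "curved id (0 + - \<tau>) (\<lambda>y. k y + - \<tau> / 2 * (mnorm id (y - 0))\<^sup>2)"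
    by (rule curved_add[OF k spd_map.curved_quadratic[OF spd_map.intro[OF spd_id]]])
  then show ?thesis by (simp add: k_def mnorm_id)
qed

lemma gradient_eq:
  assumes "GDERIV h x :> g" shows "gradient h x = g"
  unfolding gradient_def
proof (rule the_equality[where P = "\<lambda>g. GDERIV h x :> g", OF assms])
  fix g' assume "GDERIV h x :> g'"
  with assms have "(\<lambda>v. v \<bullet> g') = (\<lambda>v. v \<bullet> g)" unfolding gderiv_def by (rule has_derivative_unique[rotated])
  then have "(g' - g) \<bullet> g' = (g' - g) \<bullet> g" by (rule fun_cong)
  then have "(g' - g) \<bullet> (g' - g) = 0" by (simp add: inner_diff_right)
  then show "g' = g" by simp
qed

lemma convergent_prod_ge_1_bounds:
  fixes \<rho> :: "nat \<Rightarrow> real"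
  assumes conv: "convergent_prod \<rho>" and 0: "\<rho> 0 = 1" and ge: "\<And>k. k \<ge> 1 \<Longrightarrow> 1 \<le> \<rho> k"
  shows "bdd_above ((\<lambda>k. (\<rho> k)\<^sup>2) ` {1..})" and "\<exists>C. \<forall>n. (\<Prod>i<n. (\<rho> (Suc i))\<^sup>2) \<le> C"
proof -
  have "Bseq (\<lambda>n. \<Prod>i\<le>n. \<rho> i)"
    using convergent_prod_LIMSEQ[OF conv] convergentI convergent_imp_Bseq by blast
  then obtain C where C: "\<And>n. \<bar>\<Prod>i\<le>n. \<rho> i\<bar> \<le> C" by (auto simp: Bseq_def)
  have "(\<Prod>i<n. (\<rho> (Suc i))\<^sup>2) \<le> C\<^sup>2" for n
  proof -
    have "(\<Prod>i\<le>n. \<rho> i) = (\<Prod>i<n. \<rho> (Suc i))"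
      using 0 by (simp add: prod.atMost_shift)
    then have "(\<Prod>i<n. (\<rho> (Suc i))\<^sup>2) = \<bar>\<Prod>i\<le>n. \<rho> i\<bar>\<^sup>2" by (simp add: prod_power_distrib)
    also have "\<dots> \<le> C\<^sup>2" by (intro power_mono C) auto
    finally show ?thesis .
  qed
  then show "\<exists>C. \<forall>n. (\<Prod>i<n. (\<rho> (Suc i))\<^sup>2) \<le> C" by blast
  have "Bseq \<rho>" using convergent_prod_imp_LIMSEQ[OF conv] convergentI convergent_imp_Bseq by blast
  then obtain D where D: "\<And>k. \<bar>\<rho> k\<bar> \<le> D" by (auto simp: Bseq_def)
  have "(\<rho> k)\<^sup>2 \<le> D\<^sup>2" for k using power_mono[OF D[of k], of 2] by simp
  then show "bdd_above ((\<lambda>k. (\<rho> k)\<^sup>2) ` {1..})" by (intro bdd_aboveI2[where M = "D\<^sup>2"])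
qed

theorem theorem2p2:
  fixes P :: "'s measure" and \<Omega> :: "'w measure"
    and f :: "'a::euclidean_space \<Rightarrow> 's \<Rightarrow> ereal" and r :: "'a \<Rightarrow> ereal"
    and V :: "'a set" and fm :: "'a \<Rightarrow> 'a \<Rightarrow> 's \<Rightarrow> real"
    and m :: nat and S :: "nat \<Rightarrow> nat \<Rightarrow> 'w \<Rightarrow> 's"
    and M :: "nat \<Rightarrow> 'w \<Rightarrow> 'a \<Rightarrow> 'a"
    and \<mu> L \<rho> \<alpha>bar :: "nat \<Rightarrow> real"
    and \<alpha> \<epsilon> :: "nat \<Rightarrow> 'w \<Rightarrow> real"
    and x1 :: 'a and x :: "nat \<Rightarrow> 'w \<Rightarrow> 'a"
    and G :: "real \<Rightarrow> real" and L\<phi> :: "'s \<Rightarrow> real"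
    and \<mu>inf Linf \<eta>bar \<tau>bar L\<phi>bar \<eta> \<tau> B\<rho> \<gamma> \<rho>bar :: real
  assumes "prob_space P" and "prob_space \<Omega>"
    and "model_family P r V fm"
    and "model_accuracy P f V fm \<eta>bar"
    and "preconditioner_condition \<Omega> (minibatch_filtration \<Omega> P m S) M \<mu> L \<rho> \<mu>inf Linf"
    and "regularity P f r V fm \<tau>bar"
    and "(INF y. objective P f r y) > -\<infinity>"
    and "\<forall>t::real. bounded {y. objective P f r y \<le> ereal t}"
    and "continuous_on {0..} G" and "mono_on {0..} G" and "\<forall>u\<ge>0. G u \<ge> 0"
    and "L\<phi> \<in> borel_measurable P" and "\<forall>s\<in>space P. L\<phi> s \<ge> 0"
    and "integrable P (\<lambda>s. (L\<phi> s)\<^sup>2)" and "sqrt (\<integral>s. (L\<phi> s)\<^sup>2 \<partial>P) \<le> L\<phi>bar"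
    and "local_lipschitz_growth P r V fm L\<phi> G"
    and "\<eta> = Linf\<^sup>2 * \<eta>bar" and "\<tau> = Linf\<^sup>2 * \<tau>bar"
    and "B\<rho> = (SUP k\<in>{1..}. (\<rho> k)\<^sup>2)"
    and "ispPPA \<Omega> P m S r V fm \<tau> M \<alpha> \<epsilon> x1 x"
    and "\<gamma> \<ge> 0" and "\<rho>bar > B\<rho> * (\<eta> + 2 * \<tau>)"
    and "\<forall>k\<ge>1. \<forall>\<omega>\<in>space \<Omega>. \<alpha> k \<omega> = \<alpha>bar k / max 1 (G (norm (x k \<omega>)))"
    and "\<forall>k\<ge>1. \<forall>\<omega>\<in>space \<Omega>. \<epsilon> k \<omega> = \<gamma> * (\<alpha> k \<omega>)\<^sup>2"
    and "(SUP k\<in>{1..}. \<alpha>bar k) < 1 / (2 * \<rho>bar)"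
    and "summable (\<lambda>k. (\<alpha>bar (Suc k))\<^sup>2)"
  shows "(AE \<omega> in \<Omega>. (SUP k\<in>{1..}. ereal (norm (x k \<omega>))) < \<infinity>) \<and>
    (\<not> summable (\<lambda>k. \<alpha>bar (Suc k)) \<longrightarrow>
      (AE \<omega> in \<Omega>.
        (\<forall>k\<ge>1. (\<lambda>y. real_of_ereal (envelope (M (k - 1) \<omega>) (1 / \<rho>bar) (objective P f r) y))
                  differentiable (at (x k \<omega>))) \<and>
        liminf (\<lambda>k. ereal (norm (gradient
          (\<lambda>y. real_of_ereal (envelope (M (k - 1) \<omega>) (1 / \<rho>bar) (objective P f r) y))
          (x k \<omega>)))) = 0))"
proof -
  note asm = assms
  interpret P: prob_space P by fact
  interpret Om: prob_space \<Omega> by fact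
  have ispp: "m \<ge> 1" "iid_minibatches \<Omega> P m S" "preconditioners \<Omega> (minibatch_filtration \<Omega> P m S) M"
    "x1 \<in> V" "\<And>\<omega>. \<omega> \<in> space \<Omega> \<Longrightarrow> x 1 \<omega> = x1"
    "\<And>k \<omega>. k \<ge> 1 \<Longrightarrow> \<omega> \<in> space \<Omega> \<Longrightarrow> 0 < \<alpha> k \<omega>"
    "\<And>k. k \<ge> 1 \<Longrightarrow> x (Suc k) \<in> borel_measurable (minibatch_filtration \<Omega> P m S k)"
    "\<And>k. k \<ge> 1 \<Longrightarrow> AE \<omega> in \<Omega>. inexact_prox_step \<tau> (M k \<omega>) (\<alpha> k \<omega>) (\<epsilon> k \<omega>)
             (\<lambda>y. minibatch_obj m fm r (x k \<omega>) y (\<lambda>i. S k i \<omega>)) (x k \<omega>) (x (Suc k) \<omega>)"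
    using asm(20) by (auto simp: ispPPA_def)
  note dom = model_domain_is_everything[OF asm(1,3,4,6,16,10,11,13) ispp(4)]
  note V = dom(1)
  define rr where "rr u = real_of_ereal (r u)" for u
  have r_eq: "r u = ereal (rr u)" for u using dom(2)[of u] by (simp add: rr_def ereal_real)
  define \<psi> where "\<psi> z u s = fm z u s + rr u" for z u s
  define \<phi> where "\<phi> u = expected_loss P f u + rr u" for u
  have obj: "objective P f r = (\<lambda>u. ereal (\<phi> u))" by (simp add: objective_def \<phi>_def r_eq fun_eq_iff)
  have model: "model_obj fm r z u s = ereal (\<psi> z u s)" for z u s by (simp add: model_obj_def \<psi>_def r_eq)
  have acc: "AE s in P. \<forall>z u. \<bar>ereal (fm z u s) - f u s\<bar> \<le> ereal (\<eta>bar / 2 * (norm (u - z))\<^sup>2)"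
    using asm(4) unfolding model_accuracy_def V by (rule AE_mp) (auto intro!: AE_I2)
  have pc: "0 < \<mu>inf" "\<mu>inf \<le> 1" "1 \<le> Linf" "\<rho> 0 = 1" "convergent_prod \<rho>"
    "\<And>k. k \<ge> 1 \<Longrightarrow> \<mu>inf \<le> \<mu> k" "\<And>k. k \<ge> 1 \<Longrightarrow> L k \<le> Linf" "\<And>k. k \<ge> 1 \<Longrightarrow> 1 \<le> \<rho> k"
    "\<And>k. k \<ge> 1 \<Longrightarrow> AE \<omega> in \<Omega>. \<forall>v. \<mu> k * mnorm (M k \<omega>) v \<le> norm v \<and> norm v \<le> L k * mnorm (M k \<omega>) v"
    "\<And>k v. k \<ge> 1 \<Longrightarrow> v \<noteq> 0 \<Longrightarrow> AE \<omega> in \<Omega>. real_cond_exp \<Omega> (minibatch_filtration \<Omega> P m S (k - 1))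
        (\<lambda>\<omega>. (mnorm (M k \<omega>) v)\<^sup>2 / (mnorm (M (k - 1) \<omega>) v)\<^sup>2) \<omega> \<le> (\<rho> k)\<^sup>2"
    using asm(5) by (auto simp: preconditioner_condition_def Let_def)
  have spd: "\<omega> \<in> space \<Omega> \<Longrightarrow> spd (M k \<omega>)" and M0: "\<omega> \<in> space \<Omega> \<Longrightarrow> M 0 \<omega> = id" for k \<omega>
    using ispp(3) by (auto simp: preconditioners_def)
  note \<rho>bd = convergent_prod_ge_1_bounds[OF pc(5,4,8)]
  obtain C where C: "\<And>n. (\<Prod>i<n. (\<rho> (Suc i))\<^sup>2) \<le> C" using \<rho>bd(2) by blast
  obtain \<omega>0 where \<omega>0: "\<omega>0 \<in> space \<Omega>" using Om.not_empty by blast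
  have apos: "0 < \<alpha>bar (Suc n)" for n
    using ispp(6)[of "Suc n" \<omega>0] asm(23) \<omega>0 by (auto simp: zero_less_divide_iff)
  have a_bdd: "bdd_above (\<alpha>bar ` {1..})"
  proof -
    have "Bseq (\<lambda>k. (\<alpha>bar (Suc k))\<^sup>2)" using asm(26) summable_imp_Bseq by blast
    then obtain D where D: "\<And>k. \<bar>(\<alpha>bar (Suc k))\<^sup>2\<bar> \<le> D" by (auto simp: Bseq_def)
    have "\<alpha>bar k \<le> sqrt D" if "k \<ge> 1" for k
      using D[of "k - 1"] that by (intro real_le_rsqrt) simp
    then show ?thesis by (intro bdd_aboveI2[where M = "sqrt D"]) auto
  qed
  \<comment> \<open>the accuracy bound at two distinct points is nonnegative\<close>
  have \<eta>0: "0 \<le> \<eta>bar"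
  proof -
    obtain s where s: "\<And>z u. \<bar>ereal (fm z u s) - f u s\<bar> \<le> ereal (\<eta>bar / 2 * (norm (u - z))\<^sup>2)"
      using eventually_happens'[OF P.ae_filter_bot acc] by blast
    obtain e :: 'a where e: "e \<in> Basis" using nonempty_Basis by blast
    have "0 \<le> \<bar>ereal (fm 0 e s) - f e s\<bar>" by simp
    also have "\<dots> \<le> ereal (\<eta>bar / 2 * (norm (e - 0))\<^sup>2)" by (rule s)
    finally show ?thesis using e by simp
  qed
  have \<tau>0: "0 \<le> \<tau>bar" using asm(6) by (simp add: regularity_def)
  have fm_meas: "(\<lambda>(z, u, s). fm z u s) \<in> borel_measurable (borel \<Otimes>\<^sub>M borel \<Otimes>\<^sub>M P)"
  proof -
    have "restrict_space borel (UNIV :: 'a set) = borel"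
      by (rule measure_eqI) (auto simp: sets_restrict_space emeasure_restrict_space)
    then show ?thesis using asm(3) by (simp add: model_family_def V)
  qed
  have f_int: "integrable P (\<lambda>s. real_of_ereal (f u s))" for u
    using asm(6) by (simp add: regularity_def)
  have fm_int: "integrable P (fm z u)" for z u
  proof (rule Bochner_Integration.integrable_bound)
    show "integrable P (\<lambda>s. \<bar>real_of_ereal (f u s)\<bar> + \<eta>bar / 2 * (norm (u - z))\<^sup>2)"
      by (intro Bochner_Integration.integrable_add integrable_abs f_int P.integrable_const)
    have "(\<lambda>s. (z, u, s)) \<in> measurable P (borel \<Otimes>\<^sub>M borel \<Otimes>\<^sub>M P)" by measurable
    from measurable_compose[OF this fm_meas] show "fm z u \<in> borel_measurable P" by simp
    show "AE s in P. norm (fm z u s) \<le> norm (\<bar>real_of_ereal (f u s)\<bar> + \<eta>bar / 2 * (norm (u - z))\<^sup>2)"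
      using acc
    proof eventually_elim
      case (elim s)
      then have le: "\<bar>ereal (fm z u s) - f u s\<bar> \<le> ereal (\<eta>bar / 2 * (norm (u - z))\<^sup>2)" by blast
      then obtain v where v: "f u s = ereal v" by (cases "f u s") auto
      have "\<bar>fm z u s - v\<bar> \<le> \<eta>bar / 2 * (norm (u - z))\<^sup>2" using le by (simp add: v)
      then have "\<bar>fm z u s\<bar> \<le> \<bar>v\<bar> + \<eta>bar / 2 * (norm (u - z))\<^sup>2" by linarith
      also have "\<dots> \<le> \<bar>\<bar>v\<bar> + \<eta>bar / 2 * (norm (u - z))\<^sup>2\<bar>" by (rule abs_ge_self)
      finally show ?case by (simp add: v)
    qed
  qed
  have fm_mean: "\<bar>(\<integral>s. fm z u s \<partial>P) - expected_loss P f u\<bar> \<le> \<eta>bar / 2 * (norm (u - z))\<^sup>2" for z u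
  proof -
    have "\<bar>(\<integral>s. fm z u s \<partial>P) - expected_loss P f u\<bar> = \<bar>\<integral>s. fm z u s - real_of_ereal (f u s) \<partial>P\<bar>"
      by (simp add: expected_loss_def fm_int f_int)
    also have "\<dots> \<le> (\<integral>s. \<bar>fm z u s - real_of_ereal (f u s)\<bar> \<partial>P)" by (rule integral_abs_bound)
    also have "\<dots> \<le> (\<integral>s. \<eta>bar / 2 * (norm (u - z))\<^sup>2 \<partial>P)"
    proof (rule integral_mono_AE)
      show "AE s in P. \<bar>fm z u s - real_of_ereal (f u s)\<bar> \<le> \<eta>bar / 2 * (norm (u - z))\<^sup>2"
        using acc
      proof eventually_elim
        case (elim s)
        then have "\<bar>ereal (fm z u s) - f u s\<bar> \<le> ereal (\<eta>bar / 2 * (norm (u - z))\<^sup>2)" by blast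
        then show ?case by (cases "f u s") auto
      qed
    qed (auto intro!: integrable_abs Bochner_Integration.integrable_diff fm_int f_int)
    finally show ?thesis by (simp add: P.prob_space)
  qed
  have \<psi>_curved: "AE s in P. \<forall>z. curved id (- \<tau>bar) (\<lambda>u. \<psi> z u s)"
  proof -
    have "AE s in P. proper_fun (\<lambda>x. f x s) \<and> closed_fun (\<lambda>x. f x s) \<and> edom r \<subseteq> edom (\<lambda>x. f x s) \<and>
        (\<forall>x\<in>V. weakly_convex \<tau>bar (\<lambda>y. model_obj fm r x y s))"
      using asm(6) unfolding regularity_def by blast
    then show ?thesis
      by eventually_elim (auto simp: V model intro!: weakly_convex_imp_curved)
  qed
  have \<psi>_lower: "AE s in P. \<forall>z u. \<psi> z z s - L\<phi> s * G (norm z) * norm (u - z) - \<tau>bar / 2 * (norm (u - z))\<^sup>2 \<le> \<psi> z u s"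
    using \<psi>_curved asm(16)[unfolded local_lipschitz_growth_def V]
  proof eventually_elim
    case (elim s)
    show ?case
    proof (intro allI)
      fix z u
      interpret spd_map "id :: 'a \<Rightarrow> 'a" by unfold_locales (rule spd_id)
      have ev: "\<forall>\<^sub>F w in nhds z. \<bar>\<psi> z z s - \<psi> z w s\<bar> \<le> L\<phi> s * G (norm z) * norm (z - w)"
        using elim(2)[rule_format, of z z] by (simp add: model)
      have "((\<lambda>t. z + t *\<^sub>R (u - z)) \<longlongrightarrow> z + 0 *\<^sub>R (u - z)) (at_right 0)" by (intro tendsto_intros)
      then have "filterlim (\<lambda>t. z + t *\<^sub>R (u - z)) (nhds z) (at_right 0)" by simp
      from eventually_compose_filterlim[OF ev this]
      have "\<forall>\<^sub>F t in at_right 0. (- (L\<phi> s * G (norm z) * norm (u - z))) * t \<le> \<psi> z (z + t *\<^sub>R (u - z)) s - \<psi> z z s"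
        using eventually_at_right_less[of 0]
      proof eventually_elim
        case (elim t)
        then show ?case by (simp add: abs_le_iff mult_ac)
      qed
      from curved_slope[OF elim(1)[rule_format, of z] this]
      show "\<psi> z z s - L\<phi> s * G (norm z) * norm (u - z) - \<tau>bar / 2 * (norm (u - z))\<^sup>2 \<le> \<psi> z u s"
        by (simp add: mnorm_id)
    qed
  qed
  interpret mp: model_prox_process \<Omega> P m S M "\<lambda>n. x (Suc n)" x1 "\<lambda>n. \<alpha>bar (Suc n)" "\<lambda>n. (\<rho> (Suc n))\<^sup>2"
    \<psi> \<phi> L\<phi> G \<tau>bar \<eta>bar "1 / \<mu>inf" Linf \<rho>bar \<gamma> "SUP k\<in>{1..}. \<alpha>bar k" B\<rho> C
    "real_of_ereal (INF y. objective P f r y)"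
    "minibatch_filtration \<Omega> P m S"
    "\<lambda>n \<omega>. \<alpha>bar (Suc n) / max 1 (G (norm (x (Suc n) \<omega>)))"
    "\<lambda>n \<omega> u. 1 / real m * (\<Sum>i=1..m. \<psi> (x (Suc n) \<omega>) u (S (Suc n) i \<omega>))"
  proof unfold_locales
    show "1 \<le> m" "iid_minibatches \<Omega> P m S" "preconditioners \<Omega> (minibatch_filtration \<Omega> P m S) M" "1 \<le> Linf"
      by fact+
    show "AE \<omega> in \<Omega>. \<forall>v. mnorm (M n \<omega>) v \<le> 1 / \<mu>inf * norm v \<and> norm v \<le> Linf * mnorm (M n \<omega>) v" for n
    proof (cases "n = 0")
      case True
      have "norm v \<le> 1 / \<mu>inf * norm v" "norm v \<le> Linf * norm v" for v :: 'a
        using pc(1,2,3) by (auto simp: le_divide_eq mult_le_cancel_left1 mult_le_cancel_right1 mult_left_le)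
      then show ?thesis using M0 True by (intro AE_I2) (simp add: mnorm_id)
    next
      case False
      then have n: "n \<ge> 1" by simp
      show ?thesis using pc(9)[OF n] AE_space
      proof eventually_elim
        case (elim \<omega>)
        interpret spd_map "M n \<omega>" using spd elim by unfold_locales auto
        show ?case
        proof
          fix v
          have "\<mu>inf * mnorm (M n \<omega>) v \<le> \<mu> n * mnorm (M n \<omega>) v"
            using pc(6)[OF n] mnorm_nonneg by (intro mult_right_mono) auto
          also have "\<dots> \<le> norm v" using elim by blast
          finally have 1: "mnorm (M n \<omega>) v \<le> 1 / \<mu>inf * norm v" using pc(1) by (simp add: field_simps)
          have "norm v \<le> L n * mnorm (M n \<omega>) v" using elim by blast
          also have "\<dots> \<le> Linf * mnorm (M n \<omega>) v"
            using pc(7)[OF n] mnorm_nonneg by (intro mult_right_mono) auto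
          finally show "mnorm (M n \<omega>) v \<le> 1 / \<mu>inf * norm v \<and> norm v \<le> Linf * mnorm (M n \<omega>) v" using 1 by blast
        qed
      qed
    qed
    show "AE \<omega> in \<Omega>. real_cond_exp \<Omega> (minibatch_filtration \<Omega> P m S n)
        (\<lambda>\<omega>. (mnorm (M (Suc n) \<omega>) v)\<^sup>2 / (mnorm (M n \<omega>) v)\<^sup>2) \<omega> \<le> (\<rho> (Suc n))\<^sup>2" if "v \<noteq> 0" for n v
      using pc(10)[of "Suc n" v] that by simp
    show "1 \<le> (\<rho> (Suc n))\<^sup>2" for n using pc(8)[of "Suc n"] by simp
    show "(\<rho> (Suc n))\<^sup>2 \<le> B\<rho>" for n unfolding asm(19) by (rule cSUP_upper[OF _ \<rho>bd(1)]) simp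
    show "(\<Prod>i<n. (\<rho> (Suc i))\<^sup>2) \<le> C" for n by (rule C)
    show "(\<lambda>(z, u, s). \<psi> z u s) \<in> borel_measurable (borel \<Otimes>\<^sub>M borel \<Otimes>\<^sub>M P)"
    proof -
      have "closed {u. rr u \<le> t}" for t
      proof -
        have "closed ((\<lambda>u. (u, t)) -` eepigraph r)"
          using asm(6) by (intro continuous_closed_vimage) (auto simp: regularity_def closed_fun_def intro!: continuous_intros)
        moreover have "(\<lambda>u. (u, t)) -` eepigraph r = {u. rr u \<le> t}" by (auto simp: eepigraph_def r_eq)
        ultimately show ?thesis by simp
      qed
      then have [measurable]: "rr \<in> borel_measurable borel"
        by (intro borel_measurable_iff_le[THEN iffD2]) auto
      note [measurable] = fm_meas
      have "(\<lambda>p. (case p of (z, u, s) \<Rightarrow> fm z u s) + rr (fst (snd p))) \<in> borel_measurable (borel \<Otimes>\<^sub>M borel \<Otimes>\<^sub>M P)"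
        by measurable
      then show ?thesis by (simp add: \<psi>_def split_beta')
    qed
    show "integrable P (\<psi> z u)" for z u
      unfolding \<psi>_def using fm_int[of z u] by simp
    show "\<bar>(\<integral>s. \<psi> z u s \<partial>P) - \<phi> u\<bar> \<le> \<eta>bar / 2 * (norm (u - z))\<^sup>2" for z u
      using fm_mean[of z u] by (simp add: \<psi>_def \<phi>_def fm_int P.prob_space)
    show "AE s in P. \<forall>z. curved id (- \<tau>bar) (\<lambda>u. \<psi> z u s)" by (rule \<psi>_curved)
    show "AE s in P. \<forall>z u. \<psi> z z s - L\<phi> s * G (norm z) * norm (u - z) - \<tau>bar / 2 * (norm (u - z))\<^sup>2 \<le> \<psi> z u s"
      by (rule \<psi>_lower)
    show "L\<phi> \<in> borel_measurable P" "\<And>s. s \<in> space P \<Longrightarrow> 0 \<le> L\<phi> s" "integrable P (\<lambda>s. (L\<phi> s)\<^sup>2)"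
      "continuous_on {0..} G" "mono_on {0..} G" "\<And>u. 0 \<le> u \<Longrightarrow> 0 \<le> G u"
      using asm by auto
    show "real_of_ereal (INF y. objective P f r y) \<le> \<phi> u" for u
    proof -
      have "(INF y. objective P f r y) \<le> ereal (\<phi> u)" unfolding obj by (rule INF_lower) simp
      then show ?thesis using asm(7) by (cases "INF y. objective P f r y") auto
    qed
    show "bounded {u. \<phi> u \<le> t}" for t using asm(8) by (simp add: obj)
    show "0 \<le> \<tau>bar" "0 \<le> \<eta>bar" by fact+
    show "B\<rho> * (Linf\<^sup>2 * \<eta>bar + 2 * (Linf\<^sup>2 * \<tau>bar)) < \<rho>bar" using asm(17,18,22) by simp
    show "0 < \<alpha>bar (Suc n)" for n by (rule apos)
    show "\<alpha>bar (Suc n) \<le> (SUP k\<in>{1..}. \<alpha>bar k)" for n by (rule cSUP_upper[OF _ a_bdd]) simp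
    show "(SUP k\<in>{1..}. \<alpha>bar k) < 1 / (2 * \<rho>bar)" "summable (\<lambda>n. (\<alpha>bar (Suc n))\<^sup>2)" "0 \<le> \<gamma>" by fact+
    show "x (Suc 0) \<omega> = x1" if "\<omega> \<in> space \<Omega>" for \<omega> using ispp(5)[OF that] by simp
    show "x (Suc n) \<in> borel_measurable (minibatch_filtration \<Omega> P m S n)" for n
    proof (cases "n = 0")
      case True
      have "(\<lambda>\<omega>. x1) \<in> borel_measurable (minibatch_filtration \<Omega> P m S 0)" by simp
      then have "x 1 \<in> borel_measurable (minibatch_filtration \<Omega> P m S 0)"
        using ispp(5) by (subst measurable_cong[where g = "\<lambda>\<omega>. x1"]) (auto simp: space_minibatch_filtration)
      then show ?thesis using True by simp
    qed (use ispp(7) in simp)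
    show "AE \<omega> in \<Omega>. inexact_prox_step (Linf\<^sup>2 * \<tau>bar) (M (Suc n) \<omega>) (\<alpha>bar (Suc n) / max 1 (G (norm (x (Suc n) \<omega>))))
        (\<gamma> * (\<alpha>bar (Suc n) / max 1 (G (norm (x (Suc n) \<omega>))))\<^sup>2)
        (\<lambda>u. ereal (1 / real m * (\<Sum>i=1..m. \<psi> (x (Suc n) \<omega>) u (S (Suc n) i \<omega>)))) (x (Suc n) \<omega>) (x (Suc (Suc n)) \<omega>)" for n
    proof -
      have mb: "minibatch_obj m fm r z u ss = ereal (1 / real m * (\<Sum>i=1..m. \<psi> z u (ss i)))" for z u ss
        using ispp(1) by (simp add: minibatch_obj_def minibatch_model_def \<psi>_def r_eq sum.distrib field_simps)
      have "AE \<omega> in \<Omega>. inexact_prox_step \<tau> (M (Suc n) \<omega>) (\<alpha> (Suc n) \<omega>) (\<epsilon> (Suc n) \<omega>)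
             (\<lambda>u. minibatch_obj m fm r (x (Suc n) \<omega>) u (\<lambda>i. S (Suc n) i \<omega>)) (x (Suc n) \<omega>) (x (Suc (Suc n)) \<omega>)"
        by (rule ispp(8)) simp
      then show ?thesis using AE_space
      proof eventually_elim
        case (elim \<omega>)
        have "\<alpha> (Suc n) \<omega> = \<alpha>bar (Suc n) / max 1 (G (norm (x (Suc n) \<omega>)))"
          "\<epsilon> (Suc n) \<omega> = \<gamma> * (\<alpha> (Suc n) \<omega>)\<^sup>2" using asm(23,24) elim(2) by auto
        with elim(1) show ?case by (simp only: mb asm(18))
      qed
    qed
  qed
  note main = mp.iterates_bounded_gaps_vanish
  show ?thesis
  proof (intro conjI impI)
    show "AE \<omega> in \<Omega>. (SUP k\<in>{1..}. ereal (norm (x k \<omega>))) < \<infinity>"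
      using main
    proof eventually_elim
      case (elim \<omega>)
      then obtain R where R: "\<And>n. norm (x (Suc n) \<omega>) \<le> R" by blast
      have "(SUP k\<in>{1..}. ereal (norm (x k \<omega>))) \<le> ereal R"
      proof (rule SUP_least)
        fix k :: nat assume "k \<in> {1..}"
        then show "ereal (norm (x k \<omega>)) \<le> ereal R" using R[of "k - 1"] by simp
      qed
      then show ?case by (rule le_less_trans) simp
    qed
    assume ns: "\<not> summable (\<lambda>k. \<alpha>bar (Suc k))"
    have "AE \<omega> in \<Omega>. \<forall>n. mp.good n \<omega>" unfolding AE_all_countable using mp.AE_good by blast
    moreover have "AE \<omega> in \<Omega>. \<forall>n. \<forall>u. mp.h n \<omega> (mp.y n \<omega>) \<le> mp.h n \<omega> u"
      unfolding AE_all_countable[where P = "\<lambda>n \<omega>. \<forall>u. mp.h n \<omega> (mp.y n \<omega>) \<le> mp.h n \<omega> u"] using mp.y_min by blast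
    ultimately show "AE \<omega> in \<Omega>.
        (\<forall>k\<ge>1. (\<lambda>y. real_of_ereal (envelope (M (k - 1) \<omega>) (1 / \<rho>bar) (objective P f r) y))
                  differentiable (at (x k \<omega>))) \<and>
        liminf (\<lambda>k. ereal (norm (gradient
          (\<lambda>y. real_of_ereal (envelope (M (k - 1) \<omega>) (1 / \<rho>bar) (objective P f r) y))
          (x k \<omega>)))) = 0"
      using main
    proof eventually_elim
      case (elim \<omega>)
      define e where "e k = (\<lambda>y. real_of_ereal (envelope (M (k - 1) \<omega>) (1 / \<rho>bar) (objective P f r) y))" for k
      define g where "g k = norm (gradient (e k) (x k \<omega>))" for k
      have grad: "\<exists>v. GDERIV (e (Suc n)) (x (Suc n) \<omega>) :> v \<and> norm v \<le> \<rho>bar * (1 / \<mu>inf * sqrt (mp.D n \<omega>))" for n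
        using mp.envelope_gradient[of n \<omega>] elim(1,2) unfolding e_def obj by (metis diff_Suc_1)
      have diff: "e k differentiable (at (x k \<omega>))" if "k \<ge> 1" for k
        using grad[of "k - 1"] that unfolding differentiable_def gderiv_def by auto
      have g_le: "g (Suc n) \<le> \<rho>bar * (1 / \<mu>inf * sqrt (mp.D n \<omega>))" for n
        using grad[of n] gradient_eq unfolding g_def by blast
      have "liminf (\<lambda>k. ereal (g k)) = 0"
      proof (rule antisym)
        show "0 \<le> liminf (\<lambda>k. ereal (g k))" by (rule Liminf_bounded) (simp add: g_def)
        show "liminf (\<lambda>k. ereal (g k)) \<le> 0"
        proof (rule ccontr)
          assume "\<not> ?thesis"
          then obtain d where d: "0 < ereal d" "ereal d < liminf (\<lambda>k. ereal (g k))"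
            using ereal_dense2[of 0 "liminf (\<lambda>k. ereal (g k))"] by (auto simp: not_le)
          from less_LiminfD[OF d(2)] obtain N where N: "\<And>k. k \<ge> N \<Longrightarrow> d < g k"
            by (auto simp: eventually_sequentially)
          \<comment> \<open>the value of the gap at which the bound \<open>g_le\<close> on the gradient equals \<open>d\<close>\<close>
          define c where "c = (d * \<mu>inf / \<rho>bar)\<^sup>2"
          have "0 < c" using d pc(1) mp.\<rho> by (simp add: c_def)
          then obtain n where n: "n \<ge> N" "mp.D n \<omega> < c" using elim(3) ns by blast
          have "sqrt (mp.D n \<omega>) \<le> sqrt c" using n by simp
          also have "\<dots> = d * \<mu>inf / \<rho>bar" using d pc(1) mp.\<rho> by (simp add: c_def)
          finally have "\<rho>bar * (1 / \<mu>inf * sqrt (mp.D n \<omega>)) \<le> \<rho>bar * (1 / \<mu>inf * (d * \<mu>inf / \<rho>bar))"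
            using pc(1) mp.\<rho> by (intro mult_left_mono) auto
          also have "\<dots> = d" using pc(1) mp.\<rho> by simp
          finally have "g (Suc n) \<le> d" using g_le[of n] by linarith
          with N[of "Suc n"] n show False by simp
        qed
      qed
      with diff show ?case by (simp add: g_def e_def)
    qed
  qed
qed

end
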